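(* Let $m \geq n$, $A \in \mathbb{C}^{m\times m}$ and $B \in \mathbb{C}^{n \times n}$ be normal matrices, and let $X \in \mathbb{C}^{m\times n}$ satisfy $AX - XB = F$. Let $a, b \in \mathbb{R}$ with $0 < a < b$, and suppose that every eigenvalue of $A$ lies in $[-b,-a]$ and every eigenvalue of $B$ lies in $[a,b]$. Set $\mu_2 = \exp\left(\pi^2/\log(4b/a)\right)$. Suppose that there is a constant $K \geq 1$ such that $\sigma_{j+1}(F) \leq K \mu_2^{-j}\|F\|_2$ for all $0 \leq j < n$. Then for every triangular number $t = k(k+1)/2$ (with $k$ a positive integer) satisfying $1 \leq t < n$, \[ \sigma_{t+1}(X) \leq \frac{K b}{a}\left(6\sqrt{t} + 1\right) \mu_2^{-(\sqrt{8t+1}-1)/2}\, \|X\|_2 . \]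
   Context: For a matrix $M$, $\sigma_j(M)$ denotes its $j$th largest singular value, with $\sigma_j(M) = 0$ if $j$ exceeds the smaller dimension of $M$, and $\|M\|_2 = \sigma_1(M)$ is the spectral norm. *)

theory Defs
  imports "Jordan_Normal_Form.Schur_Decomposition" "HOL-Computational_Algebra.Polynomial"
begin

text \<open>Singular values of a complex matrix M (of any shape), in non-increasing order,
  counted with multiplicity: square roots of the eigenvalues (roots of the
  characteristic polynomial, with multiplicity) of M^H M.  The list has length
  dim_col M; the entries beyond min(dim_row M, dim_col M) are 0.\<close>
definition sing_vals :: "complex mat \<Rightarrow> real list" where
  "sing_vals M = rev (sorted_list_of_multiset
      (image_mset (\<lambda>z. sqrt (Re z)) (proots (char_poly (mat_adjoint M * M)))))"

definition sigma :: "nat \<Rightarrow> complex mat \<Rightarrow> real" where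
  "sigma j M = (if 1 \<le> j \<and> j \<le> length (sing_vals M) then sing_vals M ! (j - 1) else 0)"

definition spec_norm :: "complex mat \<Rightarrow> real" where
  "spec_norm M = sigma 1 M"

definition normal_mat :: "complex mat \<Rightarrow> bool" where
  "normal_mat A \<longleftrightarrow> A * mat_adjoint A = mat_adjoint A * A"

end

theory Submission
  imports "HOL-Analysis.Gamma_Function" "HOL-Analysis.Infinite_Products"
    "HOL-Real_Asymp.Real_Asymp" "HOL-Library.Nat_Bijection" Defs
begin

text \<open>
  After unitary diagonalization of \<open>A\<close> and \<open>B\<close>, the equation reads
  \<open>- (\<alpha>\<^sub>p + \<beta>\<^sub>q) X\<^sub>p\<^sub>q = F\<^sub>p\<^sub>q\<close> with \<open>\<alpha>\<^sub>p, \<beta>\<^sub>q \<in> [a, b]\<close>. Split \<open>F\<close> by its singular value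
  decomposition into rank one terms \<open>F\<^sub>j\<close> with \<open>j < k\<close> and a tail of norm \<open>\<sigma>\<^sub>k\<^sub>+\<^sub>1(F)\<close>, and \<open>X\<close> accordingly.
  For a rational function \<open>r\<close> with zeros \<open>p\<^sub>i > 0\<close> and poles \<open>- p\<^sub>i\<close>, \<open>i < l\<close>, the solution \<open>X\<^sub>j\<close> differs from
  \<open>r(\<alpha>) X\<^sub>j r(\<beta>)\<close> by a matrix of rank at most \<open>l\<close>. Zolotarev's choice of the \<open>p\<^sub>i\<close> makes
  \<open>|r|\<^sup>2 \<le> 4 \<mu>\<^sub>2\<^sup>-\<^sup>l\<close> on \<open>[a, b]\<close>. Using \<open>l = k - j\<close> for \<open>X\<^sub>j\<close>, the total rank is \<open>k (k + 1) / 2 = t\<close> and every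
  error is at most \<open>4 K \<mu>\<^sub>2\<^sup>-\<^sup>k \<parallel>F\<parallel> / (2 a)\<close>, where \<open>\<parallel>F\<parallel> \<le> 2 b \<parallel>X\<parallel>\<close>. The constant obtained is
  \<open>4 k + 1 \<le> 6 \<surd>t + 1\<close>.
\<close>

unbundle no vec_syntax

subsection \<open>Partial fractions of the hyperbolic functions\<close>

text \<open>Entrywise division by \<open>\<alpha> p + \<beta> q\<close> is a Schur multiplier:
  bounds on its entries give no operator norm bound that is free of the dimension. The norm
  estimates for solutions therefore use only row and column scalings, which do control the norm:
  Cayley factors for the bound by \<open>1 / (2 * a)\<close>, and \<open>r\<close> on either side
  for the rank reduction. Since \<open>r\<close> acts on both sides, the bound for it enters
  squared. The degrees \<open>k - j\<close> balance two kinds of decay: the term with index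
  \<open>j\<close> already carries \<open>j\<close> powers from the decay of \<open>F\<close>, so
  fewer zeros suffice for it. The analytic difficulty is the bound for \<open>r\<close> with
  explicit constants. Its zeros come from theta functions of nome \<open>exp (- L)\<close>, where
  the explicit \<open>L = ln (4 * b / a)\<close> replaces the exact elliptic modulus; it suffices
  that the parametrization covers \<open>{a..b}\<close>. The 4 in \<open>L\<close> is the square of
  the factor 2 in \<open>half_theta_odd_le\<close>, which counts the positive and the negative odd
  indices. The factor 2 in front of the exponential is \<open>exp (ln 2)\<close>, with
  \<open>ln 2\<close> the alternating harmonic sum. All hyperbolic series needed go back to the
  cotangent.\<close>

lemma Digamma_reflection_complex:
  fixes z :: complex
  assumes "z \<notin> \<int>"
  shows "Digamma (1 - z) - Digamma z = of_real pi * cot (of_real pi * z)"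
proof -
  have z: "z \<notin> \<int>\<^sub>\<le>\<^sub>0" "1 - z \<notin> \<int>\<^sub>\<le>\<^sub>0"
    using assms nonpos_Ints_Int Ints_1 by (blast, metis Ints_diff add_diff_cancel_left' diff_add_cancel nonpos_Ints_Int)
  \<comment> \<open>Product rule with derivative \<open>- rGamma z * Digamma z\<close> of
    \<open>rGamma\<close>. Comparing it with the derivative of the sine side of the reflection
    formula is the whole proof.\<close>
  let ?D = "rGamma z * (rGamma (1 - z) * Digamma (1 - z)) - (rGamma z * Digamma z) * rGamma (1 - z)"
  have "((\<lambda>w. rGamma w * rGamma (1 - w)) has_field_derivative ?D) (at z)"
    using z by (auto intro!: derivative_eq_intros simp: algebra_simps)
  moreover have "(\<lambda>w::complex. rGamma w * rGamma (1 - w)) = (\<lambda>w. sin (of_real pi * w) / of_real pi)"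
    by (rule ext) (rule rGamma_reflection_complex)
  moreover have "((\<lambda>w::complex. sin (of_real pi * w) / of_real pi) has_field_derivative cos (of_real pi * z)) (at z)"
    by (auto intro!: derivative_eq_intros)
  ultimately have "?D = cos (of_real pi * z)"
    by (metis DERIV_unique)
  then have eq: "rGamma z * rGamma (1 - z) * (Digamma (1 - z) - Digamma z) = cos (of_real pi * z)"
    by (simp add: algebra_simps)
  have nz: "rGamma z * rGamma (1 - z) \<noteq> 0"
    using z by (simp add: rGamma_eq_zero_iff)
  then have "sin (of_real pi * z) \<noteq> 0"
    unfolding rGamma_reflection_complex by simp
  with eq show ?thesis
    unfolding rGamma_reflection_complex by (simp add: cot_def field_simps)
qed

text \<open>The limit formulas for \<open>Digamma\<close> at \<open>1 - z\<close> and at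
  \<open>z\<close> contain the same logarithm, which cancels in the difference.\<close>

lemma cot_partial_fractions:
  fixes z :: complex
  assumes "z \<notin> \<int>"
  shows "(\<lambda>n. inverse (z + of_nat n) - inverse (1 - z + of_nat n)) sums (of_real pi * cot (of_real pi * z))"
proof -
  have "z \<noteq> 0" "1 - z \<noteq> 0" using assms by auto
  from tendsto_diff[OF Digamma_LIMSEQ[OF this(2)] Digamma_LIMSEQ[OF this(1)]]
  show ?thesis
    unfolding sums_def Digamma_reflection_complex[OF assms, symmetric]
    by (simp add: sum_subtractf algebra_simps)
qed

lemma tanh_real_of_real: "tanh (of_real x) = (of_real (tanh x) :: complex)"
  by (simp add: tanh_def sinh_def cosh_def scaleR_conv_of_real flip: exp_of_real)

lemma imaginary_notin_Ints:
  "y \<noteq> 0 \<Longrightarrow> Complex x y \<notin> \<int>"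
  by (metis Ints_cases complex.sel(2) complex_Im_of_int)

lemma tanh_partial_fractions:
  fixes x :: real
  shows "(\<lambda>n. 8 * x / (4 * x\<^sup>2 + pi\<^sup>2 * (2 * real n + 1)\<^sup>2)) sums tanh x"
proof (cases "x = 0")
  case False
  define y where "y = x / pi"
  have y: "y \<noteq> 0" using False by (simp add: y_def)
  \<comment> \<open>On the line with real part 1/2, the map from \<open>z\<close> to
    \<open>1 - z\<close> is conjugation, so the two halves of each cotangent term have opposite
    imaginary parts and their difference doubles them.\<close>
  define z where "z = Complex (1/2) y"
  have pz: "of_real pi * z = of_real (pi/2) + \<i> * of_real x"
    by (simp add: z_def complex_eq_iff y_def)
  have cot: "cot (of_real pi * z) = - \<i> * of_real (tanh x)"
  proof -
    have "cot (of_real pi * z) = - tan (\<i> * of_real x :: complex)"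
      unfolding pz cot_def tan_def
      by (subst sin_add, subst cos_add) (simp flip: sin_of_real cos_of_real)
    also have "tan (\<i> * of_real x :: complex) = \<i> * tanh (of_real x)"
      by (simp add: tanh_conv_tan)
    finally show ?thesis
      by (simp add: tanh_real_of_real)
  qed
  have "(\<lambda>n. inverse (z + of_nat n) - inverse (1 - z + of_nat n)) sums (of_real pi * (- \<i> * of_real (tanh x)))"
    using cot_partial_fractions[of z] imaginary_notin_Ints[OF y, of "1/2"] cot z_def by simp
  from sums_Im[OF this]
  have s: "(\<lambda>n. Im (inverse (z + of_nat n) - inverse (1 - z + of_nat n))) sums (- (pi * tanh x))"
    by simp
  have "Im (inverse (z + of_nat n) - inverse (1 - z + of_nat n)) = - 2 * y / ((1/2 + real n)\<^sup>2 + y\<^sup>2)" for n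
    by (simp add: z_def Im_divide power2_eq_square)
  then have "(\<lambda>n. - (1/pi) * (- 2 * y / ((1/2 + real n)\<^sup>2 + y\<^sup>2))) sums (- (1/pi) * - (pi * tanh x))"
    using sums_mult[OF s, of "- (1/pi)"] by simp
  moreover have "- (1/pi) * (- 2 * y / ((1/2 + real n)\<^sup>2 + y\<^sup>2)) = 8 * x / (4 * x\<^sup>2 + pi\<^sup>2 * (2 * real n + 1)\<^sup>2)" for n
  proof -
    have a: "(1/2 + real n)\<^sup>2 + y\<^sup>2 = (4 * x\<^sup>2 + pi\<^sup>2 * (2 * real n + 1)\<^sup>2) / (4 * pi\<^sup>2)"
      by (simp add: y_def field_simps power2_eq_square)
    have b: "4 * x\<^sup>2 + pi\<^sup>2 * (2 * real n + 1)\<^sup>2 \<noteq> 0"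
      using False by (metis add_nonneg_eq_0_iff mult_eq_0_iff mult_nonneg_nonneg zero_le_numeral zero_le_power2 zero_eq_power2 zero_neq_numeral)
    show ?thesis unfolding a using b by (simp add: y_def field_simps power2_eq_square)
  qed
  ultimately show ?thesis by simp
qed auto

lemma coth_partial_fractions:
  fixes x :: real
  assumes "x \<noteq> 0"
  shows "(\<lambda>n. 2 * x / (x\<^sup>2 + pi\<^sup>2 * (real n + 1)\<^sup>2)) sums (inverse (tanh x) - 1 / x)"
proof -
  define y where "y = x / pi"
  have y: "y \<noteq> 0" using assms by (simp add: y_def)
  define z where "z = Complex 0 y"
  have pz: "of_real pi * z = \<i> * of_real x"
    by (simp add: z_def complex_eq_iff y_def)
  have cot: "cot (of_real pi * z) = - \<i> * of_real (inverse (tanh x))"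
  proof -
    have "cot (of_real pi * z) = inverse (tan (\<i> * of_real x :: complex))"
      unfolding pz cot_def tan_def by simp
    also have "tan (\<i> * of_real x :: complex) = \<i> * tanh (of_real x)"
      by (simp add: tanh_conv_tan)
    finally show ?thesis
      by (simp add: tanh_real_of_real)
  qed
  have s0: "(\<lambda>n. inverse (z + of_nat n) - inverse (1 - z + of_nat n)) sums (of_real pi * (- \<i> * of_real (inverse (tanh x))))"
    using cot_partial_fractions[of z] imaginary_notin_Ints[OF y, of 0] cot z_def by simp
  define f where "f n = y / ((real n)\<^sup>2 + y\<^sup>2)" for n
  have im: "Im (inverse (z + of_nat n) - inverse (1 - z + of_nat n)) = - f n - f (Suc n)" for n
    by (simp add: z_def Im_divide power2_eq_square f_def algebra_simps)
  have s: "(\<lambda>n. - f n - f (Suc n)) sums (- (pi * inverse (tanh x)))"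
  proof -
    have "Im (of_real pi * (- \<i> * of_real q)) = - (pi * q)" for q by simp
    then show ?thesis using sums_Im[OF s0] unfolding im by metis
  qed
  have f0: "f \<longlonglongrightarrow> 0" unfolding f_def
    by real_asymp
  \<comment> \<open>On the imaginary axis the two halves of each term are offset by one index. A
    telescoping series aligns them and splits off \<open>f 0\<close>, which becomes the pole term
    \<open>1 / x\<close>.\<close>
  have "(\<lambda>n. f n - f (Suc n)) sums (f 0 - 0)"
    by (rule telescope_sums'[OF f0])
  from sums_add[OF s this]
  have "(\<lambda>n. - 2 * f (Suc n)) sums (f 0 - pi * inverse (tanh x))" by simp
  from sums_mult[OF this, of "- (1/pi)"]
  have "(\<lambda>n. (2/pi) * f (Suc n)) sums (inverse (tanh x) - f 0 / pi)"
    by (simp add: diff_divide_distrib inverse_eq_divide)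
  moreover have "f 0 / pi = 1 / x" using assms by (simp add: f_def y_def power2_eq_square)
  moreover have "(2/pi) * f (Suc n) = 2 * x / (x\<^sup>2 + pi\<^sup>2 * (real n + 1)\<^sup>2)" for n
  proof -
    have a: "(real (Suc n))\<^sup>2 + y\<^sup>2 = (x\<^sup>2 + pi\<^sup>2 * (real n + 1)\<^sup>2) / (pi\<^sup>2)"
      by (simp add: y_def field_simps power2_eq_square)
    have b: "x\<^sup>2 + pi\<^sup>2 * (real n + 1)\<^sup>2 \<noteq> 0"
      using assms by (metis add_nonneg_eq_0_iff mult_nonneg_nonneg zero_le_power2 zero_eq_power2)
    show ?thesis unfolding f_def a using b by (simp add: y_def field_simps power2_eq_square)
  qed
  ultimately show ?thesis by simp
qed

lemma odd_inverse_squares_sums: "(\<lambda>n. 1 / (2 * real n + 1)\<^sup>2) sums (pi\<^sup>2 / 8)"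
proof -
  have "(\<lambda>n. \<Sum>i\<in>{n*2..<n*2+2}. 1 / (real i + 1)\<^sup>2) sums (pi\<^sup>2 / 6)"
    using inverse_squares_sums by (intro sums_group) (auto simp: add.commute)
  moreover have "(\<Sum>i\<in>{n*2..<n*2+2}. 1 / (real i + 1)\<^sup>2) = 1 / (2 * real n + 1)\<^sup>2 + 1 / (2 * real n + 2)\<^sup>2" for n
    by (simp add: numeral_2_eq_2 algebra_simps)
  ultimately have 1: "(\<lambda>n. 1 / (2 * real n + 1)\<^sup>2 + 1 / (2 * real n + 2)\<^sup>2) sums (pi\<^sup>2 / 6)"
    by simp
  have "(\<lambda>n. (1/4) * (1 / (real n + 1)\<^sup>2)) sums ((1/4) * (pi\<^sup>2 / 6))"
    using inverse_squares_sums by (intro sums_mult) (auto simp: add.commute)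
  moreover have "(1/4) * (1 / (real n + 1)\<^sup>2) = 1 / (2 * real n + 2)\<^sup>2" for n
    by (simp add: power2_eq_square field_simps)
  ultimately have 2: "(\<lambda>n. 1 / (2 * real n + 2)\<^sup>2) sums (pi\<^sup>2 / 24)" by simp
  from sums_diff[OF 1 2] show ?thesis by simp
qed

section \<open>Bounds for \<open>1 / sinh\<close> and for products of \<open>tanh\<close>\<close>

text \<open>Half the difference of \<open>coth (x/2)\<close> and \<open>tanh (x/2)\<close> is
  \<open>1 / sinh x\<close>, so the two expansions interlace to an alternating series with
  decreasing terms. It is subtracted from \<open>1 / x\<close>, and a partial sum with an odd number
  of terms overestimates it.\<close>

lemma inverse_sinh_ge:
  fixes x :: real
  assumes "x > 0"
  shows "1 / x - (\<Sum>k<2*N+1. (-1)^k * (2 * x / (x\<^sup>2 + pi\<^sup>2 * (real k + 1)\<^sup>2))) \<le> 1 / sinh x"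
proof -
  define e where "e k = 2 * x / (x\<^sup>2 + pi\<^sup>2 * (real k + 1)\<^sup>2)" for k :: nat
  have pos: "0 < x\<^sup>2 + pi\<^sup>2 * (real k + 1)\<^sup>2" for k
    using assms by (simp add: add_pos_nonneg)
  have anti: "e (Suc k) \<le> e k" for k
    unfolding e_def by (intro divide_left_mono add_left_mono mult_left_mono power_mono mult_pos_pos pos) (use assms in auto)
  have "(\<lambda>n. 2 * e (2*n+1)) sums (inverse (tanh (x/2)) - 2 / x)"
  proof -
    have "2 * e (2*n+1) = 2 * (x/2) / ((x/2)\<^sup>2 + pi\<^sup>2 * (real n + 1)\<^sup>2)" for n
    proof -
      have a: "(x/2)\<^sup>2 + pi\<^sup>2 * (real n + 1)\<^sup>2 = (x\<^sup>2 + pi\<^sup>2 * (real (2*n+1) + 1)\<^sup>2) / 4"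
        by (simp add: power2_eq_square field_simps)
      show ?thesis unfolding a e_def by simp
    qed
    then show ?thesis using coth_partial_fractions[of "x/2"] assms by simp
  qed
  moreover have "(\<lambda>n. 2 * e (2*n)) sums tanh (x/2)"
  proof -
    have "2 * e (2*n) = 8 * (x/2) / (4 * (x/2)\<^sup>2 + pi\<^sup>2 * (2 * real n + 1)\<^sup>2)" for n
      by (simp add: e_def power_divide)
    then show ?thesis using tanh_partial_fractions[of "x/2"] by simp
  qed
  ultimately have "(\<lambda>n. 2 * e (2*n+1) - 2 * e (2*n)) sums (inverse (tanh (x/2)) - 2 / x - tanh (x/2))"
    by (rule sums_diff)
  from sums_mult[OF this, of "1/2"]
  have s: "(\<lambda>n. e (2*n+1) - e (2*n)) sums ((inverse (tanh (x/2)) - tanh (x/2)) / 2 - 1 / x)"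
    by (simp add: algebra_simps diff_divide_distrib)
  have "(inverse (tanh (x/2)) - tanh (x/2)) / 2 = 1 / sinh x"
  proof -
    have sp: "sinh (x/2) > 0" "cosh (x/2) > 0" using assms by auto
    have "sinh x = 2 * sinh (x/2) * cosh (x/2)" using sinh_double[of "x/2"] by simp
    moreover have "(cosh (x/2))\<^sup>2 = (sinh (x/2))\<^sup>2 + 1" using hyperbolic_pythagoras[of "x/2"] by simp
    ultimately show ?thesis using sp by (simp add: tanh_def field_simps power2_eq_square)
  qed
  with s have s: "(\<lambda>n. e (2*n+1) - e (2*n)) sums (1 / sinh x - 1 / x)" by simp
  have e0: "(\<lambda>n. e (2*n)) \<longlonglongrightarrow> 0" unfolding e_def by real_asymp
  \<comment> \<open>Regrouping: with this telescoping series added, the terms become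
    \<open>e (2*n+1) - e (2*n+2)\<close>, which are nonnegative, so that truncation gives a lower
    bound.\<close>
  have "(\<lambda>n. e (2*n) - e (2*(Suc n))) sums (e (2*0) - 0)"
    using telescope_sums'[OF e0] by simp
  from sums_add[OF s this]
  have t: "(\<lambda>n. e (2*n+1) - e (2*n+2)) sums (1 / sinh x - 1 / x + e 0)" by simp
  have "(\<Sum>n<N. e (2*n+1) - e (2*n+2)) \<le> 1 / sinh x - 1 / x + e 0"
    using anti by (subst sums_unique[OF t]) (intro sum_le_suminf sums_summable[OF t], auto)
  moreover have "(\<Sum>k<2*N+1. (-1)^k * e k) = e 0 - (\<Sum>n<N. e (2*n+1) - e (2*n+2))"
    by (induction N) auto
  ultimately show ?thesis by (simp add: e_def)
qed

text \<open>With \<open>y = exp (- x)\<close>, minus the logarithm of \<open>tanh (x/2)\<close> is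
  \<open>ln ((1 + y) / (1 - y))\<close>. Its series in odd powers of \<open>y\<close> has positive
  terms and may be truncated.\<close>

lemma tanh_half_le:
  fixes x :: real
  assumes "x > 0"
  shows "tanh (x/2) \<le> exp (- (\<Sum>i<M. 2 * exp (- (2 * real i + 1) * x) / (2 * real i + 1)))"
proof -
  define y where "y = exp (-x)"
  have y: "0 < y" "y < 1" using assms by (auto simp: y_def)
  have th: "tanh (x/2) = (1 - y) / (1 + y)"
    by (simp add: tanh_real_altdef y_def)
  define w where "w = (1 + y) / (1 - y)"
  have w: "w > 0" using y by (simp add: w_def)
  have wy: "(w - 1) / (w + 1) = y" using y by (simp add: w_def field_simps)
  have s: "(\<lambda>n. 2 * y ^ (2*n+1) / real (2*n+1)) sums ln w"
    using ln_series_quadratic[OF w] unfolding wy by (simp add: mult_ac)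
  have "(\<Sum>i<M. 2 * y ^ (2*i+1) / real (2*i+1)) \<le> ln w"
    using y by (subst sums_unique[OF s]) (intro sum_le_suminf sums_summable[OF s], auto)
  moreover have "y ^ (2*i+1) = exp (- (2 * real i + 1) * x)" for i
    unfolding y_def exp_of_nat_mult[symmetric] by (simp add: algebra_simps)
  ultimately have "(\<Sum>i<M. 2 * exp (- (2 * real i + 1) * x) / (2 * real i + 1)) \<le> ln w" by (simp add: add_ac)
  moreover have "tanh (x/2) = exp (- ln w)" using w y by (simp add: th w_def exp_minus)
  ultimately show ?thesis by simp
qed

text \<open>The difference of the two sides is an alternating sum of the decreasing numbers
  \<open>d k\<close>; with an odd number of terms it is nonnegative.\<close>

lemma alternating_tanh_sum_le:
  fixes c :: real
  assumes "c > 0"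
  shows "(\<Sum>k<2*N+1. (-1)^k * (tanh (c * (real k + 1)) / (real k + 1))) \<le> (\<Sum>k<2*N+1. (-1)^k / (real k + 1))"
proof -
  define d where "d k = (1 - tanh (c * (real k + 1))) / (real k + 1)" for k :: nat
  have d0: "0 \<le> d k" for k
    using tanh_real_lt_1[of "c * (real k + 1)"] by (simp add: d_def)
  have "d (Suc k) \<le> d k" for k
    unfolding d_def
    using tanh_real_lt_1[of "c * (real k + 1)"] tanh_real_lt_1[of "c * (real (Suc k) + 1)"] assms
    by (intro frac_le) (auto intro!: less_imp_le)
  then have "0 \<le> (\<Sum>k<2*N+1. (-1)^k * d k)"
  proof -
    have "(\<Sum>k<2*N+1. (-1)^k * d k) = (\<Sum>n<N. d (2*n) - d (2*n+1)) + d (2*N)"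
      by (induction N) auto
    with \<open>\<And>k. d (Suc k) \<le> d k\<close> d0 show ?thesis by (simp add: sum_nonneg)
  qed
  also have "(\<Sum>k<2*N+1. (-1)^k * d k) = (\<Sum>k<2*N+1. (-1)^k / (real k + 1)) - (\<Sum>k<2*N+1. (-1)^k * (tanh (c * (real k + 1)) / (real k + 1)))"
    unfolding d_def sum_subtractf[symmetric] by (intro sum.cong refl) (simp add: diff_divide_distrib right_diff_distrib)
  finally show ?thesis by simp
qed

text \<open>The logarithm of the product is minus the sum of \<open>2 / (m * sinh (m * h / 2))\<close> over odd \<open>m\<close>.
  Partial fractions of \<open>1 / sinh\<close> in \<open>k\<close>, truncated after an odd number of terms, bound this from below;
  summing over \<open>m\<close> first gives \<open>pi\<^sup>2 / (2 * h)\<close> minus an alternating sum of \<open>tanh (c * k) / k\<close>,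
  which is at most \<open>ln 2\<close>.\<close>

lemma tanh_prod_limit_le:
  fixes h l :: real
  assumes h: "h > 0" and lim: "(\<lambda>M. \<Prod>n<M. (tanh ((real n + 1/2) * h / 2))\<^sup>2) \<longlonglongrightarrow> l"
  shows "l \<le> 2 * exp (- pi\<^sup>2 / (2 * h))"
proof -
  define m where "m i = 2 * real i + 1" for i :: nat
  have m: "m i > 0" for i by (simp add: m_def)
  have b1: "l \<le> exp (- (\<Sum>i<I. 2 / (m i * sinh (m i * h / 2))))" for I
  proof (rule LIMSEQ_le[OF lim])
    \<comment> \<open>The sum over \<open>n\<close> is geometric; starting at the half-integer 1/2
      makes it exactly a reciprocal of \<open>sinh\<close>.\<close>
    have geo: "(\<lambda>n. exp (- m i * ((real n + 1/2) * h))) sums (1 / (2 * sinh (m i * h / 2)))" for i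
    proof -
      define q where "q = exp (- m i * h)"
      have q: "0 < q" "q < 1" using m[of i] h by (auto simp: q_def)
      have "(\<lambda>n. exp (- m i * h / 2) * q ^ n) sums (exp (- m i * h / 2) * (1 / (1 - q)))"
        using q by (intro sums_mult geometric_sums) auto
      moreover have "exp (- m i * h / 2) * q ^ n = exp (- m i * ((real n + 1/2) * h))" for n
        unfolding q_def exp_of_nat_mult[symmetric] exp_add[symmetric] by (simp add: algebra_simps)
      moreover have "exp (- m i * h / 2) * (1 / (1 - q)) = 1 / (2 * sinh (m i * h / 2))"
      proof -
        define r where "r = exp (- m i * h / 2)"
        have r: "r > 0" "q = r * r" by (auto simp: r_def q_def simp flip: exp_add)
        have "exp (m i * h / 2) = 1 / r" by (simp add: r_def exp_minus field_simps)
        then have "2 * sinh (m i * h / 2) = 1 / r - r" by (simp add: sinh_field_def r_def)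
        also have "\<dots> = (1 - q) / r" using r by (simp add: field_simps)
        finally show ?thesis unfolding r_def[symmetric] using r q by simp
      qed
      ultimately show ?thesis by simp
    qed
    have "(\<lambda>M. \<Sum>i<I. (4 / m i) * (\<Sum>n<M. exp (- m i * ((real n + 1/2) * h))))
       \<longlonglongrightarrow> (\<Sum>i<I. (4 / m i) * (1 / (2 * sinh (m i * h / 2))))"
      by (intro tendsto_sum tendsto_mult[OF tendsto_const] geo[unfolded sums_def])
    moreover have "(4 / m i) * (1 / (2 * y)) = 2 / (m i * y)" for i y by simp
    ultimately show "(\<lambda>M. exp (- (\<Sum>i<I. (4 / m i) * (\<Sum>n<M. exp (- m i * ((real n + 1/2) * h))))))
       \<longlonglongrightarrow> exp (- (\<Sum>i<I. 2 / (m i * sinh (m i * h / 2))))"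
      by (intro tendsto_exp tendsto_minus) (simp only:)
    have "(\<Prod>n<M. (tanh ((real n + 1/2) * h / 2))\<^sup>2) \<le> exp (- (\<Sum>i<I. (4 / m i) * (\<Sum>n<M. exp (- m i * ((real n + 1/2) * h)))))" for M
    proof -
      have "(\<Prod>n<M. (tanh ((real n + 1/2) * h / 2))\<^sup>2)
          \<le> (\<Prod>n<M. (exp (- (\<Sum>i<I. 2 * exp (- m i * ((real n + 1/2) * h)) / m i)))\<^sup>2)"
        using h tanh_half_le[of "(real n + 1/2) * h" I for n] unfolding m_def
        by (intro prod_mono conjI power_mono) auto
      also have "\<dots> = exp (- (\<Sum>n<M. 2 * (\<Sum>i<I. 2 * exp (- m i * ((real n + 1/2) * h)) / m i)))"
      proof -
        have "(exp (- y))\<^sup>2 = exp (- (2 * y))" for y :: real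
          by (simp add: exp_double[symmetric])
        then show ?thesis
          by (simp only:) (subst sum_negf[symmetric], subst exp_sum, rule finite_lessThan, rule refl)
      qed
      also have "(\<Sum>n<M. 2 * (\<Sum>i<I. 2 * exp (- m i * ((real n + 1/2) * h)) / m i))
          = (\<Sum>i<I. (4 / m i) * (\<Sum>n<M. exp (- m i * ((real n + 1/2) * h))))"
        unfolding sum_distrib_left by (subst sum.swap) (simp add: mult_ac)
      finally show ?thesis .
    qed
    then show "\<exists>N. \<forall>n\<ge>N. (\<Prod>n<n. (tanh ((real n + 1/2) * h / 2))\<^sup>2)
        \<le> exp (- (\<Sum>i<I. (4 / m i) * (\<Sum>n<n. exp (- m i * ((real n + 1/2) * h)))))" by blast
  qed
  \<comment> \<open>The dual width: summing the partial fraction with index \<open>k\<close> over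
    all odd \<open>m\<close> turns the width \<open>h\<close> into \<open>pi\<^sup>2 / h\<close>,
    inside a \<open>tanh\<close>.\<close>
  define c where "c = pi\<^sup>2 / h"
  have c: "c > 0" using h by (simp add: c_def)
  \<comment> \<open>\<open>N\<close> stays fixed while the number of odd \<open>m\<close> tends to
    infinity. Thus only finitely many \<open>k\<close> occur in the interchange of summations, and
    \<open>N\<close> tends to infinity afterwards.\<close>
  have b2: "l \<le> exp (- (pi\<^sup>2 / (2 * h)) + (\<Sum>k<2*N+1. (-1)^k / (real k + 1)))" for N
  proof -
    define e where "e i k = 2 * (m i * h / 2) / ((m i * h / 2)\<^sup>2 + pi\<^sup>2 * (real k + 1)\<^sup>2)" for i k :: nat
    have "l \<le> exp (- (\<Sum>i<I. (2 / m i) * (1 / (m i * h / 2) - (\<Sum>k<2*N+1. (-1)^k * e i k))))" for I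
    proof -
      have "(\<Sum>i<I. (2 / m i) * (1 / (m i * h / 2) - (\<Sum>k<2*N+1. (-1)^k * e i k))) \<le> (\<Sum>i<I. (2 / m i) * (1 / sinh (m i * h / 2)))"
        unfolding e_def using m h by (intro sum_mono mult_left_mono inverse_sinh_ge) (auto intro: less_imp_le)
      then show ?thesis using order_trans[OF b1[of I]] by (simp add: field_simps)
    qed
    moreover have "(\<lambda>i. (2 / m i) * (1 / (m i * h / 2) - (\<Sum>k<2*N+1. (-1)^k * e i k)))
      sums (4 / h * (pi\<^sup>2 / 8) - (\<Sum>k<2*N+1. (-1)^k * (tanh (c * (real k + 1)) / (real k + 1))))"
    proof -
      have "(\<lambda>i. (2 / m i) * e i k) sums (tanh (c * (real k + 1)) / (real k + 1))" for k
      proof -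
        let ?x = "c * (real k + 1)"
        have "(\<lambda>i. (1 / (real k + 1)) * (8 * ?x / (4 * ?x\<^sup>2 + pi\<^sup>2 * (2 * real i + 1)\<^sup>2))) sums ((1 / (real k + 1)) * tanh ?x)"
          by (rule sums_mult[OF tanh_partial_fractions])
        moreover have "(1 / (real k + 1)) * (8 * ?x / (4 * ?x\<^sup>2 + pi\<^sup>2 * (2 * real i + 1)\<^sup>2)) = (2 / m i) * e i k" for i
        proof -
          have p: "0 < 4 * pi\<^sup>2 * (real k + 1)\<^sup>2 + h\<^sup>2 * (m i)\<^sup>2"
            using m[of i] h by (intro add_nonneg_pos mult_pos_pos) auto
          have a: "4 * ?x\<^sup>2 + pi\<^sup>2 * (2 * real i + 1)\<^sup>2 = (pi\<^sup>2 / h\<^sup>2) * (4 * pi\<^sup>2 * (real k + 1)\<^sup>2 + h\<^sup>2 * (m i)\<^sup>2)"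
            using h unfolding m_def c_def by (simp add: power2_eq_square field_simps)
          have b: "(m i * h / 2)\<^sup>2 + pi\<^sup>2 * (real k + 1)\<^sup>2 = (4 * pi\<^sup>2 * (real k + 1)\<^sup>2 + h\<^sup>2 * (m i)\<^sup>2) / 4"
            by (simp add: power2_eq_square field_simps)
          show ?thesis unfolding e_def a b using p m[of i] h
            by (simp add: c_def power2_eq_square divide_simps) 
        qed
        ultimately show ?thesis by simp
      qed
      then have "(\<lambda>i. \<Sum>k<2*N+1. (-1)^k * ((2 / m i) * e i k)) sums (\<Sum>k<2*N+1. (-1)^k * (tanh (c * (real k + 1)) / (real k + 1)))"
        by (intro sums_sum sums_mult)
      moreover have "(\<lambda>i. 4 / h * (1 / (m i)\<^sup>2)) sums (4 / h * (pi\<^sup>2 / 8))"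
        unfolding m_def by (rule sums_mult[OF odd_inverse_squares_sums])
      ultimately have "(\<lambda>i. 4 / h * (1 / (m i)\<^sup>2) - (\<Sum>k<2*N+1. (-1)^k * ((2 / m i) * e i k))) sums (4 / h * (pi\<^sup>2 / 8) - (\<Sum>k<2*N+1. (-1)^k * (tanh (c * (real k + 1)) / (real k + 1))))"
        by (intro sums_diff)
      moreover have "4 / h * (1 / (m i)\<^sup>2) - (\<Sum>k<2*N+1. (-1)^k * ((2 / m i) * e i k)) = (2 / m i) * (1 / (m i * h / 2) - (\<Sum>k<2*N+1. (-1)^k * e i k))" for i
      proof -
        have "4 / h * (1 / (m i)\<^sup>2) = (2 / m i) * (1 / (m i * h / 2))" by (simp add: power2_eq_square)
        moreover have "(\<Sum>k<2*N+1. (-1)^k * ((2 / m i) * e i k)) = (2 / m i) * (\<Sum>k<2*N+1. (-1)^k * e i k)"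
          unfolding sum_distrib_left by (intro sum.cong) auto
        ultimately show ?thesis by (simp only: right_diff_distrib)
      qed
      ultimately show ?thesis by simp
    qed
    ultimately have "l \<le> exp (- (4 / h * (pi\<^sup>2 / 8) - (\<Sum>k<2*N+1. (-1)^k * (tanh (c * (real k + 1)) / (real k + 1)))))"
      unfolding sums_def by (intro LIMSEQ_le_const[OF tendsto_exp[OF tendsto_minus]]) auto
    also have "\<dots> \<le> exp (- (pi\<^sup>2 / (2 * h)) + (\<Sum>k<2*N+1. (-1)^k / (real k + 1)))"
      using alternating_tanh_sum_le[OF c, of N] by simp
    finally show ?thesis .
  qed
  have "(\<lambda>n. \<Sum>k<n. (-1)^k / (real k + 1)) \<longlonglongrightarrow> ln 2"
    using alternating_harmonic_series_sums unfolding sums_def by (simp add: add.commute)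
  then have "(\<lambda>N. \<Sum>k<2*N+1. (-1)^k / (real k + 1)) \<longlonglongrightarrow> ln 2"
    by (rule LIMSEQ_subseq_LIMSEQ[unfolded comp_def, where f="\<lambda>N. 2*N+1" and X="\<lambda>n. \<Sum>k<n. (-1)^k / (real k + 1)"]) (auto simp: strict_mono_def)
  then have "l \<le> exp (- (pi\<^sup>2 / (2 * h)) + ln 2)"
    using b2 by (intro LIMSEQ_le_const[OF tendsto_exp[OF tendsto_add[OF tendsto_const]]]) auto
  then show ?thesis by (simp add: exp_diff exp_minus field_simps)
qed

subsection \<open>The triple product and theta functions\<close>

text \<open>Reciprocals of \<open>q\<close>-factorials; with the value 0 at negative arguments the recursion below
  holds for all integers, so the sum in the finite triple product needs no explicit range.\<close>

definition rqfac :: "real \<Rightarrow> int \<Rightarrow> real" where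
  "rqfac q k = (if k < 0 then 0 else inverse (\<Prod>i<nat k. 1 - q ^ Suc i))"

lemma rqfac_diff_one:
  assumes "0 < q" "q < 1"
  shows "rqfac q (k - 1) = rqfac q k * (1 - q powi k)"
proof (cases "k > 0")
  case True
  then obtain m where m: "k = int (Suc m)" by (metis zero_less_imp_eq_int gr0_conv_Suc)
  have "q ^ Suc m \<noteq> 1" using assms power_Suc_less_one[of q m] by simp
  moreover have "q powi k = q ^ Suc m" unfolding m by (simp only: power_int_of_nat)
  moreover have "nat (k - 1) = m" "nat k = Suc m" using m by auto
  moreover have "inverse P = inverse (P * d) * d" if "d \<noteq> 0" for P d :: real
    using that by (simp add: divide_simps)
  ultimately show ?thesis using True unfolding rqfac_def by simp
next
  case False
  then show ?thesis by (cases "k = 0") (auto simp: rqfac_def)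
qed

text \<open>The finite form of Jacobi's triple product: the coefficients are Gaussian binomials
  \<open>2 * N\<close> over \<open>N + n\<close> in base \<open>s\<^sup>2\<close>. It is proved by
  induction on \<open>N\<close>, comparing the coefficients of the powers of
  \<open>w\<close>.\<close>

lemma finite_triple_product:
  fixes s w :: real
  assumes s: "0 < s" "s < 1" and w: "w \<noteq> 0"
  shows "((\<lambda>n::int. (\<Prod>i<2*N. 1 - (s\<^sup>2) ^ Suc i) * rqfac (s\<^sup>2) (int N + n) * rqfac (s\<^sup>2) (int N - n) * (s powi (n\<^sup>2) * w powi n))
     has_sum (\<Prod>n<N. (1 + s ^ (2*n+1) * w) * (1 + s ^ (2*n+1) / w))) UNIV"
proof (induction N)
  case 0
  show ?case
    by (rule has_sum_finite_neutralI[of "{0}"]) (auto simp: rqfac_def)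
next
  case (Suc N)
  define q where "q = s\<^sup>2"
  have q: "0 < q" "q < 1" using s by (auto simp: q_def power_less_one_iff)
  have qi: "q powi k = s powi (2 * k)" for k
    unfolding q_def by (simp add: power_int_mult)
  define ph where "ph = (\<Prod>i<2*N. 1 - q ^ Suc i)"
  define f where "f n = ph * rqfac q (int N + n) * rqfac q (int N - n) * (s powi (n\<^sup>2) * w powi n)" for n :: int
  define P where "P = (\<Prod>n<N. (1 + s ^ (2*n+1) * w) * (1 + s ^ (2*n+1) / w))"
  have f: "(f has_sum P) UNIV" using Suc unfolding f_def P_def ph_def q_def .
  have fm: "((\<lambda>n. f (n - 1)) has_sum P) UNIV"
    using f by (subst has_sum_reindex_bij_witness[where S = UNIV and i = "\<lambda>n. n + 1" and j = "\<lambda>n. n - 1" and h = f and s' = P]) auto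
  have fp: "((\<lambda>n. f (n + 1)) has_sum P) UNIV"
    using f by (subst has_sum_reindex_bij_witness[where S = UNIV and i = "\<lambda>n. n - 1" and j = "\<lambda>n. n + 1" and h = f and s' = P]) auto
  \<comment> \<open>The new factor \<open>(1 + c * w) * (1 + c / w)\<close> expands to
    \<open>(1 + c\<^sup>2) + c * w + c / w\<close>; the last two parts shift the summation index by
    one in either direction.\<close>
  define c where "c = s ^ (2*N+1)"
  have "((\<lambda>n. (1 + c\<^sup>2) * f n + c * w * f (n - 1) + c / w * f (n + 1)) has_sum ((1 + c\<^sup>2) * P + c * w * P + c / w * P)) UNIV"
    by (intro has_sum_add has_sum_cmult_right f fm fp)
  moreover have "(1 + c\<^sup>2) * P + c * w * P + c / w * P = P * ((1 + c * w) * (1 + c / w))"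
    using w by (simp add: field_simps power2_eq_square)
  moreover have "(1 + c\<^sup>2) * f n + c * w * f (n - 1) + c / w * f (n + 1)
    = (ph * (1 - q ^ (2*N+1)) * (1 - q ^ (2*N+2))) * rqfac q (int (Suc N) + n) * rqfac q (int (Suc N) - n) * (s powi (n\<^sup>2) * w powi n)" for n
  proof -
    \<comment> \<open>All five reciprocal factorials are reduced to the two at \<open>Suc N\<close>.
      Since \<open>a * b = q ^ (2 * N)\<close> and \<open>c\<^sup>2 = a * b * q\<close>, equality of
      the coefficients becomes a polynomial identity in \<open>a\<close>, \<open>b\<close> and
      \<open>q\<close>.\<close>
    define a b where "a = q powi (int N + n)" and "b = q powi (int N - n)"
    define A B where "A = rqfac q (int (Suc N) + n)" and "B = rqfac q (int (Suc N) - n)"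
    have a1: "q powi (int (Suc N) + n) = a * q" and b1: "q powi (int (Suc N) - n) = b * q"
      using q by (simp_all add: a_def b_def power_int_add power_int_diff)
    have k: "int (Suc N) + n - 1 = int N + n" "int (Suc N) - n - 1 = int N - n"
      "int N + n - 1 = int N + (n - 1)" "int N - n - 1 = int N - (n + 1)"
      "int N + (n + 1) = int (Suc N) + n" "int N - (n - 1) = int (Suc N) - n" by auto
    have r1: "rqfac q (int N + n) = A * (1 - a * q)"
      using rqfac_diff_one[OF q, of "int (Suc N) + n"] unfolding k(1) a1 A_def .
    have r2: "rqfac q (int N - n) = B * (1 - b * q)"
      using rqfac_diff_one[OF q, of "int (Suc N) - n"] unfolding k(2) b1 B_def .
    have r3: "rqfac q (int N + (n - 1)) = A * (1 - a * q) * (1 - a)"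
      using rqfac_diff_one[OF q, of "int N + n"] unfolding k(3) r1 a_def[symmetric] .
    have r4: "rqfac q (int N - (n + 1)) = B * (1 - b * q) * (1 - b)"
      using rqfac_diff_one[OF q, of "int N - n"] unfolding k(4) r2 b_def[symmetric] .
    have r5: "rqfac q (int N + (n + 1)) = A" "rqfac q (int N - (n - 1)) = B"
      unfolding k(5,6) A_def B_def by auto
    note r = r1 r2 r3 r4 r5
    have ab: "a * b = q ^ (2 * N)"
    proof -
      have "a * b = q powi (int (2 * N))" using q unfolding a_def b_def by (simp flip: power_int_add)
      then show ?thesis by (simp only: power_int_of_nat)
    qed
    have cc: "c\<^sup>2 = a * b * q" unfolding ab c_def q_def power_mult[symmetric] power_add[symmetric]
      by (rule arg_cong[where f = "power s"]) simp
    have iN: "int (2 * N + 1) = 2 * int N + 1" by simp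
    have c': "c = s powi (2 * int N + 1)"
      unfolding c_def iN[symmetric] by (rule power_int_of_nat[symmetric])
    have as: "a = s powi (2 * (int N + n))" and bs: "b = s powi (2 * (int N - n))"
      by (simp_all only: a_def b_def qi)
    have e1: "c * w * (s powi ((n - 1)\<^sup>2) * w powi (n - 1)) = b * q * (s powi (n\<^sup>2) * w powi n)"
    proof -
      have "c * s powi ((n - 1)\<^sup>2) = s powi (2 * (int N - n) + 2 + n\<^sup>2)"
        unfolding c' using s by (subst power_int_add[symmetric]) (auto simp: power2_eq_square algebra_simps)
      also have "\<dots> = b * q * s powi (n\<^sup>2)"
        using s by (simp add: power_int_add bs q_def)
      finally have "c * s powi ((n - 1)\<^sup>2) = b * q * s powi (n\<^sup>2)" .
      moreover have "w * w powi (n - 1) = w powi n" using w by (simp add: power_int_diff)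
      moreover have "c * w * (s powi ((n - 1)\<^sup>2) * w powi (n - 1)) = (c * s powi ((n - 1)\<^sup>2)) * (w * w powi (n - 1))"
        by (simp only: mult_ac)
      ultimately show ?thesis by (simp only:)
    qed
    have e2: "c / w * (s powi ((n + 1)\<^sup>2) * w powi (n + 1)) = a * q * (s powi (n\<^sup>2) * w powi n)"
    proof -
      have "c * s powi ((n + 1)\<^sup>2) = s powi (2 * (int N + n) + 2 + n\<^sup>2)"
        unfolding c' using s by (subst power_int_add[symmetric]) (auto simp: power2_eq_square algebra_simps)
      also have "\<dots> = a * q * s powi (n\<^sup>2)"
        using s by (simp add: power_int_add as q_def)
      finally have "c * s powi ((n + 1)\<^sup>2) = a * q * s powi (n\<^sup>2)" .
      moreover have "w powi (n + 1) / w = w powi n" using w by (simp add: power_int_add)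
      moreover have "c / w * (s powi ((n + 1)\<^sup>2) * w powi (n + 1)) = (c * s powi ((n + 1)\<^sup>2)) * (w powi (n + 1) / w)"
        by simp
      ultimately show ?thesis by simp
    qed
    define t where "t = s powi (n\<^sup>2) * w powi n"
    have "(1 + c\<^sup>2) * f n + c * w * f (n - 1) + c / w * f (n + 1)
       = ph * A * B * ((1 + c\<^sup>2) * (1 - a * q) * (1 - b * q)) * t
        + ph * (A * (1 - a * q) * (1 - a)) * B * (c * w * (s powi ((n - 1)\<^sup>2) * w powi (n - 1)))
        + ph * A * (B * (1 - b * q) * (1 - b)) * (c / w * (s powi ((n + 1)\<^sup>2) * w powi (n + 1)))"
      unfolding f_def r t_def by (simp add: mult_ac)
    also have "\<dots> = ph * A * B * t * ((1 + a * b * q) * (1 - a * q) * (1 - b * q) + (1 - a * q) * (1 - a) * b * q + (1 - b * q) * (1 - b) * a * q)"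
      unfolding e1 e2 cc t_def by (simp add: algebra_simps)
    also have "(1 + a * b * q) * (1 - a * q) * (1 - b * q) + (1 - a * q) * (1 - a) * b * q + (1 - b * q) * (1 - b) * a * q
       = (1 - a * b * q) * (1 - a * b * q * q)" by (simp add: algebra_simps)
    also have "a * b * q = q ^ (2*N+1)" by (simp add: ab)
    finally show ?thesis by (simp add: A_def B_def t_def mult_ac)
  qed
  moreover have "(\<Prod>i<2*Suc N. 1 - q ^ Suc i) = ph * (1 - q ^ (2*N+1)) * (1 - q ^ (2*N+2))"
    by (simp add: ph_def)
  ultimately show ?case
    unfolding q_def[symmetric] prod.lessThan_Suc P_def[symmetric] c_def[symmetric] by (simp only:)
qed

section \<open>Theta series, their product form and their product formula\<close>

lemma summable_on_exp_neg_abs_int: "(\<lambda>n::int. exp (- \<bar>real_of_int n\<bar>)) summable_on UNIV"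
proof -
  have 1: "(\<lambda>n::nat. exp (- real n)) summable_on UNIV"
  proof (rule norm_summable_imp_summable_on)
    have "exp (- real n) = exp (- 1) ^ n" for n by (simp flip: exp_of_nat_mult)
    then show "summable (\<lambda>n. norm (exp (- real n)))" by (simp add: summable_geometric)
  qed
  have a: "(\<lambda>n::int. exp (- \<bar>real_of_int n\<bar>)) summable_on range int"
    using 1 by (subst summable_on_reindex) (auto simp: o_def)
  have b: "(\<lambda>n::int. exp (- \<bar>real_of_int n\<bar>)) summable_on range (\<lambda>n. - int n)"
    using 1 by (subst summable_on_reindex) (auto simp: o_def inj_def)
  have "range int \<union> range (\<lambda>n. - int n) = UNIV"
    by (metis (no_types, lifting) UNIV_eq_I UnCI int_cases2 rangeI)
  with summable_on_union[OF a b] show ?thesis by simp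
qed

text \<open>Completing the square in \<open>\<bar>x\<bar>\<close>. The majorant depends on
  \<open>v\<close> only through a constant that increases with \<open>\<bar>v\<bar>\<close>, so it
  also serves for uniform convergence when \<open>v\<close> ranges over an interval.\<close>

lemma gaussian_bound:
  fixes c v x :: real
  assumes "c > 0"
  shows "exp (- c * x\<^sup>2 + x * v) \<le> exp ((\<bar>v\<bar> + 1)\<^sup>2 / (4 * c)) * exp (- \<bar>x\<bar>)"
proof -
  have "0 \<le> (2 * c * \<bar>x\<bar> - (\<bar>v\<bar> + 1))\<^sup>2 / (4 * c)" using assms by simp
  also have "\<dots> = c * x\<^sup>2 - \<bar>x\<bar> * (\<bar>v\<bar> + 1) + (\<bar>v\<bar> + 1)\<^sup>2 / (4 * c)"
    using assms by (simp add: field_simps power2_eq_square)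
  finally have "- c * x\<^sup>2 + \<bar>x\<bar> * \<bar>v\<bar> \<le> (\<bar>v\<bar> + 1)\<^sup>2 / (4 * c) - \<bar>x\<bar>" by (simp add: algebra_simps)
  moreover have "x * v \<le> \<bar>x\<bar> * \<bar>v\<bar>" by (metis abs_ge_self abs_mult)
  ultimately show ?thesis by (simp flip: exp_add)
qed

lemma summable_on_gaussian_int:
  fixes c v :: real
  assumes "c > 0"
  shows "(\<lambda>n::int. exp (- c * (real_of_int n)\<^sup>2 + real_of_int n * v)) summable_on A"
proof -
  have "(\<lambda>n::int. exp ((\<bar>v\<bar> + 1)\<^sup>2 / (4 * c)) * exp (- \<bar>real_of_int n\<bar>)) summable_on A"
    using summable_on_subset[OF summable_on_exp_neg_abs_int subset_UNIV]
    by (rule summable_on_cmult_right)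
  then show ?thesis
    by (rule summable_on_comparison_test) (use gaussian_bound[OF assms] in auto)
qed

text \<open>Jacobi's theta functions of nome \<open>exp (- c)\<close> along the imaginary axis:
  theta 3 for \<epsilon> = 1 and theta 4 for \<epsilon> = - 1.\<close>

definition theta :: "real \<Rightarrow> real \<Rightarrow> real \<Rightarrow> real" where
  "theta c \<epsilon> x = (\<Sum>\<^sub>\<infinity>n::int. \<epsilon> powi n * exp (- c * (real_of_int n)\<^sup>2 + real_of_int n * x))"

lemma theta_term_abs_summable:
  assumes "c > 0" "\<bar>\<epsilon>\<bar> = 1"
  shows "(\<lambda>n::int. \<epsilon> powi n * exp (- c * (real_of_int n)\<^sup>2 + real_of_int n * x)) abs_summable_on A"
  using summable_on_gaussian_int[OF assms(1), of x A] assms(2)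
  by (simp add: abs_mult power_int_abs)

text \<open>The limit of the finite triple product. The constant \<open>C\<close> is chosen before
  \<epsilon> and \<open>x\<close>, so that it cancels in quotients of theta functions.\<close>

lemma theta_product_limit:
  assumes c: "c > 0" 
  shows "\<exists>C>0. \<forall>\<epsilon> x. \<bar>\<epsilon>\<bar> = 1 \<longrightarrow>
    (\<lambda>N. \<Prod>n<N. (1 + \<epsilon> * exp (- (2 * real n + 1) * c + x)) * (1 + \<epsilon> * exp (- (2 * real n + 1) * c - x))) \<longlonglongrightarrow> C * theta c \<epsilon> x"
proof -
  define s where "s = exp (- c)"
  have s: "0 < s" "s < 1" using c by (auto simp: s_def)
  define q where "q = s\<^sup>2"
  have q: "0 < q" "q < 1" using s by (auto simp: q_def power_less_one_iff)
  define D where "D k = (\<Prod>i<k. 1 - q ^ Suc i)" for k :: nat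
  have fac: "0 < 1 - q ^ Suc i" "1 - q ^ Suc i \<le> 1" for i
    using q power_Suc_less_one[of q i] by auto
  have cp: "convergent_prod (\<lambda>i. 1 + - (q ^ Suc i))"
  proof (rule summable_imp_convergent_prod_real)
    show "summable (\<lambda>k. \<bar>- (q ^ Suc k)\<bar>)"
      using q summable_mult[OF summable_geometric[of q], of q] by (simp add: abs_mult)
    show "- (q ^ Suc k) \<noteq> - 1" for k using fac[of k] by auto
  qed
  define d where "d = prodinf (\<lambda>i. 1 - q ^ Suc i)"
  have Dd: "D \<longlonglongrightarrow> d"
  proof -
    have "(\<lambda>n. D (Suc n)) \<longlonglongrightarrow> d"
      using convergent_prod_LIMSEQ[OF cp] by (simp add: D_def d_def lessThan_Suc_atMost del: prod.lessThan_Suc)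
    then show ?thesis by (rule LIMSEQ_imp_Suc)
  qed
  have Dpos: "0 < D k" for k unfolding D_def using fac by (intro prod_pos) auto
  have Danti: "decseq D"
    unfolding decseq_Suc_iff D_def prod.lessThan_Suc using fac Dpos[unfolded D_def]
    by (intro allI mult_left_le) (auto intro: less_imp_le)
  have Dge: "d \<le> D k" for k by (rule decseq_ge[OF Danti Dd])
  have D1: "D k \<le> 1" for k using decseqD[OF Danti, of 0 k] by (simp add: D_def)
  have d0: "d > 0"
  proof -
    have "d \<noteq> 0" unfolding d_def using cp fac by (intro prodinf_nonzero) (auto, metis less_irrefl)
    moreover have "d \<ge> 0" by (rule LIMSEQ_le_const[OF Dd]) (use Dpos less_imp_le in blast)
    ultimately show ?thesis by simp
  qed
  have rq: "rqfac q (int k) = inverse (D k)" for k by (simp add: rqfac_def D_def)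
  \<comment> \<open>Since \<open>D\<close> decreases to \<open>d\<close>, the number
    \<open>inverse d\<close> bounds all these values, the default 0 included. This supplies a
    majorant independent of \<open>N\<close> for Tannery's theorem.\<close>
  have rqb: "0 \<le> rqfac q k" "rqfac q k \<le> inverse d" for k
  proof -
    have "0 \<le> rqfac q (int n) \<and> rqfac q (int n) \<le> inverse d" for n
      unfolding rq using Dpos[of n] Dge[of n] d0 by (auto intro: le_imp_inverse_le)
    moreover have "rqfac q k = 0" if "k < 0" using that by (simp add: rqfac_def)
    ultimately show "0 \<le> rqfac q k" "rqfac q k \<le> inverse d"
      using d0 by (metis nonneg_int_cases not_less inverse_nonnegative_iff_nonnegative less_imp_le order_refl)+
  qed
  have rqlim: "(\<lambda>N. rqfac q (int N + n)) \<longlonglongrightarrow> inverse d" for n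
  proof -
    have L: "(\<lambda>N. inverse (D N)) \<longlonglongrightarrow> inverse d" using Dd d0 by (intro tendsto_inverse) auto
    obtain m where m: "n \<ge> - int m" by (metis minus_le_iff nat_le_iff order_refl)
    have "(\<lambda>N. rqfac q (int (N + m) + n)) \<longlonglongrightarrow> inverse d"
    proof -
      have "int (N + m) + n = int (N + nat (int m + n))" for N using m by simp
      then have "rqfac q (int (N + m) + n) = inverse (D (N + nat (int m + n)))" for N
        by (simp only: rq)
      then show ?thesis using LIMSEQ_ignore_initial_segment[OF L] by simp
    qed
    then show ?thesis by (rule LIMSEQ_offset)
  qed
  have Dl: "(\<lambda>N. D (2 * N)) \<longlonglongrightarrow> d"
    using LIMSEQ_subseq_LIMSEQ[OF Dd, of "\<lambda>N. 2 * N"] by (simp add: strict_mono_def o_def)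
  show ?thesis
  proof (intro exI[of _ "inverse d"] conjI allI impI)
    show "0 < inverse d" using d0 by simp
    fix \<epsilon> x :: real assume e: "\<bar>\<epsilon>\<bar> = 1"
    define w where "w = \<epsilon> * exp x"
    have e': "\<epsilon> = 1 \<or> \<epsilon> = - 1" using e by auto
    have w: "w \<noteq> 0" using e by (auto simp: w_def)
    define t where "t n = \<epsilon> powi n * exp (- c * (real_of_int n)\<^sup>2 + real_of_int n * x)" for n :: int
    have t: "s powi (n\<^sup>2) * w powi n = t n" for n
    proof -
      have "real_of_int (n\<^sup>2) * - c = - c * (real_of_int n)\<^sup>2" by simp
      then show ?thesis
        unfolding s_def w_def t_def power_int_mult_distrib exp_power_int exp_add by (simp only: mult_ac)
    qed
    \<comment> \<open>Tannery's theorem concerns series over the naturals; \<open>int_decode\<close>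
      enumerates the integers for it.\<close>
    define a where "a k N = D (2 * N) * rqfac q (int N + int_decode k) * rqfac q (int N - int_decode k) * t (int_decode k)" for k N :: nat
    have prod_eq: "(\<Prod>n<N. (1 + \<epsilon> * exp (- (2 * real n + 1) * c + x)) * (1 + \<epsilon> * exp (- (2 * real n + 1) * c - x))) = (\<Sum>k. a k N)" for N
    proof -
      let ?f = "\<lambda>n. D (2 * N) * rqfac q (int N + n) * rqfac q (int N - n) * t n"
      have "(?f has_sum (\<Prod>n<N. (1 + s ^ (2*n+1) * w) * (1 + s ^ (2*n+1) / w))) UNIV"
        using finite_triple_product[OF s w, of N] unfolding t q_def[symmetric] D_def[symmetric] .
      then have "((\<lambda>k. a k N) has_sum (\<Prod>n<N. (1 + s ^ (2*n+1) * w) * (1 + s ^ (2*n+1) / w))) UNIV"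
        using has_sum_reindex_bij_betw[OF bij_int_decode, of ?f] unfolding a_def by blast
      then have eq: "(\<Sum>k. a k N) = (\<Prod>n<N. (1 + s ^ (2*n+1) * w) * (1 + s ^ (2*n+1) / w))"
        by (rule sums_unique[OF has_sum_imp_sums, symmetric])
      have sn: "s ^ (2*n+1) = exp (- (2 * real n + 1) * c)" for n
        unfolding s_def exp_of_nat_mult[symmetric] by (simp add: algebra_simps)
      have p: "exp z * w = \<epsilon> * exp (z + x)" "exp z / w = \<epsilon> * exp (z - x)" for z
        using e' by (auto simp: w_def exp_add exp_diff)
      show ?thesis unfolding eq sn p by (rule refl)
    qed
    have sumt: "((\<lambda>k. t (int_decode k)) has_sum theta c \<epsilon> x) UNIV"
    proof -
      have "t summable_on UNIV"
        unfolding t_def by (rule abs_summable_summable[OF theta_term_abs_summable[OF c e]])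
      then have "(t has_sum theta c \<epsilon> x) UNIV"
        unfolding theta_def t_def[symmetric] by (rule has_sum_infsum)
      then show ?thesis
        using has_sum_reindex_bij_betw[OF bij_int_decode, of t] by simp
    qed
    have abst: "summable (\<lambda>k. \<bar>t (int_decode k)\<bar>)"
    proof -
      have "(\<lambda>n. \<bar>t n\<bar>) summable_on UNIV"
        unfolding t_def using theta_term_abs_summable[OF c e, of x UNIV] by simp
      then have "(\<lambda>k. \<bar>t (int_decode k)\<bar>) summable_on UNIV"
        using summable_on_reindex_bij_betw[OF bij_int_decode, of "\<lambda>n. \<bar>t n\<bar>"] by simp
      then show ?thesis by (rule summable_on_imp_summable)
    qed
    have lim: "(\<lambda>N. a k N) \<longlonglongrightarrow> inverse d * t (int_decode k)" for k
    proof -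
      have "(\<lambda>N. a k N) \<longlonglongrightarrow> d * inverse d * inverse d * t (int_decode k)"
        unfolding a_def using rqlim[of "- int_decode k"]
        by (intro tendsto_mult Dl rqlim tendsto_const) simp
      then show ?thesis using d0 by simp
    qed
    have "((\<lambda>N. \<Sum>k. a k N) \<longlonglongrightarrow> (\<Sum>k. inverse d * t (int_decode k)))"
    proof (rule tannerys_theorem[THEN conjunct2, THEN conjunct2, OF lim])
      have "norm (a k N) \<le> inverse d * inverse d * \<bar>t (int_decode k)\<bar>" for k N
      proof -
        have "norm (a k N) = D (2*N) * rqfac q (int N + int_decode k) * rqfac q (int N - int_decode k) * \<bar>t (int_decode k)\<bar>"
          unfolding a_def using Dpos[of "2*N"] rqb by (simp add: abs_mult)
        also have "\<dots> \<le> 1 * inverse d * inverse d * \<bar>t (int_decode k)\<bar>"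
          using Dpos[of "2*N"] D1 rqb d0 by (intro mult_mono mult_nonneg_nonneg) (auto intro: less_imp_le)
        finally show ?thesis by simp
      qed
      then show "\<forall>\<^sub>F (k, N) in at_top \<times>\<^sub>F sequentially. norm (a k N) \<le> inverse d * inverse d * \<bar>t (int_decode k)\<bar>"
        by (intro always_eventually) auto
      show "summable (\<lambda>k. inverse d * inverse d * \<bar>t (int_decode k)\<bar>)"
        by (intro summable_mult abst)
    qed auto
    also have "(\<Sum>k. inverse d * t (int_decode k)) = inverse d * theta c \<epsilon> x"
      by (rule sums_unique[OF sums_mult[OF has_sum_imp_sums[OF sumt]], symmetric])
    finally show "(\<lambda>N. \<Prod>n<N. (1 + \<epsilon> * exp (- (2 * real n + 1) * c + x)) * (1 + \<epsilon> * exp (- (2 * real n + 1) * c - x))) \<longlonglongrightarrow> inverse d * theta c \<epsilon> x"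
      unfolding prod_eq .
  qed
qed

lemma has_sum_product_Times:
  fixes f :: "'a \<Rightarrow> real" and g :: "'b \<Rightarrow> real"
  assumes "f abs_summable_on A" "g abs_summable_on B"
  shows "((\<lambda>(x, y). f x * g y) has_sum (infsum f A * infsum g B)) (A \<times> B)"
proof (rule has_sum_SigmaI)
  have f: "f summable_on A" and g: "g summable_on B" using assms by (auto intro: abs_summable_summable)
  show "((\<lambda>y. case (x, y) of (x, y) \<Rightarrow> f x * g y) has_sum f x * infsum g B) B" for x
    using g by (auto intro!: has_sum_cmult_right)
  show "((\<lambda>x. f x * infsum g B) has_sum infsum f A * infsum g B) A"
    using f by (auto intro!: has_sum_cmult_left)
  have "(\<lambda>(x, y). f x * g y) abs_summable_on A \<times> B"
    unfolding abs_summable_on_Sigma_iff using assms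
    by (auto simp: abs_mult infsum_cmult_right' intro!: summable_on_cmult_right summable_on_cmult_left)
  then show "(\<lambda>(x, y). f x * g y) summable_on A \<times> B" by (rule abs_summable_summable)
qed

text \<open>The coefficient is halved because \<open>m\<^sup>2 + n\<^sup>2\<close> is half of
  \<open>(m + n)\<^sup>2 + (m - n)\<^sup>2\<close>. For even indices this is theta 3, for odd ones
  theta 2, both of nome \<open>exp (- 2 * c)\<close>.\<close>

definition half_theta :: "real \<Rightarrow> int set \<Rightarrow> real \<Rightarrow> real" where
  "half_theta c S x = (\<Sum>\<^sub>\<infinity>n\<in>S. exp (- (c/2) * (real_of_int n)\<^sup>2 + real_of_int n * x))"

text \<open>In the product of the two series over \<open>(m, n)\<close>, the new indices \<open>m + n\<close> and \<open>m - n\<close> separate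
  the variables and range over all pairs of integers of equal parity.\<close>

lemma theta_add_times_theta_diff:
  assumes c: "c > 0" and e: "\<epsilon> = 1 \<or> \<epsilon> = - 1"
  shows "theta c \<epsilon> (x + y) * theta c \<epsilon> (x - y)
    = half_theta c {n. even n} x * half_theta c {n. even n} y + \<epsilon> * (half_theta c {n. odd n} x * half_theta c {n. odd n} y)"
proof -
  define g where "g z n = exp (- (c/2) * (real_of_int n)\<^sup>2 + real_of_int n * z)" for z n
  have gs: "g z abs_summable_on S" for z S
    unfolding g_def using summable_on_gaussian_int[of "c/2" z S] c by simp
  define t where "t z n = \<epsilon> powi n * exp (- c * (real_of_int n)\<^sup>2 + real_of_int n * z)" for z n
  have "((\<lambda>(m, n). t (x + y) m * t (x - y) n) has_sum (theta c \<epsilon> (x + y) * theta c \<epsilon> (x - y))) (UNIV \<times> UNIV)"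
    unfolding theta_def t_def using e by (intro has_sum_product_Times theta_term_abs_summable c) auto
  \<comment> \<open>The sign depends only on the sum \<open>s\<close> of the two indices: it is 1 on
    pairs of even numbers and \<epsilon> on pairs of odd numbers.\<close>
  define H where "H = (\<lambda>(s, d). \<epsilon> powi s * (g x s * g y d))"
  define j :: "int \<times> int \<Rightarrow> int \<times> int" where "j = (\<lambda>(m, n). (m + n, m - n))"
  define Ev where "Ev = {n::int. even n}"
  define Od where "Od = {n::int. odd n}"
  have bij: "bij_betw j (UNIV \<times> UNIV) (Ev \<times> Ev \<union> Od \<times> Od)"
    unfolding j_def Ev_def Od_def
  proof (rule bij_betwI[where g = "\<lambda>(s, d). ((s + d) div 2, (s - d) div 2)"])
    show "(case case z of (m, n) \<Rightarrow> (m + n, m - n) of (s, d) \<Rightarrow> ((s + d) div 2, (s - d) div 2)) = z" for z :: "int \<times> int"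
      by (cases z) simp
    fix z :: "int \<times> int"
    assume z: "z \<in> {n. even n} \<times> {n. even n} \<union> {n. odd n} \<times> {n. odd n}"
    obtain s d where sd: "z = (s, d)" by (cases z)
    have "even (s + d)" "even (s - d)" using z sd by auto
    then obtain p r where pr: "s + d = 2 * p" "s - d = 2 * r" by (elim evenE)
    then have "(s + d) div 2 = p" "(s - d) div 2 = r" "p + r = s" "p - r = d" by auto
    then show "(case case z of (s, d) \<Rightarrow> ((s + d) div 2, (s - d) div 2) of (m, n) \<Rightarrow> (m + n, m - n)) = z"
      by (simp add: sd)
  qed auto
  have "(\<lambda>(m, n). t (x + y) m * t (x - y) n) = (\<lambda>z. H (j z))"
  proof (rule ext, clarify)
    fix m n :: int
    have "- c * (real_of_int m)\<^sup>2 + real_of_int m * (x + y) + (- c * (real_of_int n)\<^sup>2 + real_of_int n * (x - y))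
      = - (c/2) * (real_of_int (m + n))\<^sup>2 + real_of_int (m + n) * x + (- (c/2) * (real_of_int (m - n))\<^sup>2 + real_of_int (m - n) * y)"
      by (simp add: power2_eq_square field_simps)
    moreover have "\<epsilon> powi m * \<epsilon> powi n = \<epsilon> powi (m + n)" using e by (subst power_int_add) auto
    moreover have "p * exp X * (r * exp Y) = z * (exp G * exp D)" if "X + Y = G + D" "p * r = z" for p r z X Y G D :: real
    proof -
      have "exp X * exp Y = exp G * exp D" using that(1) by (simp only: exp_add[symmetric])
      moreover have "p * exp X * (r * exp Y) = (p * r) * (exp X * exp Y)" by (simp only: mult_ac)
      ultimately show ?thesis using that(2) by (simp only:)
    qed
    ultimately show "t (x + y) m * t (x - y) n = H (j (m, n))"
      unfolding H_def j_def t_def g_def split by blast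
  qed
  then have "(H has_sum (theta c \<epsilon> (x + y) * theta c \<epsilon> (x - y))) (Ev \<times> Ev \<union> Od \<times> Od)"
    using \<open>(_ has_sum _) (UNIV \<times> UNIV)\<close> has_sum_reindex_bij_betw[OF bij, of H] by simp
  moreover have "(H has_sum (half_theta c Ev x * half_theta c Ev y + \<epsilon> * (half_theta c Od x * half_theta c Od y))) (Ev \<times> Ev \<union> Od \<times> Od)"
  proof (rule has_sum_Un_disjoint)
    have "((\<lambda>(s, d). g x s * g y d) has_sum (half_theta c Ev x * half_theta c Ev y)) (Ev \<times> Ev)"
      unfolding half_theta_def g_def[symmetric] by (intro has_sum_product_Times gs)
    moreover have "H z = (case z of (s, d) \<Rightarrow> g x s * g y d)" if "z \<in> Ev \<times> Ev" for z
      using that e by (auto simp: H_def Ev_def)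
    ultimately show "(H has_sum (half_theta c Ev x * half_theta c Ev y)) (Ev \<times> Ev)"
      by (subst has_sum_cong) auto
    have "((\<lambda>z. \<epsilon> * (case z of (s, d) \<Rightarrow> g x s * g y d)) has_sum (\<epsilon> * (half_theta c Od x * half_theta c Od y))) (Od \<times> Od)"
      unfolding half_theta_def g_def[symmetric] by (intro has_sum_cmult_right has_sum_product_Times gs)
    moreover have "H z = \<epsilon> * (case z of (s, d) \<Rightarrow> g x s * g y d)" if "z \<in> Od \<times> Od" for z
      using that e by (auto simp: H_def Od_def)
    ultimately show "(H has_sum (\<epsilon> * (half_theta c Od x * half_theta c Od y))) (Od \<times> Od)"
      by (subst has_sum_cong) auto
  qed (auto simp: Ev_def Od_def)
  ultimately show ?thesis unfolding Ev_def Od_def by (rule has_sum_unique)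
qed

text \<open>Quasi-periodicity, by moving the summation index by one. The multipliers for \<epsilon>
  = 1 and \<epsilon> = - 1 differ only in sign, so the quotient of the two functions changes sign
  under a shift by \<open>2 * c\<close>.\<close>

lemma theta_shift:
  assumes c: "c > 0" and e: "\<epsilon> = 1 \<or> \<epsilon> = - 1"
  shows "theta c \<epsilon> (x + 2 * c) = \<epsilon> * exp (c + x) * theta c \<epsilon> x"
proof -
  have "theta c \<epsilon> (x + 2 * c) = (\<Sum>\<^sub>\<infinity>n::int. \<epsilon> powi (n + 1) * exp (- c * (real_of_int (n + 1))\<^sup>2 + real_of_int (n + 1) * (x + 2 * c)))"
    unfolding theta_def by (rule infsum_reindex_bij_witness[of _ "\<lambda>n. n + 1" "\<lambda>n. n - 1"]) auto
  also have "\<dots> = (\<Sum>\<^sub>\<infinity>n::int. \<epsilon> * exp (c + x) * (\<epsilon> powi n * exp (- c * (real_of_int n)\<^sup>2 + real_of_int n * x)))"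
  proof (rule infsum_cong)
    fix n :: int
    have "- c * (real_of_int (n + 1))\<^sup>2 + real_of_int (n + 1) * (x + 2 * c) = (c + x) + (- c * (real_of_int n)\<^sup>2 + real_of_int n * x)"
      by (simp add: power2_eq_square field_simps)
    moreover have "\<epsilon> powi (n + 1) = \<epsilon> * \<epsilon> powi n" using e by (subst power_int_add) auto
    ultimately show "\<epsilon> powi (n + 1) * exp (- c * (real_of_int (n + 1))\<^sup>2 + real_of_int (n + 1) * (x + 2 * c))
      = \<epsilon> * exp (c + x) * (\<epsilon> powi n * exp (- c * (real_of_int n)\<^sup>2 + real_of_int n * x))"
      by (simp only: exp_add mult_ac)
  qed
  also have "\<dots> = \<epsilon> * exp (c + x) * theta c \<epsilon> x"
    unfolding theta_def by (rule infsum_cmult_right')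
  finally show ?thesis .
qed

subsection \<open>A bound for Zolotarev numbers of two symmetric intervals\<close>

lemma half_theta_pos:
  assumes "c > 0" "S \<noteq> {}"
  shows "half_theta c S x > 0"
proof -
  obtain k where k: "k \<in> S" using assms by blast
  have "0 < exp (- (c/2) * (real_of_int k)\<^sup>2 + real_of_int k * x)" by simp
  also have "\<dots> = (\<Sum>n\<in>{k}. exp (- (c/2) * (real_of_int n)\<^sup>2 + real_of_int n * x))" by simp
  also have "\<dots> \<le> half_theta c S x"
    unfolding half_theta_def using k summable_on_gaussian_int[of "c/2" x S] assms
    by (intro finite_sum_le_infsum) auto
  finally show ?thesis .
qed

lemma continuous_on_half_theta:
  assumes c: "c > 0"
  shows "continuous_on {0..b} (half_theta c S)"
proof (rule uniform_limit_theorem)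
  show "uniform_limit {0..b} (\<lambda>X y. \<Sum>n\<in>X. exp (- (c/2) * (real_of_int n)\<^sup>2 + real_of_int n * y)) (half_theta c S) (finite_subsets_at_top S)"
    unfolding half_theta_def[abs_def]
  proof (rule Weierstrass_m_test_general)
    show "(\<lambda>n. exp ((\<bar>b\<bar> + 1)\<^sup>2 / (4 * (c/2))) * exp (- \<bar>real_of_int n\<bar>)) summable_on S"
      by (intro summable_on_cmult_right summable_on_subset[OF summable_on_exp_neg_abs_int]) auto
    fix n y assume "y \<in> {0..b}"
    then have y: "\<bar>y\<bar> \<le> \<bar>b\<bar>" by auto
    have "norm (exp (- (c/2) * (real_of_int n)\<^sup>2 + real_of_int n * y)) \<le> exp ((\<bar>y\<bar> + 1)\<^sup>2 / (4 * (c/2))) * exp (- \<bar>real_of_int n\<bar>)"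
      using gaussian_bound[of "c/2" "real_of_int n" y] c by simp
    also have "\<dots> \<le> exp ((\<bar>b\<bar> + 1)\<^sup>2 / (4 * (c/2))) * exp (- \<bar>real_of_int n\<bar>)"
      using y c by (intro mult_right_mono) (auto intro!: divide_right_mono power_mono)
    finally show "norm (exp (- (c/2) * (real_of_int n)\<^sup>2 + real_of_int n * y)) \<le> exp ((\<bar>b\<bar> + 1)\<^sup>2 / (4 * (c/2))) * exp (- \<bar>real_of_int n\<bar>)" .
  qed
  show "\<forall>\<^sub>F X in finite_subsets_at_top S. continuous_on {0..b} (\<lambda>y. \<Sum>n\<in>X. exp (- (c/2) * (real_of_int n)\<^sup>2 + real_of_int n * y))"
    by (intro always_eventually allI continuous_intros)
qed auto

text \<open>A shift of the index by one exchanges the parities. Consequently the quotient of the odd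
  by the even series takes reciprocal values at 0 and at \<open>c\<close>.\<close>

lemma half_theta_reflect:
  assumes c: "c > 0"
  shows "half_theta c {n. odd n} c = exp (c/2) * half_theta c {n. even n} 0"
    and "half_theta c {n. even n} c = exp (c/2) * half_theta c {n. odd n} 0"
proof -
  have key: "exp (- (c/2) * (real_of_int (n + 1))\<^sup>2 + real_of_int (n + 1) * c) = exp (c/2) * exp (- (c/2) * (real_of_int n)\<^sup>2 + real_of_int n * 0)" for n
    unfolding exp_add[symmetric] by (simp add: power2_eq_square field_simps)
  have "half_theta c {n. odd n} c = (\<Sum>\<^sub>\<infinity>n\<in>{n::int. even n}. exp (- (c/2) * (real_of_int (n + 1))\<^sup>2 + real_of_int (n + 1) * c))"
    unfolding half_theta_def by (rule infsum_reindex_bij_witness[of _ "\<lambda>n. n + 1" "\<lambda>n. n - 1"]) auto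
  then show "half_theta c {n. odd n} c = exp (c/2) * half_theta c {n. even n} 0"
    unfolding key half_theta_def by (simp only: infsum_cmult_right')
  have "half_theta c {n. even n} c = (\<Sum>\<^sub>\<infinity>n\<in>{n::int. odd n}. exp (- (c/2) * (real_of_int (n + 1))\<^sup>2 + real_of_int (n + 1) * c))"
    unfolding half_theta_def by (rule infsum_reindex_bij_witness[of _ "\<lambda>n. n + 1" "\<lambda>n. n - 1"]) auto
  then show "half_theta c {n. even n} c = exp (c/2) * half_theta c {n. odd n} 0"
    unfolding key half_theta_def by (simp only: infsum_cmult_right')
qed

text \<open>Each positive odd index is compared with the even index just below it, which costs at
  least \<open>exp (- c/2)\<close>; the negative odd indices give the same sum, whence the factor 2.
  For \<open>c = ln (4 * b / a)\<close> the whole factor is \<open>sqrt (a / b)\<close>.\<close>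

lemma half_theta_odd_le:
  assumes c: "c > 0"
  shows "half_theta c {n. odd n} 0 \<le> 2 * exp (- c/2) * half_theta c {n. even n} 0"
proof -
  define g where "g n = exp (- (c/2) * (real_of_int n)\<^sup>2)" for n :: int
  have gs: "g summable_on S" for S
    unfolding g_def using summable_on_gaussian_int[of "c/2" 0 S] c by simp
  have E: "half_theta c S 0 = infsum g S" for S by (simp add: half_theta_def g_def[abs_def])
  have "infsum g {n. odd n \<and> 0 < n} = (\<Sum>\<^sub>\<infinity>n\<in>{n. even n \<and> 0 \<le> n}. g (n + 1))"
    by (rule infsum_reindex_bij_witness[of _ "\<lambda>n. n + 1" "\<lambda>n. n - 1"]) auto
  moreover have "infsum g {n. odd n \<and> n < 0} = (\<Sum>\<^sub>\<infinity>n\<in>{n. even n \<and> 0 \<le> n}. g (n + 1))"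
    by (rule infsum_reindex_bij_witness[of _ "\<lambda>n. - n - 1" "\<lambda>n. - n - 1"]) (auto simp: g_def)
  moreover have "(\<Sum>\<^sub>\<infinity>n\<in>{n. even n \<and> 0 \<le> n}. g (n + 1)) \<le> exp (- c/2) * infsum g {n. even n}"
  proof -
    have le: "g (n + 1) \<le> exp (- c/2) * g n" if "n \<ge> 0" for n
      using that c unfolding g_def exp_add[symmetric] by (simp add: power2_eq_square algebra_simps)
    have s: "(\<lambda>n. exp (- c/2) * g n) summable_on S" for S by (intro summable_on_cmult_right gs)
    have "(\<Sum>\<^sub>\<infinity>n\<in>{n. even n \<and> 0 \<le> n}. g (n + 1)) \<le> (\<Sum>\<^sub>\<infinity>n\<in>{n. even n}. exp (- c/2) * g n)"
    proof (rule infsum_mono_neutral[OF _ s])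
      show "(\<lambda>n. g (n + 1)) summable_on {n. even n \<and> 0 \<le> n}"
        by (rule summable_on_comparison_test[OF s]) (use le in \<open>auto simp: g_def\<close>)
    qed (use le in \<open>auto simp: g_def\<close>)
    then show ?thesis by (simp add: infsum_cmult_right')
  qed
  moreover have "infsum g {n. odd n} = infsum g {n. odd n \<and> 0 < n} + infsum g {n. odd n \<and> n < 0}"
  proof -
    have "{n::int. odd n} = {n. odd n \<and> 0 < n} \<union> {n. odd n \<and> n < 0}" by (auto simp: neq_iff)
      (metis even_zero linorder_neqE_linordered_idom)
    then show ?thesis by (metis (mono_tags, lifting) infsum_Un_disjoint[OF gs gs] disjoint_iff mem_Collect_eq order_less_asym)
  qed
  ultimately show ?thesis unfolding E by simp
qed

section \<open>Theta quotients as products of \<open>tanh\<close>\<close>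

text \<open>One factor of the product for the quotient of theta 4 by theta 3. It equals
  \<open>(cosh a - cosh x) / (cosh a + cosh x)\<close>.\<close>

definition tanh_pair :: "real \<Rightarrow> real \<Rightarrow> real" where
  "tanh_pair a x = tanh ((a - x) / 2) * tanh ((a + x) / 2)"

text \<open>The factors \<open>(1 - y) / (1 + y)\<close> of the quotient of the two products, with
  \<open>y\<close> an exponential, are values of \<open>tanh\<close>; the common constant
  \<open>C\<close> cancels.\<close>

lemma theta_quotient_limit:
  assumes c: "c > 0" and p: "theta c 1 x \<noteq> 0"
  shows "(\<lambda>N. \<Prod>n<N. tanh_pair ((2 * real n + 1) * c) x) \<longlonglongrightarrow> theta c (- 1) x / theta c 1 x"
proof -
  from theta_product_limit[OF c] obtain C where C: "C > 0" and L: "\<And>\<epsilon> x. \<bar>\<epsilon>\<bar> = 1 \<Longrightarrow>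
    (\<lambda>N. \<Prod>n<N. (1 + \<epsilon> * exp (- (2 * real n + 1) * c + x)) * (1 + \<epsilon> * exp (- (2 * real n + 1) * c - x))) \<longlonglongrightarrow> C * theta c \<epsilon> x"
    by blast
  have "tanh_pair a x = ((1 + (- 1) * exp (- a + x)) * (1 + (- 1) * exp (- a - x))) / ((1 + 1 * exp (- a + x)) * (1 + 1 * exp (- a - x)))" for a
  proof -
    have "- 2 * ((a - x) / 2) = - a + x" "- 2 * ((a + x) / 2) = - a - x" by simp_all
    then show ?thesis
      unfolding tanh_pair_def tanh_real_altdef
      by (simp only: times_divide_times_eq mult_1 mult_minus1 diff_conv_add_uminus)
  qed
  then have "(\<Prod>n<N. tanh_pair ((2 * real n + 1) * c) x) = (\<Prod>n<N. (1 + (- 1) * exp (- (2 * real n + 1) * c + x)) * (1 + (- 1) * exp (- (2 * real n + 1) * c - x)))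
    / (\<Prod>n<N. (1 + 1 * exp (- (2 * real n + 1) * c + x)) * (1 + 1 * exp (- (2 * real n + 1) * c - x)))" for N
    unfolding prod_dividef[symmetric] by (intro prod.cong refl) (simp only: minus_mult_left)
  then show ?thesis
    using tendsto_divide[OF L[of "- 1" x] L[of 1 x]] C p by simp
qed

lemma theta_one_pos:
  assumes c: "c > 0"
  shows "theta c 1 x > 0"
proof -
  have "theta c 1 x = half_theta (2 * c) UNIV x" by (simp add: theta_def half_theta_def)
  then show ?thesis using half_theta_pos[of "2 * c" UNIV x] c by simp
qed

text \<open>Written with \<open>cosh\<close>, the pair is seen to be nonnegative for
  \<open>\<bar>x\<bar> \<le> a\<close> and largest at \<open>x = 0\<close>.\<close>

lemma abs_tanh_pair_le:
  assumes "\<bar>x\<bar> \<le> a"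
  shows "\<bar>tanh_pair a x\<bar> \<le> (tanh (a / 2))\<^sup>2"
proof -
  have eq: "tanh ((a - x) / 2) * tanh ((a + x) / 2) = (cosh a - cosh x) / (cosh a + cosh x)" for x
  proof -
    define u v where "u = a / 2" and "v = x / 2"
    have p: "cosh u > 0" "cosh v > 0" "cosh (u - v) > 0" "cosh (u + v) > 0" by auto
    have a: "cosh a = cosh ((u + v) + (u - v))" "cosh x = cosh ((u + v) - (u - v))" by (simp_all add: u_def v_def)
    have "tanh ((a - x) / 2) * tanh ((a + x) / 2) = (sinh (u - v) * sinh (u + v)) / (cosh (u - v) * cosh (u + v))"
      by (simp add: tanh_def u_def v_def diff_divide_distrib add_divide_distrib)
    also have "\<dots> = (2 * (sinh (u - v) * sinh (u + v))) / (2 * (cosh (u - v) * cosh (u + v)))" by simp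
    also have "2 * (sinh (u - v) * sinh (u + v)) = cosh a - cosh x"
      unfolding a cosh_add cosh_diff by (simp add: mult_ac)
    also have "2 * (cosh (u - v) * cosh (u + v)) = cosh a + cosh x"
      unfolding a cosh_add cosh_diff by (simp add: mult_ac)
    finally show ?thesis .
  qed
  have x: "1 \<le> cosh x" "cosh x \<le> cosh a"
    using assms cosh_real_ge_1 by (auto, metis abs_ge_zero cosh_real_abs cosh_real_nonneg_le_iff order_trans)
  have "\<bar>tanh_pair a x\<bar> = (cosh a - cosh x) / (cosh a + cosh x)"
    using x unfolding tanh_pair_def eq by simp
  also have "\<dots> \<le> (cosh a - 1) / (cosh a + 1)" using x by (simp add: field_simps)
  also have "\<dots> = (tanh (a / 2))\<^sup>2" using eq[of 0] by (simp add: power2_eq_square)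
  finally show ?thesis .
qed

lemma prod_lessThan_add:
  fixes f :: "nat \<Rightarrow> 'a :: comm_monoid_mult"
  shows "prod f {..<m + n} = prod f {..<m} * (\<Prod>i<n. f (m + i))"
  by (induction n) (simp_all add: mult.assoc)

text \<open>Shifts of \<open>x\<close> can be moved to the first argument. There the points at
  distance \<open>(j + 1/2) * h\<close> on both sides of the odd multiples of \<open>k * h\<close>
  are exactly the half-integer multiples of \<open>h\<close>, each hit once; block \<open>n\<close>
  covers the indices from \<open>2 * k * n\<close> to \<open>2 * k * (n + 1) - 1\<close>.\<close>

lemma tanh_pair_shift_prod:
  assumes "k > 0"
  shows "(\<Prod>j<k. \<Prod>n<N. tanh_pair ((2 * real n + 1) * (real k * h)) (x + (real j + 1/2) * h) * tanh_pair ((2 * real n + 1) * (real k * h)) (x - (real j + 1/2) * h))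
    = (\<Prod>i<2*k*N. tanh_pair ((real i + 1/2) * h) x)"
proof -
  have sw: "tanh_pair a (x + u) * tanh_pair a (x - u) = tanh_pair (a - u) x * tanh_pair (a + u) x" for a u
    unfolding tanh_pair_def by (simp add: algebra_simps)
  have blk: "(\<Prod>j<k. tanh_pair ((2 * real n + 1) * (real k * h) - (real j + 1/2) * h) x * tanh_pair ((2 * real n + 1) * (real k * h) + (real j + 1/2) * h) x)
    = (\<Prod>i<2*k. tanh_pair ((real (2*k*n + i) + 1/2) * h) x)" for n
  proof -
    have "(\<Prod>i<2*k. tanh_pair ((real (2*k*n + i) + 1/2) * h) x)
      = (\<Prod>i<k. tanh_pair ((real (2*k*n + i) + 1/2) * h) x) * (\<Prod>i<k. tanh_pair ((real (2*k*n + (k + i)) + 1/2) * h) x)"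
      unfolding mult_2 by (rule prod_lessThan_add)
    also have "(\<Prod>i<k. tanh_pair ((real (2*k*n + i) + 1/2) * h) x) = (\<Prod>j<k. tanh_pair ((2 * real n + 1) * (real k * h) - (real j + 1/2) * h) x)"
      by (subst prod.nat_diff_reindex[symmetric]) (intro prod.cong refl arg_cong2[where f = tanh_pair], auto simp: of_nat_diff algebra_simps)
    also have "(\<Prod>i<k. tanh_pair ((real (2*k*n + (k + i)) + 1/2) * h) x) = (\<Prod>j<k. tanh_pair ((2 * real n + 1) * (real k * h) + (real j + 1/2) * h) x)"
      by (intro prod.cong refl arg_cong2[where f = tanh_pair]) (auto simp: algebra_simps)
    finally show ?thesis by (simp add: prod.distrib)
  qed
  have "(\<Prod>n<N. \<Prod>i<2*k. tanh_pair ((real (2*k*n + i) + 1/2) * h) x) = (\<Prod>i<2*k*N. tanh_pair ((real i + 1/2) * h) x)"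
  proof (induction N)
    case (Suc N)
    have "2 * k * Suc N = 2 * k * N + 2 * k" by simp
    then show ?case using Suc prod_lessThan_add[of "\<lambda>i. tanh_pair ((real i + 1/2) * h) x" "2*k*N" "2*k"]
      by (simp only: prod.lessThan_Suc)
  qed simp
  then show ?thesis unfolding blk[symmetric] sw by (subst prod.swap) simp
qed

lemma convergent_tanh_prod:
  fixes h :: real
  assumes "h > 0"
  shows "convergent (\<lambda>M. \<Prod>n<M. (tanh ((real n + 1/2) * h / 2))\<^sup>2)"
proof -
  have t: "0 \<le> tanh ((real n + 1/2) * h / 2)" "tanh ((real n + 1/2) * h / 2) \<le> 1" for n
    using assms tanh_real_lt_1 by (auto intro: less_imp_le)
  have "decseq (\<lambda>M. \<Prod>n<M. (tanh ((real n + 1/2) * h / 2))\<^sup>2)"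
    unfolding decseq_Suc_iff prod.lessThan_Suc using t
    by (intro allI mult_left_le prod_nonneg power_le_one) auto
  moreover have "0 \<le> (\<Prod>n<M. (tanh ((real n + 1/2) * h / 2))\<^sup>2)" for M
    by (intro prod_nonneg) auto
  ultimately show ?thesis
    by (metis decseq_convergent convergent_def)
qed

text \<open>With \<open>T = Od / E\<close> the identity for \<open>theta (v + u) * theta (v - u)\<close> turns each factor
  \<open>(T v - 1 / T u) / (T v + 1 / T u)\<close> into a product of two theta quotients. For equidistant \<open>u\<close> these
  combine to a doubly infinite product of \<open>tanh\<close> with period \<open>h\<close>. The choice \<open>L = ln (4 * b / a)\<close> makes
  the range of \<open>sqrt (a * b) * T\<close> on \<open>{0..L}\<close> contain \<open>{a..b}\<close>.\<close>

lemma zolotarev_bound: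
  fixes a b :: real
  assumes a: "0 < a" "a < b" and k: "k > 0"
  shows "\<exists>p :: nat \<Rightarrow> real. (\<forall>j. 0 < p j) \<and>
    (\<forall>y\<in>{a..b}. \<bar>\<Prod>j<k. (y - p j) / (y + p j)\<bar> \<le> 2 * exp (- (pi\<^sup>2 * real k / (2 * ln (4 * b / a)))))"
proof -
  define L where "L = ln (4 * b / a)"
  have "4 * b / a > 1" using a by (simp add: field_simps)
  then have L: "L > 0" unfolding L_def by (rule ln_gt_zero)
  \<comment> \<open>The spacing for which \<open>2 * k\<close> equidistant points fill the length
    \<open>2 * L\<close>, after which \<open>R\<close> repeats up to sign.\<close>
  define h where "h = L / real k"
  have h: "h > 0" "real k * h = L" using L k by (auto simp: h_def)
  define E where "E = half_theta L {n. even n}"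
  define Od where "Od = half_theta L {n. odd n}"
  have ne: "{n::int. even n} \<noteq> {}" "{n::int. odd n} \<noteq> {}" using even_zero odd_one by blast+
  have pos: "E x > 0" "Od x > 0" for x
    unfolding E_def Od_def using half_theta_pos[OF L] ne by auto
  define R where "R x = theta L (- 1) x / theta L 1 x" for x
  have R: "R (v + u) * R (v - u) = (E v * E u - Od v * Od u) / (E v * E u + Od v * Od u)" for u v
    using theta_add_times_theta_diff[OF L, of 1 v u] theta_add_times_theta_diff[OF L, of "- 1" v u]
    unfolding R_def E_def Od_def by (simp add: times_divide_times_eq)
  have Rshift: "R (x + 2 * L) = - R x" for x
    unfolding R_def theta_shift[OF L, of 1, simplified] theta_shift[OF L, of "- 1", simplified] by simp
  define u where "u j = (real j + 1/2) * h" for j :: nat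
  define G where "G x = (\<Prod>j<k. R (x + u j) * R (x - u j))" for x
  have G: "G x = (\<Prod>i<2*k. R (x - L + (real i + 1/2) * h))" for x
  proof -
    have "(\<Prod>i<2*k. R (x - L + (real i + 1/2) * h)) = (\<Prod>i<k. R (x - L + (real i + 1/2) * h)) * (\<Prod>i<k. R (x - L + (real (k + i) + 1/2) * h))"
      unfolding mult_2 by (rule prod_lessThan_add)
    also have "(\<Prod>i<k. R (x - L + (real i + 1/2) * h)) = (\<Prod>j<k. R (x - u j))"
      by (subst prod.nat_diff_reindex[symmetric]) (intro prod.cong refl arg_cong[where f = R], auto simp: of_nat_diff algebra_simps u_def h(2)[symmetric])
    also have "(\<Prod>i<k. R (x - L + (real (k + i) + 1/2) * h)) = (\<Prod>j<k. R (x + u j))"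
      by (intro prod.cong refl arg_cong[where f = R]) (auto simp: algebra_simps u_def h(2)[symmetric])
    finally show ?thesis by (simp add: G_def prod.distrib)
  qed
  \<comment> \<open>A shift by \<open>h\<close> moves every factor to its neighbour. The factor
    leaving at one end returns at the other with the opposite sign, by
    \<open>Rshift\<close>.\<close>
  have Gh: "\<bar>G (x + h)\<bar> = \<bar>G x\<bar>" for x
  proof -
    obtain M where M: "2 * k = Suc M" using k by (metis Suc_pred mult_pos_pos zero_less_numeral)
    define f where "f i = R (x - L + (real i + 1/2) * h)" for i :: nat
    have "real (Suc M) * h = 2 * L" using h(2) M by (metis mult.assoc of_nat_mult of_nat_numeral)
    then have "x - L + (real (Suc M) + 1/2) * h = (x - L + (real 0 + 1/2) * h) + 2 * L"
      by (simp add: algebra_simps)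
    then have f: "f (Suc M) = - f 0" unfolding f_def by (simp only: Rshift)
    have "G (x + h) = (\<Prod>i<Suc M. f (Suc i))"
      unfolding G M f_def by (intro prod.cong refl arg_cong[where f = R]) (simp add: algebra_simps)
    also have "\<dots> = (\<Prod>i<M. f (Suc i)) * f (Suc M)" by simp
    finally have "\<bar>G (x + h)\<bar> = \<bar>f 0 * (\<Prod>i<M. f (Suc i))\<bar>" by (simp add: f abs_mult)
    also have "f 0 * (\<Prod>i<M. f (Suc i)) = G x"
      unfolding G M f_def by (subst prod.lessThan_Suc_shift) simp
    finally show ?thesis .
  qed
  have Ghn: "\<bar>G (x + real n * h)\<bar> = \<bar>G x\<bar>" for x n
  proof (induction n)
    case (Suc n)
    have "x + real (Suc n) * h = (x + real n * h) + h" by (simp add: algebra_simps)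
    then show ?case using Gh[of "x + real n * h"] Suc by (simp only:)
  qed simp
  have Ghi: "\<bar>G (x + real_of_int r * h)\<bar> = \<bar>G x\<bar>" for x r
  proof (cases r)
    case (nonneg n) then show ?thesis using Ghn by simp
  next
    case (neg n)
    have "x + real_of_int r * h + real (Suc n) * h = x" unfolding neg by (simp add: algebra_simps)
    then show ?thesis using Ghn[of "x + real_of_int r * h" "Suc n"] by (simp only:)
  qed
  \<comment> \<open>The smallest first argument in the product is \<open>h / 2\<close>, and
    \<open>abs_tanh_pair_le\<close> needs it to dominate \<open>\<bar>x\<bar>\<close>; hence the
    restriction. Periodicity removes it below.\<close>
  have Gsmall: "\<bar>G x\<bar> \<le> 2 * exp (- pi\<^sup>2 / (2 * h))" if x: "\<bar>x\<bar> \<le> h / 2" for x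
  proof -
    obtain l where l: "(\<lambda>M. \<Prod>n<M. (tanh ((real n + 1/2) * h / 2))\<^sup>2) \<longlonglongrightarrow> l"
      using convergent_tanh_prod[OF h(1)] by (auto simp: convergent_def)
    have nz: "theta L 1 z \<noteq> 0" for z using theta_one_pos[OF L, of z] by simp
    have "(\<lambda>N. \<Prod>j<k. (\<Prod>n<N. tanh_pair ((2 * real n + 1) * L) (x + u j)) * (\<Prod>n<N. tanh_pair ((2 * real n + 1) * L) (x - u j))) \<longlonglongrightarrow> G x"
      unfolding G_def R_def by (intro tendsto_prod tendsto_mult theta_quotient_limit L nz)
    moreover have "(\<Prod>j<k. (\<Prod>n<N. tanh_pair ((2 * real n + 1) * L) (x + u j)) * (\<Prod>n<N. tanh_pair ((2 * real n + 1) * L) (x - u j)))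
       = (\<Prod>i<2*k*N. tanh_pair ((real i + 1/2) * h) x)" for N
      using tanh_pair_shift_prod[OF k, where h = h and N = N and x = x] unfolding h(2) u_def prod.distrib by simp
    ultimately have "(\<lambda>N. \<bar>\<Prod>i<2*k*N. tanh_pair ((real i + 1/2) * h) x\<bar>) \<longlonglongrightarrow> \<bar>G x\<bar>"
      by (intro tendsto_rabs) simp
    moreover have "(\<lambda>N. \<Prod>n<2*k*N. (tanh ((real n + 1/2) * h / 2))\<^sup>2) \<longlonglongrightarrow> l"
      using LIMSEQ_subseq_LIMSEQ[OF l, of "\<lambda>N. 2*k*N"] k by (simp add: strict_mono_def o_def)
    moreover have "\<bar>\<Prod>i<2*k*N. tanh_pair ((real i + 1/2) * h) x\<bar> \<le> (\<Prod>n<2*k*N. (tanh ((real n + 1/2) * h / 2))\<^sup>2)" for N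
      unfolding abs_prod
    proof (intro prod_mono conjI abs_ge_zero abs_tanh_pair_le)
      fix i :: nat
      have "h / 2 \<le> (real i + 1/2) * h" using h by (simp add: algebra_simps)
      then show "\<bar>x\<bar> \<le> (real i + 1/2) * h" using x by linarith
    qed
    ultimately have "\<bar>G x\<bar> \<le> l" by (intro LIMSEQ_le) auto
    also have "l \<le> 2 * exp (- pi\<^sup>2 / (2 * h))" by (rule tanh_prod_limit_le[OF h(1) l])
    finally show ?thesis .
  qed
  have Gall: "\<bar>G x\<bar> \<le> 2 * exp (- pi\<^sup>2 / (2 * h))" for x
  proof -
    define r where "r = round (x / h)"
    have "\<bar>real_of_int r - x / h\<bar> \<le> 1/2" unfolding r_def by (rule of_int_round_abs_le)
    then have "\<bar>real_of_int r - x / h\<bar> * h \<le> 1/2 * h" using h by (intro mult_right_mono) auto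
    moreover have "\<bar>real_of_int r - x / h\<bar> * h = \<bar>x - real_of_int r * h\<bar>"
    proof -
      have "\<bar>real_of_int r - x / h\<bar> * h = \<bar>(real_of_int r - x / h) * h\<bar>" using h by (simp add: abs_mult)
      also have "(real_of_int r - x / h) * h = - (x - real_of_int r * h)" using h by (simp add: field_simps)
      finally show ?thesis by (simp only: abs_minus_cancel)
    qed
    ultimately have "\<bar>x + real_of_int (- r) * h\<bar> \<le> h / 2" by simp
    from Gsmall[OF this] show ?thesis unfolding Ghi .
  qed
  \<comment> \<open>In the parametrization of \<open>y\<close> by \<open>sqrt (a * b) * T v\<close>,
    these are the points at which \<open>T v = 1 / T (u j)\<close>.\<close>
  define p where "p j = sqrt (a * b) * (E (u j) / Od (u j))" for j
  show ?thesis
  proof (intro exI[of _ p] conjI allI ballI)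
    show "0 < p j" for j using a pos by (simp add: p_def)
    fix y assume y: "y \<in> {a..b}"
    define s where "s = sqrt (a * b)"
    have s: "s > 0" "s\<^sup>2 = a * b" using a by (auto simp: s_def)
    \<comment> \<open>Intermediate values: at 0 the quotient is at most
      \<open>a / s = sqrt (a / b)\<close>, by the choice of \<open>L\<close>, and at
      \<open>L\<close> it is the reciprocal, hence at least \<open>b / s\<close>.\<close>
    have "\<exists>v\<ge>0. v \<le> L \<and> Od v / E v = y / s"
    proof (rule IVT')
      have eL: "(exp (- L / 2))\<^sup>2 = a / (4 * b)"
      proof -
        have "(exp (- L / 2))\<^sup>2 = exp (2 * (- L / 2))" by (simp only: exp_double)
        also have "\<dots> = inverse (exp L)" by (simp add: exp_minus)
        also have "exp L = 4 * b / a" unfolding L_def using a by simp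
        finally show ?thesis by simp
      qed
      have eL': "exp (- L / 2) = a / (2 * s)"
      proof (rule power2_eq_imp_eq)
        show "(exp (- L / 2))\<^sup>2 = (a / (2 * s))\<^sup>2" unfolding eL
          using a s by (simp add: power_divide power_mult_distrib power2_eq_square)
      qed (use a s in auto)
      have O0: "Od 0 \<le> 2 * exp (- L / 2) * E 0" unfolding Od_def E_def by (rule half_theta_odd_le[OF L])
      then have O0': "Od 0 / E 0 \<le> a / s" using pos[of 0] s unfolding eL' by (simp add: field_simps)
      also have "\<dots> \<le> y / s" using y s by (intro divide_right_mono) auto
      finally show "Od 0 / E 0 \<le> y / s" .
      have "y / s \<le> b / s" using y s by (intro divide_right_mono) auto
      also have "b / s = inverse (a / s)" using s a by (simp add: field_simps power2_eq_square)
      also have "\<dots> \<le> inverse (Od 0 / E 0)" using O0' pos[of 0] by (intro le_imp_inverse_le) auto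
      also have "\<dots> = Od L / E L" unfolding Od_def E_def half_theta_reflect[OF L] by simp
      finally show "y / s \<le> Od L / E L" .
      show "continuous_on {0..L} (\<lambda>v. Od v / E v)"
        unfolding Od_def E_def using continuous_on_half_theta[OF L] pos(1)[unfolded E_def]
        by (intro continuous_on_divide) (auto simp: less_imp_neq[symmetric])
    qed (use L in auto)
    then obtain v where v: "Od v / E v = y / s" by blast
    then have yv: "y = s * (Od v / E v)" using s by (simp add: field_simps)
    have "(y - p j) / (y + p j) = - (R (v + u j) * R (v - u j))" for j
    proof -
      have "(y - p j) / (y + p j) = (Od v / E v - E (u j) / Od (u j)) / (Od v / E v + E (u j) / Od (u j))"
        unfolding yv p_def s_def[symmetric] right_diff_distrib[symmetric] distrib_left[symmetric]
        by (rule mult_divide_mult_cancel_left) (use s in simp)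
      also have "\<dots> = (Od v * Od (u j) - E v * E (u j)) / (Od v * Od (u j) + E v * E (u j))"
      proof -
        have "Od v / E v - E (u j) / Od (u j) = (Od v * Od (u j) - E v * E (u j)) / (E v * Od (u j))"
          "Od v / E v + E (u j) / Od (u j) = (Od v * Od (u j) + E v * E (u j)) / (E v * Od (u j))"
          using pos[of v] pos[of "u j"] by (simp_all add: field_simps)
        then show ?thesis using pos[of v] pos[of "u j"] by simp
      qed
      finally show ?thesis unfolding R
        by (metis add.commute minus_diff_eq minus_divide_left)
    qed
    then have "\<bar>\<Prod>j<k. (y - p j) / (y + p j)\<bar> = \<bar>G v\<bar>"
      unfolding G_def abs_prod by simp
    also have "\<dots> \<le> 2 * exp (- pi\<^sup>2 / (2 * h))" by (rule Gall)
    also have "- pi\<^sup>2 / (2 * h) = - (pi\<^sup>2 * real k / (2 * ln (4 * b / a)))"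
      unfolding h_def L_def[symmetric] by simp
    finally show "\<bar>\<Prod>j<k. (y - p j) / (y + p j)\<bar> \<le> 2 * exp (- (pi\<^sup>2 * real k / (2 * ln (4 * b / a))))" .
  qed
qed

subsection \<open>Unitary diagonalization and singular values\<close>

lemma dim_mat_adjoint [simp]: "dim_row (mat_adjoint A) = dim_col A" "dim_col (mat_adjoint A) = dim_row A"
  by (simp_all add: mat_adjoint_def)

lemma mat_adjoint_carrier [simp, intro]: "A \<in> carrier_mat m n \<Longrightarrow> mat_adjoint A \<in> carrier_mat n m"
  by (rule carrier_matI) auto

lemma index_mat_adjoint [simp]:
  fixes A :: "complex mat"
  assumes "i < dim_col A" "j < dim_row A"
  shows "mat_adjoint A $$ (i, j) = cnj (A $$ (j, i))"
  using assms by (simp add: mat_adjoint_def mat_of_rows_index)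

lemma index_mult_mat_sum:
  assumes "A \<in> carrier_mat n k" "B \<in> carrier_mat k m" "i < n" "j < m"
  shows "(A * B) $$ (i, j) = (\<Sum>l<k. A $$ (i, l) * B $$ (l, j))"
  using assms by (simp add: scalar_prod_def lessThan_atLeast0)

lemma mat_adjoint_mult:
  fixes A B :: "complex mat"
  assumes "A \<in> carrier_mat n k" "B \<in> carrier_mat k m"
  shows "mat_adjoint (A * B) = mat_adjoint B * mat_adjoint A"
proof (rule eq_matI)
  fix i j assume "i < dim_row (mat_adjoint B * mat_adjoint A)" "j < dim_col (mat_adjoint B * mat_adjoint A)"
  then have ij: "i < m" "j < n" using assms by auto
  have "mat_adjoint (A * B) $$ (i, j) = (\<Sum>l<k. cnj (A $$ (j, l)) * cnj (B $$ (l, i)))"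
    using assms ij by (simp add: index_mult_mat_sum[OF assms] del: index_mult_mat(1))
  also have "\<dots> = (mat_adjoint B * mat_adjoint A) $$ (i, j)"
    using assms ij by (subst index_mult_mat_sum[where k = k]) (auto intro!: sum.cong)
  finally show "mat_adjoint (A * B) $$ (i, j) = (mat_adjoint B * mat_adjoint A) $$ (i, j)" .
qed (use assms in auto)

lemma mat_adjoint_adjoint [simp]: "mat_adjoint (mat_adjoint A) = (A :: complex mat)"
  by (rule eq_matI) auto

lemma mat_adjoint_one [simp]: "mat_adjoint (1\<^sub>m n) = (1\<^sub>m n :: complex mat)"
  by (rule eq_matI) auto

lemma mat_adjoint_four_block_one:
  fixes P :: "complex mat"
  assumes "P \<in> carrier_mat k k"
  shows "mat_adjoint (four_block_mat (1\<^sub>m 1) (0\<^sub>m 1 k) (0\<^sub>m k 1) P) = four_block_mat (1\<^sub>m 1) (0\<^sub>m 1 k) (0\<^sub>m k 1) (mat_adjoint P)"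
  by (rule eq_matI) (use assms in auto)

lemma unit_vector_completion:
  fixes v :: "complex vec"
  assumes v: "v \<in> carrier_vec n" and v0: "v \<noteq> 0\<^sub>v n"
  shows "\<exists>W c. W \<in> carrier_mat n n \<and> mat_adjoint W * W = 1\<^sub>m n \<and> col W 0 = c \<cdot>\<^sub>v v"
proof -
  have n: "n \<noteq> 0"
  proof
    assume "n = 0"
    then have "v = 0\<^sub>v n" using v by auto
    with v0 show False by simp
  qed
  define bs where "bs = basis_completion v"
  define ws0 where "ws0 = gram_schmidt n bs"
  interpret cof_vec_space n "TYPE(complex)" .
  from basis_completion[OF v v0, folded bs_def]
  have b: "distinct bs" "\<not> lin_dep (set bs)" "set bs \<subseteq> carrier_vec n" "hd bs = v" "length bs = n"
    by auto
  from b n obtain vs where bv: "bs = v # vs" by (cases bs, auto)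
  from gram_schmidt_result[OF b(3,1,2) refl, folded ws0_def]
  have ws0: "set ws0 \<subseteq> carrier_vec n" "corthogonal ws0" "length ws0 = n" by (auto simp: b(5))
  from gram_schmidt_hd[OF v, of vs, folded bv] have hd0: "hd ws0 = v" unfolding ws0_def .
  \<comment> \<open>\<open>gram_schmidt\<close> yields orthogonal vectors of arbitrary length;
    scaling by inverse lengths keeps the first column a multiple of \<open>v\<close>.\<close>
  define s where "s i = complex_of_real (1 / sqrt (Re (ws0 ! i \<bullet>c ws0 ! i)))" for i
  define W where "W = mat_of_cols n (map (\<lambda>i. s i \<cdot>\<^sub>v (ws0 ! i)) [0..<n])"
  have W: "W \<in> carrier_mat n n" unfolding W_def by auto
  have wi: "ws0 ! i \<in> carrier_vec n" if "i < n" for i using ws0 that by auto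
  have colW: "col W i = s i \<cdot>\<^sub>v (ws0 ! i)" if "i < n" for i
    unfolding W_def using that wi by (subst col_mat_of_cols) auto
  have Wij: "W $$ (q, i) = s i * ws0 ! i $ q" if "i < n" "q < n" for i q
    using colW[OF that(1)] that W wi[OF that(1)] by (metis carrier_matD carrier_vecD index_col index_smult_vec(1))
  have sp: "(\<Sum>q<n. ws0 ! i $ q * cnj (ws0 ! j $ q)) = ws0 ! i \<bullet>c ws0 ! j" if "i < n" "j < n" for i j
    using wi[OF that(2)] that by (simp add: scalar_prod_def lessThan_atLeast0)
  have diag: "(\<Sum>q<n. (W $$ (q, i)) * cnj (W $$ (q, i))) = 1" if i: "i < n" for i
  proof -
    define d where "d = ws0 ! i \<bullet>c ws0 ! i"
    have "d \<noteq> 0" using corthogonalD[OF ws0(2), of i i] i ws0 by (simp add: d_def)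
    moreover have "d = complex_of_real (\<Sum>q<n. (cmod (ws0 ! i $ q))\<^sup>2)"
      unfolding d_def sp[OF i i, symmetric] of_real_sum complex_norm_square ..
    moreover have "0 \<le> (\<Sum>q<n. (cmod (ws0 ! i $ q))\<^sup>2)" by (simp add: sum_nonneg)
    moreover have "z = complex_of_real (Re z) \<and> Re z > 0" if "z \<noteq> 0" "z = complex_of_real r" "0 \<le> r" for z r
      using that by auto
    ultimately have d: "d = complex_of_real (Re d)" "Re d > 0" by blast+
    have "(\<Sum>q<n. (W $$ (q, i)) * cnj (W $$ (q, i))) = (s i * cnj (s i)) * d"
      unfolding d_def sp[OF i i, symmetric] sum_distrib_left using i by (intro sum.cong) (auto simp: Wij)
    also have "s i * cnj (s i) = complex_of_real (1 / Re d)"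
      using d(2) unfolding s_def d_def[symmetric] by (simp flip: of_real_mult)
    also have "complex_of_real (1 / Re d) * d = 1" using d by (metis nonzero_eq_divide_eq of_real_1 of_real_mult less_irrefl)
    finally show ?thesis .
  qed
  have off: "(\<Sum>q<n. (W $$ (q, i)) * cnj (W $$ (q, j))) = 0" if ij: "i < n" "j < n" "i \<noteq> j" for i j
  proof -
    have "(\<Sum>q<n. (W $$ (q, i)) * cnj (W $$ (q, j))) = (s i * cnj (s j)) * (ws0 ! i \<bullet>c ws0 ! j)"
      unfolding sp[OF ij(1,2), symmetric] sum_distrib_left using ij by (intro sum.cong) (auto simp: Wij)
    also have "ws0 ! i \<bullet>c ws0 ! j = 0" using corthogonalD[OF ws0(2), of i j] ij ws0 by simp
    finally show ?thesis by simp
  qed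
  have "mat_adjoint W * W = 1\<^sub>m n"
  proof (rule eq_matI)
    fix i j assume "i < dim_row (1\<^sub>m n)" "j < dim_col (1\<^sub>m n)"
    then have ij: "i < n" "j < n" by auto
    have "(mat_adjoint W * W) $$ (i, j) = (\<Sum>q<n. W $$ (q, j) * cnj (W $$ (q, i)))"
      using W ij by (subst index_mult_mat_sum[where k = n]) (auto intro!: sum.cong)
    then show "(mat_adjoint W * W) $$ (i, j) = 1\<^sub>m n $$ (i, j)"
      using diag[OF ij(1)] off[OF ij(2,1)] ij by auto
  qed (use W in auto)
  moreover have "col W 0 = s 0 \<cdot>\<^sub>v v"
    using colW[of 0] n hd0 ws0 by (metis hd_conv_nth length_0_conv neq0_conv)
  ultimately show ?thesis using W by blast
qed

text \<open>Deflation: a unitary matrix whose first column is an eigenvector splits off one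
  eigenvalue, and the remaining block is treated by induction. The order of the diagonal is
  prescribed by \<open>es\<close>, so that singular values can later be listed in non-increasing
  order.\<close>

lemma unitary_schur:
  fixes A :: "complex mat"
  assumes "A \<in> carrier_mat n n" and "char_poly A = (\<Prod>e\<leftarrow>es. [:- e, 1:])"
  shows "\<exists>U. U \<in> carrier_mat n n \<and> mat_adjoint U * U = 1\<^sub>m n \<and>
    upper_triangular (mat_adjoint U * A * U) \<and> diag_mat (mat_adjoint U * A * U) = es"
  using assms
proof (induction es arbitrary: n A)
  case Nil
  then have "n = 0" using degree_monic_char_poly[of A n] by simp
  with Nil show ?case by (intro exI[of _ "1\<^sub>m n"]) (auto simp: diag_mat_def)
next
  case (Cons e es)
  note A = Cons.prems(1)
  have cp: "char_poly A = [:- e, 1:] * (\<Prod>e\<leftarrow>es. [:- e, 1:])" using Cons.prems(2) by simp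
  have ev: "eigenvalue A e" unfolding eigenvalue_root_char_poly[OF A] cp by simp
  then obtain v where v: "v \<in> carrier_vec n" "v \<noteq> 0\<^sub>v n" "A *\<^sub>v v = e \<cdot>\<^sub>v v"
    using A unfolding eigenvalue_def eigenvector_def by auto
  then have "n \<noteq> 0" by auto
  then obtain k where n: "n = 1 + k" by (metis Suc_eq_plus1_left not0_implies_Suc)
  from unit_vector_completion[OF v(1,2)] obtain W c where W: "W \<in> carrier_mat n n"
    and WW: "mat_adjoint W * W = 1\<^sub>m n" and W0: "col W 0 = c \<cdot>\<^sub>v v" by blast
  let ?W' = "mat_adjoint W"
  have W': "?W' \<in> carrier_mat n n" using W by simp
  have WW': "W * ?W' = 1\<^sub>m n" using mat_mult_left_right_inverse[OF W' W WW] .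
  define A' where "A' = ?W' * A * W"
  have A': "A' \<in> carrier_mat n n" using A W by (auto simp: A'_def)
  have "col A' 0 = ?W' *\<^sub>v (A *\<^sub>v col W 0)"
    unfolding A'_def using A W W' n by (subst assoc_mult_mat[OF W' A W]) (auto simp: col_mult2)
  also have "A *\<^sub>v col W 0 = e \<cdot>\<^sub>v col W 0"
    unfolding W0 using A v by (simp add: mult_mat_vec smult_smult_assoc mult.commute)
  also have "?W' *\<^sub>v (e \<cdot>\<^sub>v col W 0) = e \<cdot>\<^sub>v (?W' *\<^sub>v col W 0)"
    using W' W by (intro mult_mat_vec) auto
  also have "?W' *\<^sub>v col W 0 = col (?W' * W) 0" using W W' n by (auto simp: col_mult2)
  finally have col0: "A' $$ (i, 0) = (if i = 0 then e else 0)" if "i < n" for i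
    using that A' n unfolding WW by (metis (no_types, lifting) carrier_matD(1,2) col_dim carrier_vecD index_col index_one_mat(1) index_one_mat(3) index_smult_vec(1) mult.right_neutral mult_zero_right zero_less_Suc plus_1_eq_Suc index_one_mat(2))
  obtain A1 A2 A0 A3 where split: "split_block A' 1 1 = (A1, A2, A0, A3)" by (cases "split_block A' 1 1") auto
  have "dim_row A' = 1 + k" "dim_col A' = 1 + k" using A' n by auto
  note sb = split_block[OF split this]
  have A1: "A1 = mat 1 1 (\<lambda>_. e)"
    using split col0[of 0] A' n by (auto simp: split_block_def Let_def)
  have A0: "A0 = 0\<^sub>m k 1"
    using split col0 A' n by (auto simp: split_block_def Let_def)
  have sim: "similar_mat A' A"
    by (rule similar_matI[of _ _ "?W'" W n]) (use A A' W W' WW WW' in \<open>auto simp: A'_def\<close>)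
  have "char_poly A' = char_poly A1 * char_poly A3"
    unfolding sb(5) A0 by (rule char_poly_four_block_zeros_col) (use sb in auto)
  moreover have "char_poly A1 = [:- e, 1:]" by (simp add: A1 char_poly_defs det_def sign_def)
  ultimately have "[:- e, 1:] * char_poly A3 = [:- e, 1:] * (\<Prod>e\<leftarrow>es. [:- e, 1:])"
    using char_poly_similar[OF sim] cp by simp
  then have cp3: "char_poly A3 = (\<Prod>e\<leftarrow>es. [:- e, 1:])"
    by (metis mult_cancel_left pCons_eq_0_iff zero_neq_one)
  from Cons.IH[OF sb(4) cp3] obtain P where P: "P \<in> carrier_mat k k" and PP: "mat_adjoint P * P = 1\<^sub>m k"
    and ut: "upper_triangular (mat_adjoint P * A3 * P)" and dg: "diag_mat (mat_adjoint P * A3 * P) = es" by blast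
  let ?Z = "four_block_mat (1\<^sub>m 1) (0\<^sub>m 1 k) (0\<^sub>m k 1) P"
  let ?Z' = "four_block_mat (1\<^sub>m 1) (0\<^sub>m 1 k) (0\<^sub>m k 1) (mat_adjoint P)"
  have Z: "?Z \<in> carrier_mat n n" and Z': "?Z' \<in> carrier_mat n n" using P n by auto
  have adZ: "mat_adjoint ?Z = ?Z'" by (rule mat_adjoint_four_block_one[OF P])
  let ?U = "W * ?Z"
  have U: "?U \<in> carrier_mat n n" using W Z by auto
  have adU: "mat_adjoint ?U = ?Z' * ?W'" using mat_adjoint_mult[OF W Z] adZ by simp
  have ZZ: "?Z' * ?Z = 1\<^sub>m n"
    using P PP n by (subst mult_four_block_mat[of _ 1 1 _ k _ k _ _ 1 _ k]) auto
  have "mat_adjoint ?U * ?U = ?Z' * (?W' * ?U)"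
    unfolding adU by (rule assoc_mult_mat[OF Z' W' U])
  also have "?W' * ?U = ?W' * W * ?Z" by (rule assoc_mult_mat[OF W' W Z, symmetric])
  finally have UU: "mat_adjoint ?U * ?U = 1\<^sub>m n" unfolding WW left_mult_one_mat[OF Z] ZZ .
  have W'A: "?W' * A \<in> carrier_mat n n" using W' A by auto
  have "mat_adjoint ?U * A * ?U = ?Z' * (?W' * A) * ?U"
    unfolding adU by (simp only: assoc_mult_mat[OF Z' W' A])
  also have "\<dots> = ?Z' * (?W' * A * ?U)" by (rule assoc_mult_mat[OF Z' W'A U])
  also have "?W' * A * ?U = A' * ?Z"
    unfolding A'_def by (rule assoc_mult_mat[OF W'A W Z, symmetric])
  also have "?Z' * (A' * ?Z) = ?Z' * A' * ?Z" by (rule assoc_mult_mat[OF Z' A' Z, symmetric])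
  also have "\<dots> = four_block_mat A1 (A2 * P) A0 (mat_adjoint P * A3 * P)"
  proof -
    have "?Z' * A' = four_block_mat A1 A2 (mat_adjoint P * A0) (mat_adjoint P * A3)"
      unfolding sb(5) using sb P by (subst mult_four_block_mat[of _ 1 1 _ k _ k _ _ 1 _ k]) auto
    moreover have "mat_adjoint P * A0 = A0" unfolding A0 using P by simp
    ultimately show ?thesis
      using sb P A0 by (simp, subst mult_four_block_mat[of _ 1 1 _ k _ k _ _ 1 _ k]) auto
  qed
  finally have T: "mat_adjoint ?U * A * ?U = four_block_mat A1 (A2 * P) A0 (mat_adjoint P * A3 * P)" .
  have B: "mat_adjoint P * A3 * P \<in> carrier_mat k k" using P sb by auto
  have "upper_triangular (mat_adjoint ?U * A * ?U)"
    unfolding T A0 by (rule upper_triangular_four_block[OF _ B _ ut]) (auto simp: A1)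
  moreover have "diag_mat (mat_adjoint ?U * A * ?U) = e # es"
    unfolding T diag_four_block_mat[OF sb(1) B] dg by (simp add: A1 diag_mat_def)
  ultimately show ?case using U UU by blast
qed

lemma unitary_conj_mult:
  fixes A B U W W' V :: "complex mat"
  assumes W: "W \<in> carrier_mat r r" and A: "A \<in> carrier_mat r k" and U: "U \<in> carrier_mat k k"
    and W': "W' \<in> carrier_mat k k" and B: "B \<in> carrier_mat k c" and V: "V \<in> carrier_mat c c"
    and UW: "U * W' = 1\<^sub>m k"
  shows "(W * A * U) * (W' * B * V) = W * (A * B) * V"
proof -
  have WA: "W * A \<in> carrier_mat r k" and BV: "B * V \<in> carrier_mat k c" and AB: "A * B \<in> carrier_mat r c"
    and WBV: "W' * B * V \<in> carrier_mat k c"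
    using A B U W W' V by auto
  have "U * (W' * B * V) = U * (W' * (B * V))" by (simp only: assoc_mult_mat[OF W' B V])
  also have "\<dots> = U * W' * (B * V)" by (rule assoc_mult_mat[OF U W' BV, symmetric])
  also have "\<dots> = B * V" unfolding UW by (rule left_mult_one_mat[OF BV])
  finally have "(W * A * U) * (W' * B * V) = W * A * (B * V)"
    by (simp only: assoc_mult_mat[OF WA U WBV])
  also have "\<dots> = W * (A * (B * V))" by (rule assoc_mult_mat[OF W A BV])
  also have "\<dots> = W * (A * B * V)" by (simp only: assoc_mult_mat[OF A B V])
  also have "\<dots> = W * (A * B) * V" by (rule assoc_mult_mat[OF W AB V, symmetric])
  finally show ?thesis .
qed

text \<open>By normality, row \<open>i\<close> and column \<open>i\<close> have equal Euclidean
  length. Column \<open>i\<close> consists of its diagonal entry alone: below it by triangularity,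
  above it by the induction hypothesis for earlier rows. So nothing is left for the rest of row
  \<open>i\<close>.\<close>

lemma normal_upper_triangular_diagonal:
  fixes T :: "complex mat"
  assumes T: "T \<in> carrier_mat n n" and normal: "normal_mat T" and ut: "upper_triangular T"
  shows "i < n \<Longrightarrow> j < n \<Longrightarrow> i \<noteq> j \<Longrightarrow> T $$ (i, j) = 0"
proof (induction i arbitrary: j rule: less_induct)
  case (less i)
  have low: "T $$ (r, s) = 0" if "s < r" "r < n" for r s
    using ut that T unfolding upper_triangular_def by auto
  have "(\<Sum>l<n. (cmod (T $$ (i, l)))\<^sup>2) = (\<Sum>l<n. (cmod (T $$ (l, i)))\<^sup>2)"
  proof -
    have "complex_of_real (\<Sum>l<n. (cmod (T $$ (i, l)))\<^sup>2) = (T * mat_adjoint T) $$ (i, i)"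
      unfolding of_real_sum complex_norm_square using T less.prems
      by (subst index_mult_mat_sum[where k = n]) (auto intro!: sum.cong)
    also have "\<dots> = (mat_adjoint T * T) $$ (i, i)" using normal by (simp add: normal_mat_def)
    also have "\<dots> = complex_of_real (\<Sum>l<n. (cmod (T $$ (l, i)))\<^sup>2)"
      unfolding of_real_sum complex_norm_square using T less.prems
      by (subst index_mult_mat_sum[where k = n]) (auto intro!: sum.cong)
    finally show ?thesis by (simp only: of_real_eq_iff)
  qed
  also have "\<dots> = (\<Sum>l<n. if l = i then (cmod (T $$ (i, i)))\<^sup>2 else 0)"
  proof (rule sum.cong)
    fix l assume "l \<in> {..<n}"
    then show "(cmod (T $$ (l, i)))\<^sup>2 = (if l = i then (cmod (T $$ (i, i)))\<^sup>2 else 0)"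
      using low[of i l] less.IH[of l i] less.prems by (cases l i rule: linorder_cases) auto
  qed simp
  also have "\<dots> = (cmod (T $$ (i, i)))\<^sup>2" using less.prems by simp
  finally have "(\<Sum>l\<in>{..<n} - {i}. (cmod (T $$ (i, l)))\<^sup>2) = 0"
    using less.prems by (subst (asm) sum.remove[of _ i]) auto
  then have "\<forall>l\<in>{..<n} - {i}. (cmod (T $$ (i, l)))\<^sup>2 = 0"
    by (subst (asm) sum_nonneg_eq_0_iff) auto
  then show ?case using less.prems by auto
qed

lemma unitary_diagonalization:
  fixes A :: "complex mat"
  assumes A: "A \<in> carrier_mat n n" and normal: "normal_mat A" and cp: "char_poly A = (\<Prod>e\<leftarrow>es. [:- e, 1:])"
  shows "\<exists>U. U \<in> carrier_mat n n \<and> mat_adjoint U * U = 1\<^sub>m n \<and> length es = n \<and>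
    mat_adjoint U * A * U = mat n n (\<lambda>(i, j). if i = j then es ! i else 0)"
proof -
  from unitary_schur[OF A cp] obtain U where U: "U \<in> carrier_mat n n" and UU: "mat_adjoint U * U = 1\<^sub>m n"
    and ut: "upper_triangular (mat_adjoint U * A * U)" and dg: "diag_mat (mat_adjoint U * A * U) = es" by blast
  let ?W = "mat_adjoint U"
  have W: "?W \<in> carrier_mat n n" and A': "mat_adjoint A \<in> carrier_mat n n" using U A by auto
  have UW: "U * ?W = 1\<^sub>m n" using mat_mult_left_right_inverse[OF W U UU] .
  define T where "T = ?W * A * U"
  have T: "T \<in> carrier_mat n n" using U A by (auto simp: T_def)
  have WA: "?W * A \<in> carrier_mat n n" using W A by auto
  have adT: "mat_adjoint T = ?W * mat_adjoint A * U"
    unfolding T_def mat_adjoint_mult[OF WA U] mat_adjoint_mult[OF W A] mat_adjoint_adjoint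
    by (rule assoc_mult_mat[OF W A' U, symmetric])
  have "normal_mat T"
    using normal unfolding normal_mat_def adT
    unfolding T_def unitary_conj_mult[OF W A U W A' U UW] unitary_conj_mult[OF W A' U W A U UW] by simp
  then have od: "i < n \<Longrightarrow> j < n \<Longrightarrow> i \<noteq> j \<Longrightarrow> T $$ (i, j) = 0" for i j
    using normal_upper_triangular_diagonal[OF T _ ut[folded T_def]] by blast
  have len: "length es = n" using T unfolding dg[folded T_def, symmetric] by (simp add: diag_mat_def)
  have "es ! i = T $$ (i, i)" if "i < n" for i
    using that T unfolding dg[folded T_def, symmetric] by (simp add: diag_mat_def)
  then have "T = mat n n (\<lambda>(i, j). if i = j then es ! i else 0)"
    using T od by (intro eq_matI) auto
  then show ?thesis
    by (intro exI[of _ U] conjI U UU len) (simp only: T_def)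
qed

section \<open>Singular values from the Gram matrix\<close>

lemma proots_prod_list_linear: "proots (\<Prod>e\<leftarrow>es. [:- e, 1:]) = mset (es :: 'a :: idom list)"
proof (induction es)
  case (Cons e es)
  have "(\<Prod>e\<leftarrow>es. [:- e, 1:]) \<noteq> 0" by (auto simp: prod_list_zero_iff)
  then show ?case using Cons by (simp add: proots_mult del: mult_pCons_left)
qed simp

text \<open>The diagonalized Gram matrix has the squared column lengths of \<open>M * U\<close> on
  its diagonal. All roots are thus real and nonnegative, and squaring \<open>sqrt (Re z)\<close>
  recovers the root \<open>z\<close>.\<close>

lemma gram_char_poly:
  fixes M :: "complex mat"
  assumes M: "M \<in> carrier_mat m n"
  shows "char_poly (mat_adjoint M * M) = (\<Prod>e\<leftarrow>map (\<lambda>s. complex_of_real (s\<^sup>2)) (sing_vals M). [:- e, 1:])"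
    and "\<And>s. s \<in> set (sing_vals M) \<Longrightarrow> 0 \<le> s"
proof -
  let ?H = "mat_adjoint M * M"
  have M': "mat_adjoint M \<in> carrier_mat n m" and H: "?H \<in> carrier_mat n n" using M by auto
  have adH: "mat_adjoint ?H = ?H" using mat_adjoint_mult[OF M' M] by simp
  have nH: "normal_mat ?H" unfolding normal_mat_def adH ..
  from char_poly_factorized[OF H] obtain es where es: "char_poly ?H = (\<Prod>e\<leftarrow>es. [:- e, 1:])" by blast
  from unitary_diagonalization[OF H nH es] obtain U where U: "U \<in> carrier_mat n n" and len: "length es = n"
    and D: "mat_adjoint U * ?H * U = mat n n (\<lambda>(i, j). if i = j then es ! i else 0)" by blast
  have real: "\<exists>r\<ge>0. e = complex_of_real r" if "e \<in> set es" for e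
  proof -
    from that len obtain i where i: "i < n" "e = es ! i" by (auto simp: in_set_conv_nth)
    have MU: "M * U \<in> carrier_mat m n" using M U by auto
    have U': "mat_adjoint U \<in> carrier_mat n n" using U by auto
    have "mat_adjoint (M * U) * (M * U) = mat_adjoint U * mat_adjoint M * (M * U)"
      unfolding mat_adjoint_mult[OF M U] ..
    also have "\<dots> = mat_adjoint U * (mat_adjoint M * (M * U))" by (rule assoc_mult_mat[OF U' M' MU])
    also have "mat_adjoint M * (M * U) = ?H * U" by (rule assoc_mult_mat[OF M' M U, symmetric])
    also have "mat_adjoint U * (?H * U) = mat_adjoint U * ?H * U" by (rule assoc_mult_mat[OF U' H U, symmetric])
    finally have eq: "mat_adjoint (M * U) * (M * U) = mat n n (\<lambda>(i, j). if i = j then es ! i else 0)" using D by simp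
    have "e = (mat_adjoint (M * U) * (M * U)) $$ (i, i)" unfolding eq using i by simp
    also have "\<dots> = complex_of_real (\<Sum>l<m. (cmod ((M * U) $$ (l, i)))\<^sup>2)"
      unfolding of_real_sum complex_norm_square using M U MU i(1)
      by (subst index_mult_mat_sum[where k = m]) (auto intro!: sum.cong)
    finally show ?thesis by (intro exI[of _ "\<Sum>l<m. (cmod ((M * U) $$ (l, i)))\<^sup>2"]) (auto intro: sum_nonneg)
  qed
  have ms: "mset (sing_vals M) = image_mset (\<lambda>z. sqrt (Re z)) (mset es)"
    unfolding sing_vals_def es proots_prod_list_linear by simp
  have "mset (map (\<lambda>s. complex_of_real (s\<^sup>2)) (sing_vals M)) = image_mset (\<lambda>z. complex_of_real ((sqrt (Re z))\<^sup>2)) (mset es)"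
    unfolding mset_map ms by (simp add: multiset.map_comp o_def)
  also have "\<dots> = image_mset (\<lambda>z. z) (mset es)" proof (rule image_mset_cong)
    fix z assume "z \<in># mset es"
    then obtain r where "0 \<le> r" "z = complex_of_real r" using real by auto
    then show "complex_of_real ((sqrt (Re z))\<^sup>2) = z" by (simp del: of_real_power)
  qed
  finally have "mset (map (\<lambda>s. complex_of_real (s\<^sup>2)) (sing_vals M)) = mset es" by simp
  then have "mset (map (\<lambda>e. [:- e, 1:]) (map (\<lambda>s. complex_of_real (s\<^sup>2)) (sing_vals M))) = mset (map (\<lambda>e. [:- e, 1:]) es)"
    by (metis mset_map)
  then show "char_poly ?H = (\<Prod>e\<leftarrow>map (\<lambda>s. complex_of_real (s\<^sup>2)) (sing_vals M). [:- e, 1:])"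
    unfolding es by (metis prod_mset_prod_list)
  show "0 \<le> s" if s: "s \<in> set (sing_vals M)" for s
  proof -
    have "set (sing_vals M) = (\<lambda>z. sqrt (Re z)) ` set es" using arg_cong[OF ms, of set_mset] by simp
    then obtain z where z: "z \<in> set es" "s = sqrt (Re z)" using s by auto
    from real[OF z(1)] show ?thesis unfolding z(2) by auto
  qed
qed

text \<open>The left singular vectors are left unnormalized, as columns of \<open>M * V\<close>;
  vanishing singular values then need no special treatment.\<close>

lemma svd:
  fixes M :: "complex mat"
  assumes M: "M \<in> carrier_mat m n"
  shows "\<exists>V. V \<in> carrier_mat n n \<and> mat_adjoint V * V = 1\<^sub>m n \<and> V * mat_adjoint V = 1\<^sub>m n \<and>
    mat_adjoint (M * V) * (M * V) = mat n n (\<lambda>(i, j). if i = j then complex_of_real ((sigma (i + 1) M)\<^sup>2) else 0)"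
proof -
  let ?H = "mat_adjoint M * M"
  have M': "mat_adjoint M \<in> carrier_mat n m" and H: "?H \<in> carrier_mat n n" using M by auto
  have nH: "normal_mat ?H" unfolding normal_mat_def using mat_adjoint_mult[OF M' M] by simp
  from unitary_diagonalization[OF H nH gram_char_poly(1)[OF M]] obtain V where V: "V \<in> carrier_mat n n"
    and VV: "mat_adjoint V * V = 1\<^sub>m n" and len: "length (sing_vals M) = n"
    and D: "mat_adjoint V * ?H * V = mat n n (\<lambda>(i, j). if i = j then map (\<lambda>s. complex_of_real (s\<^sup>2)) (sing_vals M) ! i else 0)"
    by (auto simp del: of_real_power)
  have V': "mat_adjoint V \<in> carrier_mat n n" and MV: "M * V \<in> carrier_mat m n" using V M by auto
  have "mat_adjoint (M * V) * (M * V) = mat_adjoint V * mat_adjoint M * (M * V)"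
    unfolding mat_adjoint_mult[OF M V] ..
  also have "\<dots> = mat_adjoint V * (mat_adjoint M * (M * V))" by (rule assoc_mult_mat[OF V' M' MV])
  also have "mat_adjoint M * (M * V) = ?H * V" by (rule assoc_mult_mat[OF M' M V, symmetric])
  also have "mat_adjoint V * (?H * V) = mat_adjoint V * ?H * V" by (rule assoc_mult_mat[OF V' H V, symmetric])
  also have "\<dots> = mat n n (\<lambda>(i, j). if i = j then complex_of_real ((sigma (i + 1) M)\<^sup>2) else 0)"
    unfolding D using len by (intro eq_matI) (auto simp: sigma_def)
  finally show "\<exists>V. V \<in> carrier_mat n n \<and> mat_adjoint V * V = 1\<^sub>m n \<and> V * mat_adjoint V = 1\<^sub>m n \<and>
    mat_adjoint (M * V) * (M * V) = mat n n (\<lambda>(i, j). if i = j then complex_of_real ((sigma (i + 1) M)\<^sup>2) else 0)"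
    using V VV mat_mult_left_right_inverse[OF V' V VV] by blast
qed

lemma sigma_nonneg:
  assumes "M \<in> carrier_mat m n"
  shows "0 \<le> sigma j M"
  unfolding sigma_def using gram_char_poly(2)[OF assms] by auto

lemma sigma_antimono:
  assumes M: "M \<in> carrier_mat m n" and "1 \<le> i" "i \<le> j"
  shows "sigma j M \<le> sigma i M"
proof (cases "j \<le> length (sing_vals M)")
  case True
  have "sorted (rev (sing_vals M))" by (simp add: sing_vals_def)
  then have "sorted_wrt (\<ge>) (sing_vals M)" by (simp add: sorted_wrt_rev)
  then have "sing_vals M ! (j - 1) \<le> sing_vals M ! (i - 1)"
    using assms True by (cases "i = j") (auto simp: sorted_wrt_iff_nth_less)
  then show ?thesis using assms True by (simp add: sigma_def)
qed (use sigma_nonneg[OF M, of i] in \<open>simp add: sigma_def\<close>)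

subsection \<open>Operator bounds and the Sylvester equation\<close>

definition vnorm :: "nat \<Rightarrow> (nat \<Rightarrow> complex) \<Rightarrow> real" where
  "vnorm n w = L2_set (\<lambda>q. cmod (w q)) {..<n}"

definition mapply :: "nat \<Rightarrow> (nat \<Rightarrow> nat \<Rightarrow> complex) \<Rightarrow> (nat \<Rightarrow> complex) \<Rightarrow> nat \<Rightarrow> complex" where
  "mapply n x w p = (\<Sum>q<n. x p q * w q)"

text \<open>Says that the operator norm is at most \<open>c\<close>. Nonnegativity is demanded
  separately because for \<open>n = 0\<close> the inequality holds for every
  \<open>c\<close>.\<close>

definition op_bound :: "nat \<Rightarrow> nat \<Rightarrow> (nat \<Rightarrow> nat \<Rightarrow> complex) \<Rightarrow> real \<Rightarrow> bool" where
  "op_bound m n x c \<longleftrightarrow> 0 \<le> c \<and> (\<forall>w. vnorm m (mapply n x w) \<le> c * vnorm n w)"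

lemma vnorm_nonneg [simp]: "0 \<le> vnorm n w"
  by (simp add: vnorm_def)

lemma vnorm_power2: "(vnorm n w)\<^sup>2 = (\<Sum>q<n. (cmod (w q))\<^sup>2)"
  by (simp add: vnorm_def L2_set_def sum_nonneg)

lemma vnorm_cong: "(\<And>q. q < n \<Longrightarrow> v q = w q) \<Longrightarrow> vnorm n v = vnorm n w"
  unfolding vnorm_def by (intro L2_set_cong) auto

lemma vnorm_add_le: "vnorm n (\<lambda>q. v q + w q) \<le> vnorm n v + vnorm n w"
proof -
  have "vnorm n (\<lambda>q. v q + w q) \<le> L2_set (\<lambda>q. cmod (v q) + cmod (w q)) {..<n}"
    unfolding vnorm_def by (intro L2_set_mono norm_triangle_ineq) auto
  also have "\<dots> \<le> vnorm n v + vnorm n w"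
    unfolding vnorm_def by (rule L2_set_triangle_ineq)
  finally show ?thesis .
qed

lemma vnorm_mult_le:
  assumes "\<And>q. q < n \<Longrightarrow> cmod (\<alpha> q) \<le> s" "0 \<le> s"
  shows "vnorm n (\<lambda>q. \<alpha> q * w q) \<le> s * vnorm n w"
proof -
  have "vnorm n (\<lambda>q. \<alpha> q * w q) \<le> L2_set (\<lambda>q. s * cmod (w q)) {..<n}"
    unfolding vnorm_def using assms by (intro L2_set_mono) (auto simp: norm_mult intro: mult_right_mono)
  also have "\<dots> = s * vnorm n w"
    unfolding vnorm_def using assms(2) by (rule L2_set_right_distrib[symmetric])
  finally show ?thesis .
qed

lemma op_bound_nonneg: "op_bound m n x c \<Longrightarrow> 0 \<le> c"
  by (simp add: op_bound_def)

lemma op_boundD: "op_bound m n x c \<Longrightarrow> vnorm m (mapply n x w) \<le> c * vnorm n w"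
  by (simp add: op_bound_def)

lemma op_bound_cong:
  assumes "\<And>p q. p < m \<Longrightarrow> q < n \<Longrightarrow> x p q = y p q"
  shows "op_bound m n x c \<longleftrightarrow> op_bound m n y c"
proof -
  have "vnorm m (mapply n x w) = vnorm m (mapply n y w)" for w
    using assms by (intro vnorm_cong) (simp add: mapply_def)
  then show ?thesis by (simp add: op_bound_def)
qed

lemma op_bound_add:
  assumes "op_bound m n x c" "op_bound m n y d"
  shows "op_bound m n (\<lambda>p q. x p q + y p q) (c + d)"
  unfolding op_bound_def
proof (intro conjI allI)
  fix w
  have "mapply n (\<lambda>p q. x p q + y p q) w = (\<lambda>p. mapply n x w p + mapply n y w p)"
    by (auto simp: mapply_def sum.distrib algebra_simps)
  then have "vnorm m (mapply n (\<lambda>p q. x p q + y p q) w) \<le> vnorm m (mapply n x w) + vnorm m (mapply n y w)"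
    by (simp only:) (rule vnorm_add_le)
  also have "\<dots> \<le> (c + d) * vnorm n w"
    using op_boundD[OF assms(1), of w] op_boundD[OF assms(2), of w] by (simp add: algebra_simps)
  finally show "vnorm m (mapply n (\<lambda>p q. x p q + y p q) w) \<le> (c + d) * vnorm n w" .
qed (use assms op_bound_nonneg in \<open>fastforce\<close>)

lemma op_bound_sum:
  assumes "finite J" "\<And>j. j \<in> J \<Longrightarrow> op_bound m n (x j) (c j)"
  shows "op_bound m n (\<lambda>p q. \<Sum>j\<in>J. x j p q) (\<Sum>j\<in>J. c j)"
  using assms
proof (induction J)
  case empty
  then show ?case by (simp add: op_bound_def mapply_def vnorm_def L2_set_def)
next
  case (insert j J)
  then show ?case using op_bound_add[of m n "x j" "c j"] by simp
qed

lemma op_bound_scale: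
  assumes x: "op_bound m n x c"
    and \<alpha>: "\<And>p. p < m \<Longrightarrow> cmod (\<alpha> p) \<le> s" "0 \<le> s" and \<beta>: "\<And>q. q < n \<Longrightarrow> cmod (\<beta> q) \<le> t" "0 \<le> t"
  shows "op_bound m n (\<lambda>p q. \<alpha> p * x p q * \<beta> q) (s * c * t)"
  unfolding op_bound_def
proof (intro conjI allI)
  have c: "0 \<le> c" by (rule op_bound_nonneg[OF x])
  then show "0 \<le> s * c * t" using \<alpha> \<beta> by simp
  fix w
  have "mapply n (\<lambda>p q. \<alpha> p * x p q * \<beta> q) w = (\<lambda>p. \<alpha> p * mapply n x (\<lambda>q. \<beta> q * w q) p)"
    by (auto simp: mapply_def sum_distrib_left algebra_simps)
  then have "vnorm m (mapply n (\<lambda>p q. \<alpha> p * x p q * \<beta> q) w) \<le> s * vnorm m (mapply n x (\<lambda>q. \<beta> q * w q))"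
    by (simp only:) (rule vnorm_mult_le[OF \<alpha>])
  also have "\<dots> \<le> s * (c * (t * vnorm n w))"
    using c \<alpha>(2) by (intro mult_left_mono order_trans[OF op_boundD[OF x] mult_left_mono] vnorm_mult_le \<beta>) auto
  finally show "vnorm m (mapply n (\<lambda>p q. \<alpha> p * x p q * \<beta> q) w) \<le> s * c * t * vnorm n w" by (simp add: mult_ac)
qed

text \<open>The sum of the moduli of all entries is a crude bound, but any finite bound can start
  the iteration for the Sylvester equation.\<close>

lemma op_bound_exists: "\<exists>c. op_bound m n x c"
proof -
  define e where "e j = (\<lambda>p q. if q = snd j \<and> p = fst j then x p q else 0)" for j
  have "op_bound m n (e j) (cmod (x (fst j) (snd j)))" if j: "j \<in> {..<m} \<times> {..<n}" for j
    unfolding op_bound_def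
  proof (intro conjI allI)
    fix w
    have "mapply n (e j) w p = (if p = fst j then x p (snd j) * w (snd j) else 0)" for p
      using j by (auto simp: mapply_def e_def if_distrib[of "\<lambda>z. z * _"] cong: if_cong)
    then have "(vnorm m (mapply n (e j) w))\<^sup>2 = (\<Sum>p<m. if p = fst j then (cmod (x p (snd j) * w (snd j)))\<^sup>2 else 0)"
      unfolding vnorm_power2 by (intro sum.cong) auto
    also have "\<dots> = (cmod (x (fst j) (snd j)))\<^sup>2 * (cmod (w (snd j)))\<^sup>2" using j by (auto simp: norm_mult power_mult_distrib)
    also have "(cmod (w (snd j)))\<^sup>2 \<le> (vnorm n w)\<^sup>2"
      unfolding vnorm_power2 using j by (intro member_le_sum) auto
    finally have "(vnorm m (mapply n (e j) w))\<^sup>2 \<le> (cmod (x (fst j) (snd j)) * vnorm n w)\<^sup>2"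
      by (simp add: power_mult_distrib mult_left_mono)
    then show "vnorm m (mapply n (e j) w) \<le> cmod (x (fst j) (snd j)) * vnorm n w"
      by (rule power2_le_imp_le) simp
  qed simp
  then have "op_bound m n (\<lambda>p q. \<Sum>j\<in>{..<m} \<times> {..<n}. e j p q) (\<Sum>j\<in>{..<m} \<times> {..<n}. cmod (x (fst j) (snd j)))"
    by (intro op_bound_sum) auto
  moreover have "(\<Sum>j\<in>{..<m} \<times> {..<n}. e j p q) = x p q" if "p < m" "q < n" for p q
  proof -
    have "(\<Sum>j\<in>{..<m} \<times> {..<n}. e j p q) = (\<Sum>j\<in>{..<m} \<times> {..<n}. if j = (p, q) then x p q else 0)"
      by (intro sum.cong) (auto simp: e_def)
    also have "\<dots> = x p q" using that by (subst sum.delta) auto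
    finally show ?thesis .
  qed
  ultimately have "op_bound m n x (\<Sum>j\<in>{..<m} \<times> {..<n}. cmod (x (fst j) (snd j)))"
    by (subst op_bound_cong[of m n x "\<lambda>p q. \<Sum>j\<in>{..<m} \<times> {..<n}. e j p q"]) auto
  then show ?thesis ..
qed

section \<open>Cayley factors, contraction and rational functions\<close>

lemma cayley_bound:
  fixes y a b :: real
  assumes "0 < a" "a \<le> y" "y \<le> b"
  shows "\<bar>(y - b) / (y + b)\<bar> \<le> (b - a) / (b + a)"
  using assms by (simp add: field_simps)

text \<open>The common source of two arguments: with the fixed shift \<open>b\<close> it gives the
  contraction for the norm bound, and with the shifts \<open>s i\<close> it gives each step of the
  telescoping sum.\<close>

lemma cayley_product:
  fixes y z b :: real
  assumes "y + b \<noteq> 0" "z + b \<noteq> 0"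
  shows "(y - b) / (y + b) * ((z - b) / (z + b)) + 2 * b * (y + z) / ((y + b) * (z + b)) = 1"
proof -
  have "(y - b) / (y + b) * ((z - b) / (z + b)) + 2 * b * (y + z) / ((y + b) * (z + b))
    = ((y - b) * (z - b) + 2 * b * (y + z)) / ((y + b) * (z + b))"
    by (simp add: add_divide_distrib)
  also have "(y - b) * (z - b) + 2 * b * (y + z) = (y + b) * (z + b)" by (simp add: algebra_simps)
  finally show ?thesis using assms by simp
qed

text \<open>The Cayley transform with shift \<open>b\<close> rewrites the equation as \<open>x = C x C' + d f d'\<close> with a
  contraction \<open>C\<close>; the resulting recursion for bounds of \<open>x\<close> has exactly \<open>c / (2 * a)\<close> as its fixed point.\<close>

lemma sylvester_op_bound:
  fixes \<alpha> \<beta> :: "nat \<Rightarrow> real" and a b c :: real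
  assumes ab: "0 < a" "a < b"
    and \<alpha>: "\<And>p. p < m \<Longrightarrow> \<alpha> p \<in> {a..b}" and \<beta>: "\<And>q. q < n \<Longrightarrow> \<beta> q \<in> {a..b}"
    and f: "op_bound m n f c"
    and eq: "\<And>p q. p < m \<Longrightarrow> q < n \<Longrightarrow> f p q = - complex_of_real (\<alpha> p + \<beta> q) * x p q"
  shows "op_bound m n x (c / (2 * a))"
proof -
  define g where "g = (b - a) / (b + a)"
  define C where "C y = complex_of_real ((y - b) / (y + b))" for y
  define I where "I y = complex_of_real (1 / (y + b))" for y
  have c: "0 \<le> c" by (rule op_bound_nonneg[OF f])
  have g: "0 \<le> g" "g < 1" using ab by (auto simp: g_def field_simps)
  have C: "cmod (C y) \<le> g" and I: "cmod (I y) \<le> 1 / (a + b)" if "y \<in> {a..b}" for y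
    using that ab cayley_bound[of a y b] unfolding C_def I_def g_def norm_of_real by (auto simp: frac_le)
  \<comment> \<open>Both summands of the Cayley form are two-sided diagonal scalings, so bounds on
    their scalar factors carry over to operator bounds.\<close>
  have step: "op_bound m n x (g\<^sup>2 * N + 2 * b * c / (a + b)\<^sup>2)" if N: "op_bound m n x N" for N
  proof -
    have 1: "op_bound m n (\<lambda>p q. C (\<alpha> p) * x p q * C (\<beta> q)) (g * N * g)"
      using g C \<alpha> \<beta> by (intro op_bound_scale[OF N]) auto
    have 2: "op_bound m n (\<lambda>p q. (- complex_of_real (2 * b) * I (\<alpha> p)) * f p q * I (\<beta> q)) ((2 * b * (1 / (a + b))) * c * (1 / (a + b)))"
    proof (rule op_bound_scale[OF f])
      fix p assume "p < m"
      then have "cmod (I (\<alpha> p)) \<le> 1 / (a + b)" using I \<alpha> by blast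
      then have "2 * b * cmod (I (\<alpha> p)) \<le> 2 * b * (1 / (a + b))" using ab by (intro mult_left_mono) auto
      then show "cmod (- complex_of_real (2 * b) * I (\<alpha> p)) \<le> 2 * b * (1 / (a + b))"
        using ab by (simp add: norm_mult)
    qed (use I \<beta> ab in auto)
    have "C (\<alpha> p) * x p q * C (\<beta> q) + (- complex_of_real (2 * b) * I (\<alpha> p)) * f p q * I (\<beta> q) = x p q" if pq: "p < m" "q < n" for p q
    proof -
      have nz: "\<alpha> p + b \<noteq> 0" "\<beta> q + b \<noteq> 0" using \<alpha>[OF pq(1)] \<beta>[OF pq(2)] ab by auto
      have "(\<alpha> p - b) / (\<alpha> p + b) * ((\<beta> q - b) / (\<beta> q + b)) + 2 * b * (1 / (\<alpha> p + b)) * (\<alpha> p + \<beta> q) * (1 / (\<beta> q + b)) = 1"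
        using cayley_product[OF nz] by simp
      then have "C (\<alpha> p) * C (\<beta> q) + complex_of_real (2 * b) * I (\<alpha> p) * complex_of_real (\<alpha> p + \<beta> q) * I (\<beta> q) = 1"
        unfolding C_def I_def of_real_mult[symmetric] of_real_add[symmetric] by simp
      moreover have "e * z * e' + - t * i * (- r * z) * i' = z * (e * e' + t * i * r * i')" for e e' t i i' r z :: complex
        by (simp add: algebra_simps)
      ultimately show ?thesis unfolding eq[OF pq] by (simp only: mult_1_right)
    qed
    then have "op_bound m n x (g * N * g + (2 * b * (1 / (a + b))) * c * (1 / (a + b)))"
      using op_bound_add[OF 1 2] by (subst op_bound_cong[OF sym]) auto
    then show ?thesis by (simp add: power2_eq_square mult_ac)
  qed
  define D where "D = c / (2 * a)"
  \<comment> \<open>That \<open>D\<close> is a fixed point amounts to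
    \<open>(b - a)\<^sup>2 + 4 * a * b = (a + b)\<^sup>2\<close>; the deviation \<open>e\<close>
    from it shrinks by \<open>g\<^sup>2\<close> in each step.\<close>
  have fix_eq: "g\<^sup>2 * (D + e) + 2 * b * c / (a + b)\<^sup>2 = D + g\<^sup>2 * e" for e
  proof -
    have "g\<^sup>2 * D + 2 * b * c / (a + b)\<^sup>2 = D"
    proof -
      have "2 * b * c = 4 * a * b * D" using ab by (simp add: D_def)
      then have "g\<^sup>2 * D + 2 * b * c / (a + b)\<^sup>2 = ((b - a)\<^sup>2 * D + 4 * a * b * D) / (a + b)\<^sup>2"
        by (simp add: g_def power_divide add_divide_distrib add.commute)
      also have "(b - a)\<^sup>2 * D + 4 * a * b * D = (a + b)\<^sup>2 * D"
        by (simp add: power2_eq_square algebra_simps)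
      finally show ?thesis using ab by simp
    qed
    then show ?thesis by (simp add: algebra_simps)
  qed
  obtain N where N: "op_bound m n x N" using op_bound_exists by blast
  have it: "op_bound m n x (D + (g\<^sup>2) ^ k * (N - D))" for k
  proof (induction k)
    case (Suc k)
    from step[OF Suc] show ?case unfolding fix_eq by (simp add: mult_ac)
  qed (simp add: N)
  have "(\<lambda>k. D + (g\<^sup>2) ^ k * (N - D)) \<longlonglongrightarrow> D + 0 * (N - D)"
    using g by (intro tendsto_intros LIMSEQ_realpow_zero) (auto simp: power_less_one_iff)
  then have lim: "(\<lambda>k. D + (g\<^sup>2) ^ k * (N - D)) \<longlonglongrightarrow> D" by simp
  have "vnorm m (mapply n x w) \<le> D * vnorm n w" for w
    by (rule LIMSEQ_le_const[OF tendsto_mult_right[OF lim]]) (use op_boundD[OF it] in blast)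
  then show ?thesis using c ab unfolding op_bound_def D_def by simp
qed

text \<open>Each difference of consecutive products is \<open>y + z\<close> times a function of
  \<open>y\<close> times a function of \<open>z\<close>. The factor \<open>y + z\<close> will cancel
  against the Sylvester equation, leaving a separated, hence rank one, correction.\<close>

lemma rational_telescope:
  fixes s :: "nat \<Rightarrow> real" and y z :: real
  assumes "\<And>i. 0 < s i" "0 < y" "0 < z"
  shows "1 - (\<Prod>i<k. (y - s i) / (y + s i)) * (\<Prod>i<k. (z - s i) / (z + s i))
    = (\<Sum>i<k. (2 * s i * (y + z)) * ((\<Prod>l<i. (y - s l) / (y + s l)) / (y + s i)) * ((\<Prod>l<i. (z - s l) / (z + s l)) / (z + s i)))"
proof (induction k)
  case (Suc k)
  define P Q where "P = (\<Prod>i<k. (y - s i) / (y + s i))" and "Q = (\<Prod>i<k. (z - s i) / (z + s i))"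
  have nz: "y + s k \<noteq> 0" "z + s k \<noteq> 0" using assms(2,3) assms(1)[of k] by linarith+
  have "1 - P * ((y - s k) / (y + s k)) * (Q * ((z - s k) / (z + s k)))
     = (1 - P * Q) + P * Q * (1 - (y - s k) / (y + s k) * ((z - s k) / (z + s k)))" by (simp add: algebra_simps)
  also have "1 - (y - s k) / (y + s k) * ((z - s k) / (z + s k)) = 2 * s k * (y + z) / ((y + s k) * (z + s k))"
    using cayley_product[OF nz] by simp
  also have "P * Q * (2 * s k * (y + z) / ((y + s k) * (z + s k))) = (2 * s k * (y + z)) * (P / (y + s k)) * (Q / (z + s k))"
    by simp
  finally show ?case using Suc by (simp add: P_def Q_def)
qed simp

text \<open>That the correction has rank at most \<open>k\<close> is expressed by \<open>k\<close>
  linear functionals on whose common kernel it vanishes. This is the form which the min-max argument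
  for singular values uses.\<close>

lemma rank_one_sylvester_approx:
  fixes \<alpha> \<beta> :: "nat \<Rightarrow> real" and s :: "nat \<Rightarrow> real" and u v :: "nat \<Rightarrow> complex" and k :: nat
  assumes \<alpha>: "\<And>p. p < m \<Longrightarrow> 0 < \<alpha> p" and \<beta>: "\<And>q. q < n \<Longrightarrow> 0 < \<beta> q" and s: "\<And>i. 0 < s i"
    and eq: "\<And>p q. p < m \<Longrightarrow> q < n \<Longrightarrow> u p * v q = - complex_of_real (\<alpha> p + \<beta> q) * x p q"
  defines "r \<equiv> \<lambda>y. complex_of_real (\<Prod>i<k. (y - s i) / (y + s i))"
  shows "\<exists>h :: nat \<Rightarrow> nat \<Rightarrow> complex. \<forall>w. (\<forall>i<k. (\<Sum>q<n. h i q * w q) = 0) \<longrightarrow>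
    (\<forall>p<m. mapply n x w p = mapply n (\<lambda>p q. r (\<alpha> p) * x p q * r (\<beta> q)) w p)"
proof -
  define R where "R i y = complex_of_real ((\<Prod>l<i. (y - s l) / (y + s l)) / (y + s i))" for i y
  define h where "h i q = v q * R i (\<beta> q)" for i q
  have key: "x p q - r (\<alpha> p) * x p q * r (\<beta> q) = (\<Sum>i<k. - complex_of_real (2 * s i) * R i (\<alpha> p) * u p * h i q)" if pq: "p < m" "q < n" for p q
  proof -
    have "1 - r (\<alpha> p) * r (\<beta> q) = (\<Sum>i<k. (complex_of_real (2 * s i) * complex_of_real (\<alpha> p + \<beta> q)) * R i (\<alpha> p) * R i (\<beta> q))"
      using arg_cong[OF rational_telescope[of s "\<alpha> p" "\<beta> q" k], of complex_of_real, OF s \<alpha>[OF pq(1)] \<beta>[OF pq(2)]]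
      unfolding r_def R_def by (simp only: of_real_sum of_real_mult of_real_diff of_real_1)
    then have "x p q * (1 - r (\<alpha> p) * r (\<beta> q)) = (\<Sum>i<k. x p q * ((complex_of_real (2 * s i) * complex_of_real (\<alpha> p + \<beta> q)) * R i (\<alpha> p) * R i (\<beta> q)))"
      by (simp only: sum_distrib_left)
    also have "\<dots> = (\<Sum>i<k. - complex_of_real (2 * s i) * R i (\<alpha> p) * u p * h i q)"
    proof (rule sum.cong[OF refl])
      fix i
      have ac: "- t * e * e' * (- r * z) = z * (t * r * e * e')" for t e e' r z :: complex
        by (simp add: mult_ac)
      have "- complex_of_real (2 * s i) * R i (\<alpha> p) * u p * h i q = - complex_of_real (2 * s i) * R i (\<alpha> p) * R i (\<beta> q) * (u p * v q)"
        by (simp add: h_def)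
      also have "\<dots> = x p q * ((complex_of_real (2 * s i) * complex_of_real (\<alpha> p + \<beta> q)) * R i (\<alpha> p) * R i (\<beta> q))"
        unfolding eq[OF pq] by (rule ac)
      finally show "x p q * ((complex_of_real (2 * s i) * complex_of_real (\<alpha> p + \<beta> q)) * R i (\<alpha> p) * R i (\<beta> q)) = - complex_of_real (2 * s i) * R i (\<alpha> p) * u p * h i q" by simp
    qed
    finally show ?thesis by (simp add: algebra_simps)
  qed
  show ?thesis
  proof (intro exI[of _ h] allI impI)
    fix w p assume w: "\<forall>i<k. (\<Sum>q<n. h i q * w q) = 0" and p: "p < m"
    have "mapply n x w p - mapply n (\<lambda>p q. r (\<alpha> p) * x p q * r (\<beta> q)) w p = (\<Sum>q<n. (x p q - r (\<alpha> p) * x p q * r (\<beta> q)) * w q)"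
      unfolding mapply_def sum_subtractf[symmetric] by (simp only: left_diff_distrib)
    also have "\<dots> = (\<Sum>q<n. \<Sum>i<k. (- complex_of_real (2 * s i) * R i (\<alpha> p) * u p) * (h i q * w q))"
      using key[OF p] by (intro sum.cong refl) (simp only: lessThan_iff sum_distrib_right mult.assoc)
    also have "\<dots> = (\<Sum>i<k. (- complex_of_real (2 * s i) * R i (\<alpha> p) * u p) * (\<Sum>q<n. h i q * w q))"
      unfolding sum_distrib_left by (rule sum.swap)
    also have "\<dots> = 0" using w by simp
    finally show "mapply n x w p = mapply n (\<lambda>p q. r (\<alpha> p) * x p q * r (\<beta> q)) w p" by simp
  qed
qed

subsection \<open>Singular systems\<close>

lemma norm_power2_orthogonal_sum:
  fixes U :: "nat \<Rightarrow> nat \<Rightarrow> complex" and d :: "nat \<Rightarrow> real"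
  assumes J: "finite J"
    and U: "\<And>i j. i \<in> J \<Longrightarrow> j \<in> J \<Longrightarrow> (\<Sum>p<m. cnj (U i p) * U j p) = (if i = j then complex_of_real (d i) else 0)"
  shows "(vnorm m (\<lambda>p. \<Sum>j\<in>J. c j * U j p))\<^sup>2 = (\<Sum>j\<in>J. (cmod (c j))\<^sup>2 * d j)"
proof -
  have "complex_of_real ((vnorm m (\<lambda>p. \<Sum>j\<in>J. c j * U j p))\<^sup>2) = (\<Sum>p<m. (\<Sum>j\<in>J. c j * U j p) * (\<Sum>i\<in>J. cnj (c i) * cnj (U i p)))"
    unfolding vnorm_power2 of_real_sum complex_norm_square by simp
  also have "\<dots> = (\<Sum>p<m. \<Sum>j\<in>J. \<Sum>i\<in>J. (c j * cnj (c i)) * (cnj (U i p) * U j p))"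
    unfolding sum_product by (intro sum.cong refl) (simp add: mult_ac)
  also have "\<dots> = (\<Sum>j\<in>J. \<Sum>p<m. \<Sum>i\<in>J. (c j * cnj (c i)) * (cnj (U i p) * U j p))" by (rule sum.swap)
  also have "\<dots> = (\<Sum>j\<in>J. \<Sum>i\<in>J. (c j * cnj (c i)) * (\<Sum>p<m. cnj (U i p) * U j p))"
    unfolding sum_distrib_left by (intro sum.cong refl sum.swap)
  also have "\<dots> = (\<Sum>j\<in>J. \<Sum>i\<in>J. if i = j then complex_of_real ((cmod (c j))\<^sup>2 * d j) else 0)"
  proof (intro sum.cong refl)
    fix i j assume "j \<in> J" "i \<in> J"
    then show "(c j * cnj (c i)) * (\<Sum>p<m. cnj (U i p) * U j p) = (if i = j then complex_of_real ((cmod (c j))\<^sup>2 * d j) else 0)"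
      by (simp only: U of_real_mult complex_norm_square) simp
  qed
  also have "\<dots> = complex_of_real (\<Sum>j\<in>J. (cmod (c j))\<^sup>2 * d j)"
    using J by (simp only: sum.delta of_real_sum) simp
  finally show ?thesis by (simp only: of_real_eq_iff)
qed

lemma underdetermined_kernel:
  fixes A :: "nat \<Rightarrow> nat \<Rightarrow> complex"
  shows "\<exists>c. (\<exists>j<Suc t. c j \<noteq> 0) \<and> (\<forall>i<t. (\<Sum>j<Suc t. A i j * c j) = 0)"
proof -
  \<comment> \<open>A zero row makes the system square. The transpose then kills the last unit
    vector, so the determinant vanishes and a kernel vector exists.\<close>
  define M where "M = mat (Suc t) (Suc t) (\<lambda>(i, j). if i < t then A i j else 0)"
  have M: "M \<in> carrier_mat (Suc t) (Suc t)" by (simp add: M_def)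
  have T: "transpose_mat M \<in> carrier_mat (Suc t) (Suc t)" using M by simp
  have "transpose_mat M *\<^sub>v unit_vec (Suc t) t = 0\<^sub>v (Suc t)"
    by (rule eq_vecI) (auto simp: M_def scalar_prod_def unit_vec_def if_distrib sum.If_cases intro!: sum.neutral)
  moreover have "unit_vec (Suc t) t \<noteq> (0\<^sub>v (Suc t) :: complex vec)"
    by simp
  ultimately have "det (transpose_mat M) = 0"
    unfolding det_0_iff_vec_prod_zero[OF T] by (intro exI[of _ "unit_vec (Suc t) t"]) simp
  then have "det M = 0" by (simp add: det_transpose[OF M])
  then obtain v where v: "v \<in> carrier_vec (Suc t)" "v \<noteq> 0\<^sub>v (Suc t)" "M *\<^sub>v v = 0\<^sub>v (Suc t)"
    unfolding det_0_iff_vec_prod_zero[OF M] by blast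
  have "\<exists>j<Suc t. v $ j \<noteq> 0"
  proof (rule ccontr)
    assume "\<not> (\<exists>j<Suc t. v $ j \<noteq> 0)"
    then have "v = 0\<^sub>v (Suc t)" using v(1) by (intro eq_vecI) auto
    with v(2) show False by simp
  qed
  moreover have "(\<Sum>j<Suc t. A i j * v $ j) = 0" if "i < t" for i
  proof -
    have "0 = (M *\<^sub>v v) $ i" unfolding v(3) using that by simp
    also have "\<dots> = (\<Sum>j<Suc t. A i j * v $ j)"
      using that v(1) unfolding M_def by (simp add: scalar_prod_def lessThan_atLeast0)
    finally show ?thesis by simp
  qed
  ultimately show ?thesis by blast
qed

text \<open>The family \<open>v\<close> of right singular vectors is required to be both orthonormal
  and complete; the images under \<open>x\<close> are orthogonal with lengths \<open>s\<close> and
  stay unnormalized, so zeros among the \<open>s\<close> do no harm.\<close>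

definition singular_system :: "nat \<Rightarrow> nat \<Rightarrow> (nat \<Rightarrow> nat \<Rightarrow> complex) \<Rightarrow> (nat \<Rightarrow> real) \<Rightarrow> (nat \<Rightarrow> nat \<Rightarrow> complex) \<Rightarrow> bool" where
  "singular_system m n x s v \<longleftrightarrow>
    (\<forall>i<n. \<forall>j<n. (\<Sum>q<n. cnj (v i q) * v j q) = (if i = j then 1 else 0)) \<and>
    (\<forall>q<n. \<forall>q'<n. (\<Sum>j<n. v j q * cnj (v j q')) = (if q = q' then 1 else 0)) \<and>
    (\<forall>i<n. \<forall>j<n. (\<Sum>p<m. cnj (mapply n x (v i) p) * mapply n x (v j) p) = (if i = j then complex_of_real ((s i)\<^sup>2) else 0))"

lemma singular_system_exists:
  assumes M: "M \<in> carrier_mat m n"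
  shows "\<exists>v. singular_system m n (\<lambda>p q. M $$ (p, q)) (\<lambda>i. sigma (i + 1) M) v"
proof -
  from svd[OF M] obtain V where V: "V \<in> carrier_mat n n" and V1: "mat_adjoint V * V = 1\<^sub>m n"
    and V2: "V * mat_adjoint V = 1\<^sub>m n"
    and D: "mat_adjoint (M * V) * (M * V) = mat n n (\<lambda>(i, j). if i = j then complex_of_real ((sigma (i + 1) M)\<^sup>2) else 0)"
    by blast
  define v where "v j q = V $$ (q, j)" for j q
  have V': "mat_adjoint V \<in> carrier_mat n n" and MV: "M * V \<in> carrier_mat m n" and MV': "mat_adjoint (M * V) \<in> carrier_mat n m"
    using M V by auto
  have mv: "mapply n (\<lambda>p q. M $$ (p, q)) (v j) p = (M * V) $$ (p, j)" if "p < m" "j < n" for p j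
    unfolding mapply_def v_def index_mult_mat_sum[OF M V that] ..
  show ?thesis
    unfolding singular_system_def
  proof (intro exI[of _ v] conjI allI impI)
    fix i j assume ij: "i < n" "j < n"
    have "(\<Sum>q<n. cnj (v i q) * v j q) = (mat_adjoint V * V) $$ (i, j)"
      unfolding index_mult_mat_sum[OF V' V ij] using V ij by (intro sum.cong) (auto simp: v_def)
    then show "(\<Sum>q<n. cnj (v i q) * v j q) = (if i = j then 1 else 0)" unfolding V1 using ij by simp
    have "(\<Sum>q<n. v q i * cnj (v q j)) = (V * mat_adjoint V) $$ (i, j)"
      unfolding index_mult_mat_sum[OF V V' ij] using V ij by (intro sum.cong) (auto simp: v_def)
    then show "(\<Sum>q<n. v q i * cnj (v q j)) = (if i = j then 1 else 0)" unfolding V2 using ij by simp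
    have "(\<Sum>p<m. cnj (mapply n (\<lambda>p q. M $$ (p, q)) (v i) p) * mapply n (\<lambda>p q. M $$ (p, q)) (v j) p)
      = (mat_adjoint (M * V) * (M * V)) $$ (i, j)"
      unfolding index_mult_mat_sum[OF MV' MV ij] using M V ij by (intro sum.cong) (auto simp: mv simp del: index_mult_mat(1))
    then show "(\<Sum>p<m. cnj (mapply n (\<lambda>p q. M $$ (p, q)) (v i) p) * mapply n (\<lambda>p q. M $$ (p, q)) (v j) p)
      = (if i = j then complex_of_real ((sigma (i + 1) M)\<^sup>2) else 0)" unfolding D using ij by simp
  qed
qed

context
  fixes m n :: nat and x :: "nat \<Rightarrow> nat \<Rightarrow> complex" and s :: "nat \<Rightarrow> real" and v :: "nat \<Rightarrow> nat \<Rightarrow> complex"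
  assumes sys: "singular_system m n x s v"
begin

lemma singular_system_expand:
  assumes "q < n"
  shows "w q = (\<Sum>j<n. v j q * (\<Sum>q'<n. cnj (v j q') * w q'))"
proof -
  have "(\<Sum>j<n. v j q * (\<Sum>q'<n. cnj (v j q') * w q')) = (\<Sum>j<n. \<Sum>q'<n. (v j q * cnj (v j q')) * w q')"
    unfolding sum_distrib_left by (simp add: mult_ac)
  also have "\<dots> = (\<Sum>q'<n. (\<Sum>j<n. v j q * cnj (v j q')) * w q')"
    unfolding sum_distrib_right by (rule sum.swap)
  also have "\<dots> = (\<Sum>q'<n. if q = q' then w q' else 0)"
    using sys assms by (intro sum.cong) (auto simp: singular_system_def)
  also have "\<dots> = w q" using assms by simp
  finally show ?thesis by simp
qed

lemma singular_system_parseval: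
  "(vnorm n w)\<^sup>2 = (\<Sum>j<n. (cmod (\<Sum>q<n. cnj (v j q) * w q))\<^sup>2)"
proof -
  have "vnorm n w = vnorm n (\<lambda>q. \<Sum>j<n. (\<Sum>q'<n. cnj (v j q') * w q') * v j q)"
    by (rule vnorm_cong) (subst singular_system_expand, auto simp: mult_ac)
  then show ?thesis
    using norm_power2_orthogonal_sum[where J = "{..<n}" and m = n and U = v and d = "\<lambda>_. 1"] sys
    by (simp add: singular_system_def)
qed

lemma singular_system_decomposition:
  assumes "q < n"
  shows "x p q = (\<Sum>j<n. mapply n x (v j) p * cnj (v j q))"
proof -
  have "(\<Sum>j<n. mapply n x (v j) p * cnj (v j q)) = (\<Sum>j<n. \<Sum>q'<n. x p q' * (v j q' * cnj (v j q)))"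
    unfolding mapply_def sum_distrib_right by (simp add: mult_ac)
  also have "\<dots> = (\<Sum>q'<n. x p q' * (\<Sum>j<n. v j q' * cnj (v j q)))"
    unfolding sum_distrib_left by (rule sum.swap)
  also have "\<dots> = (\<Sum>q'<n. if q' = q then x p q' else 0)"
    using sys assms by (intro sum.cong) (auto simp: singular_system_def)
  also have "\<dots> = x p q" using assms by simp
  finally show ?thesis by simp
qed

lemma singular_system_norm:
  assumes J: "J \<subseteq> {..<n}"
  shows "(vnorm m (\<lambda>p. \<Sum>j\<in>J. c j * mapply n x (v j) p))\<^sup>2 = (\<Sum>j\<in>J. (cmod (c j))\<^sup>2 * (s j)\<^sup>2)"
proof (rule norm_power2_orthogonal_sum)
  show "finite J" using J finite_subset by blast
  show "(\<Sum>p<m. cnj (mapply n x (v i) p) * mapply n x (v j) p) = (if i = j then complex_of_real ((s i)\<^sup>2) else 0)"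
    if "i \<in> J" "j \<in> J" for i j
  proof -
    have "i < n" "j < n" using that J by auto
    then show ?thesis using sys by (simp add: singular_system_def)
  qed
qed

lemma singular_system_truncated_op_bound:
  assumes J: "J \<subseteq> {..<n}" and s: "\<And>j. j \<in> J \<Longrightarrow> 0 \<le> s j \<and> s j \<le> S" and S: "0 \<le> S"
  shows "op_bound m n (\<lambda>p q. \<Sum>j\<in>J. mapply n x (v j) p * cnj (v j q)) S"
  unfolding op_bound_def
proof (intro conjI allI S)
  fix w
  define a where "a j = (\<Sum>q<n. cnj (v j q) * w q)" for j
  have "mapply n (\<lambda>p q. \<Sum>j\<in>J. mapply n x (v j) p * cnj (v j q)) w = (\<lambda>p. \<Sum>j\<in>J. a j * mapply n x (v j) p)"
  proof
    fix p
    have "mapply n (\<lambda>p q. \<Sum>j\<in>J. mapply n x (v j) p * cnj (v j q)) w p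
      = (\<Sum>q<n. \<Sum>j\<in>J. mapply n x (v j) p * (cnj (v j q) * w q))"
      unfolding mapply_def[of n "\<lambda>p q. \<Sum>j\<in>J. mapply n x (v j) p * cnj (v j q)"] sum_distrib_right by (simp add: mult_ac)
    also have "\<dots> = (\<Sum>j\<in>J. \<Sum>q<n. mapply n x (v j) p * (cnj (v j q) * w q))" by (rule sum.swap)
    also have "\<dots> = (\<Sum>j\<in>J. a j * mapply n x (v j) p)"
      unfolding a_def sum_distrib_left[symmetric] by (simp add: mult.commute)
    finally show "mapply n (\<lambda>p q. \<Sum>j\<in>J. mapply n x (v j) p * cnj (v j q)) w p = (\<Sum>j\<in>J. a j * mapply n x (v j) p)" .
  qed
  then have "(vnorm m (mapply n (\<lambda>p q. \<Sum>j\<in>J. mapply n x (v j) p * cnj (v j q)) w))\<^sup>2 = (\<Sum>j\<in>J. (cmod (a j))\<^sup>2 * (s j)\<^sup>2)"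
    by (simp only: singular_system_norm[OF J])
  also have "\<dots> \<le> (\<Sum>j\<in>J. (cmod (a j))\<^sup>2 * S\<^sup>2)"
    using s by (intro sum_mono mult_left_mono power_mono) auto
  also have "\<dots> \<le> (\<Sum>j<n. (cmod (a j))\<^sup>2 * S\<^sup>2)" using J by (intro sum_mono2) auto
  also have "\<dots> = (S * vnorm n w)\<^sup>2"
    unfolding power_mult_distrib singular_system_parseval a_def by (simp add: sum_distrib_left mult.commute)
  finally show "vnorm m (mapply n (\<lambda>p q. \<Sum>j\<in>J. mapply n x (v j) p * cnj (v j q)) w) \<le> S * vnorm n w"
    by (rule power2_le_imp_le) (simp add: S)
qed

lemma singular_system_op_bound:
  assumes s: "\<And>j. j < n \<Longrightarrow> 0 \<le> s j \<and> s j \<le> S" and S: "0 \<le> S"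
  shows "op_bound m n x S"
proof -
  have "op_bound m n (\<lambda>p q. \<Sum>j\<in>{..<n}. mapply n x (v j) p * cnj (v j q)) S"
    using s by (intro singular_system_truncated_op_bound S) auto
  then show ?thesis by (subst op_bound_cong) (auto intro: singular_system_decomposition)
qed

text \<open>One half of the Courant-Fischer principle. The first \<open>t + 1\<close> right singular
  vectors span a space on which \<open>x\<close> stretches by at least \<open>s t\<close>, and by
  dimension it contains a nonzero vector killed by the at most \<open>t\<close> functionals.\<close>

lemma singular_value_le:
  fixes hs :: "(nat \<Rightarrow> complex) list"
  assumes t: "t < n" and len: "length hs \<le> t"
    and s: "\<And>j. j \<le> t \<Longrightarrow> s t \<le> s j" "0 \<le> s t"
    and e: "0 \<le> e" "\<And>w. (\<And>h. h \<in> set hs \<Longrightarrow> (\<Sum>q<n. h q * w q) = 0) \<Longrightarrow> vnorm m (mapply n x w) \<le> e * vnorm n w"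
  shows "s t \<le> e"
proof -
  \<comment> \<open>For \<open>i\<close> beyond the length of \<open>hs\<close> the functional
    \<open>hs ! i\<close> is arbitrary; the surplus conditions are harmless since there are only
    \<open>t\<close> in all.\<close>
  obtain c where c: "\<exists>j<Suc t. c j \<noteq> 0" and ker: "\<And>i. i < t \<Longrightarrow> (\<Sum>j<Suc t. (\<Sum>q<n. (hs ! i) q * v j q) * c j) = 0"
    using underdetermined_kernel[of t "\<lambda>i j. \<Sum>q<n. (hs ! i) q * v j q"] by blast
  define w where "w q = (\<Sum>j<Suc t. c j * v j q)" for q
  have J: "{..<Suc t} \<subseteq> {..<n}" using t by auto
  have "(\<Sum>q<n. h q * w q) = 0" if "h \<in> set hs" for h
  proof -
    obtain i where i: "i < length hs" "h = hs ! i" using \<open>h \<in> set hs\<close> by (metis in_set_conv_nth)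
    have "(\<Sum>q<n. h q * w q) = (\<Sum>q<n. \<Sum>j<Suc t. h q * v j q * c j)"
      unfolding w_def sum_distrib_left by (simp add: mult_ac del: sum.lessThan_Suc)
    also have "\<dots> = (\<Sum>j<Suc t. (\<Sum>q<n. h q * v j q) * c j)"
      unfolding sum_distrib_right by (rule sum.swap)
    also have "\<dots> = 0" unfolding i(2) using i len by (intro ker) simp
    finally show ?thesis .
  qed
  then have le: "vnorm m (mapply n x w) \<le> e * vnorm n w" by (rule e(2))
  have nw: "(vnorm n w)\<^sup>2 = (\<Sum>j<Suc t. (cmod (c j))\<^sup>2 * 1)"
    unfolding w_def using sys J by (intro norm_power2_orthogonal_sum) (auto simp: singular_system_def)
  have "mapply n x w = (\<lambda>p. \<Sum>j<Suc t. c j * mapply n x (v j) p)"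
  proof
    fix p
    have "mapply n x w p = (\<Sum>q<n. \<Sum>j<Suc t. c j * (x p q * v j q))"
      unfolding mapply_def w_def sum_distrib_left by (simp add: mult_ac del: sum.lessThan_Suc)
    also have "\<dots> = (\<Sum>j<Suc t. c j * mapply n x (v j) p)"
      unfolding mapply_def sum_distrib_left by (rule sum.swap)
    finally show "mapply n x w p = (\<Sum>j<Suc t. c j * mapply n x (v j) p)" .
  qed
  then have nx: "(vnorm m (mapply n x w))\<^sup>2 = (\<Sum>j<Suc t. (cmod (c j))\<^sup>2 * (s j)\<^sup>2)"
    by (simp only: singular_system_norm[OF J])
  have pos: "0 < (vnorm n w)\<^sup>2"
  proof -
    from c obtain j where j: "j < Suc t" "c j \<noteq> 0" by blast
    then have "0 < (cmod (c j))\<^sup>2 * 1" by simp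
    also have "\<dots> \<le> (vnorm n w)\<^sup>2" unfolding nw using j by (intro member_le_sum) auto
    finally show ?thesis .
  qed
  have "(s t)\<^sup>2 * (vnorm n w)\<^sup>2 \<le> (vnorm m (mapply n x w))\<^sup>2"
    unfolding nw nx sum_distrib_left
  proof (rule sum_mono)
    fix j assume "j \<in> {..<Suc t}"
    then have "(s t)\<^sup>2 \<le> (s j)\<^sup>2" using s by (intro power_mono) auto
    then show "(s t)\<^sup>2 * ((cmod (c j))\<^sup>2 * 1) \<le> (cmod (c j))\<^sup>2 * (s j)\<^sup>2"
      by (simp add: mult.commute[of "(s t)\<^sup>2"] mult_left_mono)
  qed
  also have "\<dots> \<le> e\<^sup>2 * (vnorm n w)\<^sup>2"
    unfolding power_mult_distrib[symmetric] by (intro power_mono le) simp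
  finally have "(s t)\<^sup>2 \<le> e\<^sup>2" using pos by simp
  then show ?thesis by (rule power2_le_imp_le) (rule e(1))
qed

end

subsection \<open>Singular values of solutions of Sylvester equations\<close>

lemma rank_one_solution_approx:
  fixes \<alpha> \<beta> :: "nat \<Rightarrow> real" and a b \<tau> :: real and u v :: "nat \<Rightarrow> complex"
  assumes ab: "0 < a" "a < b"
    and \<alpha>: "\<And>p. p < m \<Longrightarrow> \<alpha> p \<in> {a..b}" and \<beta>: "\<And>q. q < n \<Longrightarrow> \<beta> q \<in> {a..b}"
    and f: "op_bound m n (\<lambda>p q. u p * v q) \<tau>" and k: "0 < k"
    and eq: "\<And>p q. p < m \<Longrightarrow> q < n \<Longrightarrow> u p * v q = - complex_of_real (\<alpha> p + \<beta> q) * x p q"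
  shows "\<exists>hs y. length hs = k \<and> op_bound m n y (4 * exp (pi\<^sup>2 / ln (4 * b / a)) powr (- real k) * (\<tau> / (2 * a))) \<and>
    (\<forall>w. (\<forall>h\<in>set hs. (\<Sum>q<n. h q * w q) = 0) \<longrightarrow> (\<forall>p<m. mapply n x w p = mapply n y w p))"
proof -
  define L where "L = ln (4 * b / a)"
  \<comment> \<open>The bound for \<open>r\<close> at a single point. It acts through the rows and
    through the columns, and \<open>B * B\<close> has the constant 4 and twice the exponent.\<close>
  define B where "B = 2 * exp (- (pi\<^sup>2 * real k / (2 * L)))"
  from zolotarev_bound[OF ab k] obtain s where s: "\<And>j. 0 < s j"
    and sb: "\<And>y. y \<in> {a..b} \<Longrightarrow> \<bar>\<Prod>j<k. (y - s j) / (y + s j)\<bar> \<le> B"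
    unfolding B_def L_def by blast
  define r where "r y = complex_of_real (\<Prod>i<k. (y - s i) / (y + s i))" for y
  have r: "cmod (r y) \<le> B" if "y \<in> {a..b}" for y
    unfolding r_def norm_of_real by (rule sb[OF that])
  have pos: "\<And>p. p < m \<Longrightarrow> 0 < \<alpha> p" "\<And>q. q < n \<Longrightarrow> 0 < \<beta> q" using \<alpha> \<beta> ab by fastforce+
  have "\<exists>h. \<forall>w. (\<forall>i<k. (\<Sum>q<n. h i q * w q) = 0) \<longrightarrow>
    (\<forall>p<m. mapply n x w p = mapply n (\<lambda>p q. r (\<alpha> p) * x p q * r (\<beta> q)) w p)"
    unfolding r_def by (rule rank_one_sylvester_approx[where u = u and v = v]) (fact pos s eq)+
  then obtain h where h: "\<And>w p. (\<forall>i<k. (\<Sum>q<n. h i q * w q) = 0) \<Longrightarrow> p < m \<Longrightarrow>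
      mapply n x w p = mapply n (\<lambda>p q. r (\<alpha> p) * x p q * r (\<beta> q)) w p"
    by blast
  have B0: "0 \<le> B" by (simp add: B_def)
  have "op_bound m n x (\<tau> / (2 * a))" by (rule sylvester_op_bound[OF ab \<alpha> \<beta> f eq])
  then have "op_bound m n (\<lambda>p q. r (\<alpha> p) * x p q * r (\<beta> q)) (B * (\<tau> / (2 * a)) * B)"
    by (rule op_bound_scale) (use r \<alpha> \<beta> B0 in blast)+
  moreover have "B * (\<tau> / (2 * a)) * B = 4 * exp (pi\<^sup>2 / L) powr (- real k) * (\<tau> / (2 * a))"
  proof -
    have "exp (- (pi\<^sup>2 * real k / (2 * L))) * exp (- (pi\<^sup>2 * real k / (2 * L))) = exp (pi\<^sup>2 / L) powr (- real k)"
      unfolding powr_def exp_add[symmetric] by simp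
    moreover have "2 * z * w * (2 * z) = 4 * (z * z) * w" for z w :: real by simp
    ultimately show ?thesis unfolding B_def by (simp only:)
  qed
  ultimately show ?thesis
    unfolding L_def
    by (intro exI[of _ "map h [0..<k]"] exI[of _ "\<lambda>p q. r (\<alpha> p) * x p q * r (\<beta> q)"] conjI allI impI h) auto
qed

lemma sum_triangle:
  fixes k :: nat
  shows "(\<Sum>j<k. k - j) = k * (k + 1) div 2"
proof -
  have "(\<Sum>j<k. k - j) = (\<Sum>j<k. Suc j)"
    by (subst sum.nat_diff_reindex[symmetric]) (intro sum.cong, auto)
  also have "\<dots> = k * (k + 1) div 2" by (induction k) auto
  finally show ?thesis .
qed

lemma diagonal_singular_value_bound:
  fixes \<alpha> \<beta> :: "nat \<Rightarrow> real" and a b K \<mu> :: real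
  assumes ab: "0 < a" "a < b"
    and \<alpha>: "\<And>p. p < m \<Longrightarrow> \<alpha> p \<in> {a..b}" and \<beta>: "\<And>q. q < n \<Longrightarrow> \<beta> q \<in> {a..b}"
    and eq: "\<And>p q. p < m \<Longrightarrow> q < n \<Longrightarrow> f p q = - complex_of_real (\<alpha> p + \<beta> q) * x p q"
    and sf: "singular_system m n f \<tau> v" and \<tau>: "\<And>j. 0 \<le> \<tau> j" "\<And>i j. i \<le> j \<Longrightarrow> \<tau> j \<le> \<tau> i"
    and sx: "singular_system m n x \<sigma> v'" and \<sigma>: "\<And>j. 0 \<le> \<sigma> j" "\<And>i j. i \<le> j \<Longrightarrow> \<sigma> j \<le> \<sigma> i"
  defines "\<mu> \<equiv> exp (pi\<^sup>2 / ln (4 * b / a))"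
  assumes K: "0 \<le> K" and decay: "\<And>j. j < n \<Longrightarrow> \<tau> j \<le> K * \<mu> powr (- real j) * \<tau> 0"
    and t: "t = k * (k + 1) div 2" "t < n"
  shows "\<sigma> t \<le> K * b / a * (4 * real k + 1) * \<mu> powr (- real k) * \<sigma> 0"
proof -
  have n: "0 < n" using t by simp
  have "k \<le> t" unfolding t by (cases k) auto
  then have kn: "k < n" using t by simp
  \<comment> \<open>The solution of the diagonalized equation with right-hand side \<open>g\<close>.
    It is linear in \<open>g\<close>, so splitting \<open>f\<close> splits \<open>x\<close>.\<close>
  define X where "X g p q = - g p q / complex_of_real (\<alpha> p + \<beta> q)" for g :: "nat \<Rightarrow> nat \<Rightarrow> complex" and p q
  have nz: "complex_of_real (\<alpha> p + \<beta> q) \<noteq> 0" if "p < m" "q < n" for p q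
    using \<alpha>[OF that(1)] \<beta>[OF that(2)] ab by (simp only: of_real_eq_0_iff) auto
  have X: "g p q = - complex_of_real (\<alpha> p + \<beta> q) * X g p q" if "p < m" "q < n" for g p q
    using nz[OF that] by (simp add: X_def del: of_real_add)
  define u where "u j = mapply n f (v j)" for j
  define tail where "tail = (\<lambda>p q. \<Sum>j\<in>{k..<n}. u j p * cnj (v j q))"
  have fj: "op_bound m n (\<lambda>p q. u j p * cnj (v j q)) (\<tau> j)" if "j < n" for j
    using singular_system_truncated_op_bound[OF sf, of "{j}" "\<tau> j"] that \<tau> by (simp add: u_def)
  have ftail: "op_bound m n tail (\<tau> k)"
    unfolding tail_def u_def using \<tau> by (intro singular_system_truncated_op_bound[OF sf]) auto
  define e where "e j = 4 * \<mu> powr (- real (k - j)) * (\<tau> j / (2 * a))" for j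
  have "\<forall>j. \<exists>hs y. j < k \<longrightarrow> length hs = k - j \<and> op_bound m n y (e j) \<and>
    (\<forall>w. (\<forall>h\<in>set hs. (\<Sum>q<n. h q * w q) = 0) \<longrightarrow> (\<forall>p<m. mapply n (X (\<lambda>p q. u j p * cnj (v j q))) w p = mapply n y w p))"
  proof
    fix j
    show "\<exists>hs y. j < k \<longrightarrow> length hs = k - j \<and> op_bound m n y (e j) \<and>
      (\<forall>w. (\<forall>h\<in>set hs. (\<Sum>q<n. h q * w q) = 0) \<longrightarrow> (\<forall>p<m. mapply n (X (\<lambda>p q. u j p * cnj (v j q))) w p = mapply n y w p))"
    proof (cases "j < k")
      case True
      then have "0 < k - j" "j < n" using kn by auto
      from rank_one_solution_approx[where u = "u j" and v = "\<lambda>q. cnj (v j q)"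
          and x = "X (\<lambda>p q. u j p * cnj (v j q))", OF ab \<alpha> \<beta> fj[OF this(2)] this(1) X[where g = "\<lambda>p q. u j p * cnj (v j q)"]]
      show ?thesis
        unfolding e_def \<mu>_def by blast
    qed simp
  qed
  then obtain hs y where hy: "\<And>j. j < k \<Longrightarrow> length (hs j) = k - j" "\<And>j. j < k \<Longrightarrow> op_bound m n (y j) (e j)"
    "\<And>j w p. j < k \<Longrightarrow> (\<forall>h\<in>set (hs j). (\<Sum>q<n. h q * w q) = 0) \<Longrightarrow> p < m \<Longrightarrow>
       mapply n (X (\<lambda>p q. u j p * cnj (v j q))) w p = mapply n (y j) w p"
    unfolding choice_iff by blast
  define E where "E = (\<Sum>j<k. e j) + \<tau> k / (2 * a)"
  have "op_bound m n (X tail) (\<tau> k / (2 * a))" by (rule sylvester_op_bound[OF ab \<alpha> \<beta> ftail X[where g = tail]])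
  then have bound: "op_bound m n (\<lambda>p q. (\<Sum>j<k. y j p q) + X tail p q) E"
    unfolding E_def by (intro op_bound_add op_bound_sum hy) auto
  have xdec: "x p q = (\<Sum>j<k. X (\<lambda>p q. u j p * cnj (v j q)) p q) + X tail p q" if pq: "p < m" "q < n" for p q
  proof -
    have "f p q = (\<Sum>j<n. u j p * cnj (v j q))" unfolding u_def by (rule singular_system_decomposition[OF sf pq(2)])
    also have "{..<n} = {..<k} \<union> {k..<n}" using kn by auto
    also have "(\<Sum>j\<in>{..<k} \<union> {k..<n}. u j p * cnj (v j q)) = (\<Sum>j<k. u j p * cnj (v j q)) + tail p q"
      unfolding tail_def by (rule sum.union_disjoint) auto
    finally have "X f p q = - ((\<Sum>j<k. u j p * cnj (v j q)) + tail p q) / complex_of_real (\<alpha> p + \<beta> q)" by (simp only: X_def)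
    also have "\<dots> = (\<Sum>j<k. X (\<lambda>p q. u j p * cnj (v j q)) p q) + X tail p q"
      unfolding X_def by (simp add: sum_divide_distrib sum_negf add_divide_distrib diff_divide_distrib)
    also have "X f p q = x p q" using nz[OF pq] unfolding X_def eq[OF pq] by (simp del: of_real_add)
    finally show ?thesis .
  qed
  have "\<sigma> t \<le> E"
  proof (rule singular_value_le[OF sx t(2)])
    show "length (concat (map hs [0..<k])) \<le> t"
    proof -
      have "length (concat (map hs [0..<k])) = (\<Sum>j<k. length (hs j))"
        by (simp add: length_concat o_def interv_sum_list_conv_sum_set_nat lessThan_atLeast0)
      also have "\<dots> = (\<Sum>j<k. k - j)" by (intro sum.cong) (auto simp: hy(1))
      also have "\<dots> = t" unfolding t by (rule sum_triangle)
      finally show ?thesis by simp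
    qed
    show "0 \<le> E" by (rule op_bound_nonneg[OF bound])
    fix w assume w: "\<And>h. h \<in> set (concat (map hs [0..<k])) \<Longrightarrow> (\<Sum>q<n. h q * w q) = 0"
    have w': "(\<Sum>q<n. h q * w q) = 0" if "j < k" "h \<in> set (hs j)" for j h
      by (rule w) (use that in auto)
    have "mapply n x w p = mapply n (\<lambda>p q. (\<Sum>j<k. y j p q) + X tail p q) w p" if p: "p < m" for p
    proof -
      have sw: "mapply n (\<lambda>p q. (\<Sum>j<k. g j p q) + X tail p q) w p = (\<Sum>j<k. mapply n (g j) w p) + mapply n (X tail) w p" for g :: "nat \<Rightarrow> nat \<Rightarrow> nat \<Rightarrow> complex"
        unfolding mapply_def distrib_right sum.distrib sum_distrib_right by (simp add: sum.swap[of _ "{..<k}"])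
      have "mapply n x w p = mapply n (\<lambda>p q. (\<Sum>j<k. X (\<lambda>p q. u j p * cnj (v j q)) p q) + X tail p q) w p"
        unfolding mapply_def by (intro sum.cong) (auto simp: xdec[OF p])
      also have "\<dots> = (\<Sum>j<k. mapply n (y j) w p) + mapply n (X tail) w p"
        unfolding sw using w' p by (intro arg_cong2[where f = "(+)"] sum.cong refl hy(3)) auto
      also have "\<dots> = mapply n (\<lambda>p q. (\<Sum>j<k. y j p q) + X tail p q) w p" by (rule sw[symmetric])
      finally show ?thesis .
    qed
    then have "vnorm m (mapply n x w) = vnorm m (mapply n (\<lambda>p q. (\<Sum>j<k. y j p q) + X tail p q) w)"
      by (rule vnorm_cong)
    then show "vnorm m (mapply n x w) \<le> E * vnorm n w" using op_boundD[OF bound, of w] by simp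
  qed (use \<sigma> in auto)
  also have "E \<le> K * \<mu> powr (- real k) * \<tau> 0 * (4 * real k + 1) / (2 * a)"
  proof -
    have "e j \<le> 4 * (K * \<mu> powr (- real k) * \<tau> 0) / (2 * a)" if j: "j < k" for j
    proof -
      have "e j \<le> 4 * \<mu> powr (- real (k - j)) * (K * \<mu> powr (- real j) * \<tau> 0 / (2 * a))"
        unfolding e_def using decay[of j] j kn ab by (intro mult_left_mono divide_right_mono) auto
      also have "\<dots> = 4 * (K * (\<mu> powr (- real (k - j)) * \<mu> powr (- real j)) * \<tau> 0) / (2 * a)" by simp
      also have "\<mu> powr (- real (k - j)) * \<mu> powr (- real j) = \<mu> powr (- real k)"
        using j by (simp add: of_nat_diff flip: powr_add)
      finally show ?thesis .
    qed
    then have "(\<Sum>j<k. e j) \<le> real (card {..<k}) * (4 * (K * \<mu> powr (- real k) * \<tau> 0) / (2 * a))"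
      by (intro sum_bounded_above) (simp only: lessThan_iff)
    then have "(\<Sum>j<k. e j) \<le> real k * (4 * (K * \<mu> powr (- real k) * \<tau> 0) / (2 * a))"
      by (simp only: card_lessThan)
    moreover have "\<tau> k / (2 * a) \<le> K * \<mu> powr (- real k) * \<tau> 0 / (2 * a)"
      using decay[OF kn] ab by (intro divide_right_mono) auto
    ultimately have "E \<le> real k * (4 * (K * \<mu> powr (- real k) * \<tau> 0) / (2 * a)) + K * \<mu> powr (- real k) * \<tau> 0 / (2 * a)"
      unfolding E_def by linarith
    also have "\<dots> = K * \<mu> powr (- real k) * \<tau> 0 * (4 * real k + 1) / (2 * a)"
      by (simp add: algebra_simps add_divide_distrib)
    finally show ?thesis .
  qed
  also have "\<dots> \<le> K * \<mu> powr (- real k) * (2 * b * \<sigma> 0) * (4 * real k + 1) / (2 * a)"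
  proof -
    have xb: "op_bound m n x (\<sigma> 0)"
      using \<sigma> by (intro singular_system_op_bound[OF sx]) auto
    have "op_bound m n (\<lambda>p q. complex_of_real (- \<alpha> p) * x p q * 1) (b * \<sigma> 0 * 1)"
      using \<alpha> ab by (intro op_bound_scale[OF xb]) force+
    moreover have "op_bound m n (\<lambda>p q. 1 * x p q * complex_of_real (- \<beta> q)) (1 * \<sigma> 0 * b)"
      using \<beta> ab by (intro op_bound_scale[OF xb]) force+
    ultimately have "op_bound m n (\<lambda>p q. complex_of_real (- \<alpha> p) * x p q * 1 + 1 * x p q * complex_of_real (- \<beta> q)) (b * \<sigma> 0 * 1 + 1 * \<sigma> 0 * b)"
      by (rule op_bound_add)
    then have fb: "op_bound m n f (2 * b * \<sigma> 0)"
      by (subst op_bound_cong[where y = "\<lambda>p q. complex_of_real (- \<alpha> p) * x p q * 1 + 1 * x p q * complex_of_real (- \<beta> q)"])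
        (auto simp: eq algebra_simps)
    \<comment> \<open>With no functionals and \<open>t = 0\<close>, the min-max bound says that the
      largest singular value is at most any operator bound.\<close>
    have "\<tau> 0 \<le> 2 * b * \<sigma> 0"
    proof (rule singular_value_le[OF sf n, where hs = "[]"])
      show "0 \<le> 2 * b * \<sigma> 0" by (rule op_bound_nonneg[OF fb])
      show "vnorm m (mapply n f w) \<le> 2 * b * \<sigma> 0 * vnorm n w" for w by (rule op_boundD[OF fb])
    qed (use \<tau> in auto)
    then show ?thesis using K ab by (intro divide_right_mono mult_right_mono mult_left_mono) auto
  qed
  also have "\<dots> = K * b / a * (4 * real k + 1) * \<mu> powr (- real k) * \<sigma> 0"
    using ab by (simp add: field_simps)
  finally show ?thesis .
qed

section \<open>Reduction to diagonal coefficients\<close>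

text \<open>The left unitary factor cancels in the Gram matrix and the right one conjugates it, so
  the characteristic polynomial is unchanged.\<close>

lemma sing_vals_unitary:
  fixes X U V :: "complex mat"
  assumes X: "X \<in> carrier_mat m n" and U: "U \<in> carrier_mat m m" and V: "V \<in> carrier_mat n n"
    and UU: "U * mat_adjoint U = 1\<^sub>m m" and VV: "V * mat_adjoint V = 1\<^sub>m n"
  shows "sing_vals (mat_adjoint U * X * V) = sing_vals X"
proof -
  have U': "mat_adjoint U \<in> carrier_mat m m" and V': "mat_adjoint V \<in> carrier_mat n n"
    and X': "mat_adjoint X \<in> carrier_mat n m" and UX: "mat_adjoint U * X \<in> carrier_mat m n"
    and H: "mat_adjoint X * X \<in> carrier_mat n n"
    using U V X by auto
  have VV': "mat_adjoint V * V = 1\<^sub>m n" by (rule mat_mult_left_right_inverse[OF V V' VV])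
  have "mat_adjoint (mat_adjoint U * X * V) = mat_adjoint V * mat_adjoint X * U"
    unfolding mat_adjoint_mult[OF UX V] mat_adjoint_mult[OF U' X] mat_adjoint_adjoint
    by (rule assoc_mult_mat[OF V' X' U, symmetric])
  then have "mat_adjoint (mat_adjoint U * X * V) * (mat_adjoint U * X * V) = mat_adjoint V * (mat_adjoint X * X) * V"
    using unitary_conj_mult[OF V' X' U U' X V UU] by simp
  moreover have "similar_mat (mat_adjoint V * (mat_adjoint X * X) * V) (mat_adjoint X * X)"
    by (rule similar_matI[of _ _ "mat_adjoint V" V n]) (use V V' H VV VV' in auto)
  ultimately show ?thesis
    unfolding sing_vals_def by (metis char_poly_similar)
qed

lemma unitary_diagonalization_eigenvalues:
  fixes A :: "complex mat"
  assumes A: "A \<in> carrier_mat n n" and normal: "normal_mat A"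
  shows "\<exists>U d. U \<in> carrier_mat n n \<and> U * mat_adjoint U = 1\<^sub>m n \<and>
    mat_adjoint U * A * U = mat n n (\<lambda>(i, j). if i = j then d i else 0) \<and> (\<forall>i<n. eigenvalue A (d i))"
proof -
  from char_poly_factorized[OF A] obtain es where es: "char_poly A = (\<Prod>e\<leftarrow>es. [:- e, 1:])" by blast
  from unitary_diagonalization[OF A normal es] obtain U where U: "U \<in> carrier_mat n n"
    and UU: "mat_adjoint U * U = 1\<^sub>m n" and len: "length es = n"
    and D: "mat_adjoint U * A * U = mat n n (\<lambda>(i, j). if i = j then es ! i else 0)" by blast
  have "eigenvalue A (es ! i)" if "i < n" for i
  proof -
    have "es ! i \<in> set es" using that len by simp
    then have "poly (char_poly A) (es ! i) = 0"
      unfolding es poly_prod_list by (auto simp: prod_list_zero_iff)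
    then show ?thesis by (simp add: eigenvalue_root_char_poly[OF A])
  qed
  then show ?thesis
    using U D mat_mult_left_right_inverse[OF mat_adjoint_carrier[OF U] U UU]
    by (intro exI[of _ U] exI[of _ "\<lambda>i. es ! i"]) simp
qed

lemma index_diag_mult:
  fixes X :: "complex mat"
  assumes X: "X \<in> carrier_mat m n" and pq: "p < m" "q < n"
  shows "(mat m m (\<lambda>(i, j). if i = j then d i else 0) * X) $$ (p, q) = d p * X $$ (p, q)"
    and "(X * mat n n (\<lambda>(i, j). if i = j then d i else 0)) $$ (p, q) = X $$ (p, q) * d q"
proof -
  have "(mat m m (\<lambda>(i, j). if i = j then d i else 0) * X) $$ (p, q) = (\<Sum>l<m. if l = p then d p * X $$ (p, q) else 0)"
    unfolding index_mult_mat_sum[OF mat_carrier X pq] using pq by (intro sum.cong) auto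
  then show "(mat m m (\<lambda>(i, j). if i = j then d i else 0) * X) $$ (p, q) = d p * X $$ (p, q)" using pq by simp
  have "(X * mat n n (\<lambda>(i, j). if i = j then d i else 0)) $$ (p, q) = (\<Sum>l<n. if l = q then X $$ (p, q) * d q else 0)"
    unfolding index_mult_mat_sum[OF X mat_carrier pq] using pq by (intro sum.cong) auto
  then show "(X * mat n n (\<lambda>(i, j). if i = j then d i else 0)) $$ (p, q) = X $$ (p, q) * d q" using pq by simp
qed

theorem theorem6:
  fixes m n :: nat and A B X F :: "complex mat" and a b K :: real
  assumes "n \<le> m"
    and "A \<in> carrier_mat m m" and "B \<in> carrier_mat n n"
    and "X \<in> carrier_mat m n" and "F \<in> carrier_mat m n"
    and "normal_mat A" and "normal_mat B"
    and "A * X - X * B = F"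
    and "0 < a" and "a < b"
    and "\<And>e. eigenvalue A e \<Longrightarrow> e \<in> complex_of_real ` {-b..-a}"
    and "\<And>e. eigenvalue B e \<Longrightarrow> e \<in> complex_of_real ` {a..b}"
    and "K \<ge> 1"
    and "\<And>j. j < n \<Longrightarrow>
           sigma (j + 1) F \<le> K * exp (pi\<^sup>2 / ln (4 * b / a)) powr (- real j) * spec_norm F"
  shows "\<forall>k t. k \<ge> 1 \<longrightarrow> t = k * (k + 1) div 2 \<longrightarrow> 1 \<le> t \<longrightarrow> t < n \<longrightarrow>
           sigma (t + 1) X \<le> K * b / a * (6 * sqrt (real t) + 1)
             * exp (pi\<^sup>2 / ln (4 * b / a)) powr (- (sqrt (8 * real t + 1) - 1) / 2)
             * spec_norm X"
proof (intro allI impI)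
  fix k t :: nat assume t: "t = k * (k + 1) div 2" "t < n"
  note A = assms(2) and B = assms(3) and X = assms(4) and F = assms(5)
  obtain U d where U: "U \<in> carrier_mat m m" and UU: "U * mat_adjoint U = 1\<^sub>m m"
    and DA: "mat_adjoint U * A * U = mat m m (\<lambda>(i, j). if i = j then d i else 0)" and eA: "\<And>i. i < m \<Longrightarrow> eigenvalue A (d i)"
    using unitary_diagonalization_eigenvalues[OF A assms(6)] by blast
  obtain V d' where V: "V \<in> carrier_mat n n" and VV: "V * mat_adjoint V = 1\<^sub>m n"
    and DB: "mat_adjoint V * B * V = mat n n (\<lambda>(i, j). if i = j then d' i else 0)" and eB: "\<And>i. i < n \<Longrightarrow> eigenvalue B (d' i)"
    using unitary_diagonalization_eigenvalues[OF B assms(7)] by blast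
  \<comment> \<open>The spectrum of \<open>A\<close> is negative. The change of sign puts both
    families into \<open>{a..b}\<close> and turns the difference of eigenvalues into
    \<open>- (\<alpha> p + \<beta> q)\<close>.\<close>
  define \<alpha> where "\<alpha> p = - Re (d p)" for p
  define \<beta> where "\<beta> q = Re (d' q)" for q
  have \<alpha>: "\<alpha> p \<in> {a..b}" "d p = - complex_of_real (\<alpha> p)" if "p < m" for p
    using assms(11)[OF eA[OF that]] by (auto simp: \<alpha>_def)
  have \<beta>: "\<beta> q \<in> {a..b}" "d' q = complex_of_real (\<beta> q)" if "q < n" for q
    using assms(12)[OF eB[OF that]] by (auto simp: \<beta>_def)
  let ?U' = "mat_adjoint U" and ?V' = "mat_adjoint V"
  have U': "?U' \<in> carrier_mat m m" and V': "?V' \<in> carrier_mat n n"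
    and AX: "A * X \<in> carrier_mat m n" and XB: "X * B \<in> carrier_mat m n"
    and UAX: "?U' * (A * X) \<in> carrier_mat m n" and UXB: "?U' * (X * B) \<in> carrier_mat m n"
    using A B X U V by auto
  define X' where "X' = ?U' * X * V"
  define F' where "F' = ?U' * F * V"
  have X': "X' \<in> carrier_mat m n" and F': "F' \<in> carrier_mat m n"
    using U V X F by (auto simp: X'_def F'_def)
  have "F' = ?U' * (A * X) * V - ?U' * (X * B) * V"
    unfolding F'_def assms(8)[symmetric] mult_minus_distrib_mat[OF U' AX XB] minus_mult_distrib_mat[OF UAX UXB V] ..
  also have "?U' * (A * X) * V = mat m m (\<lambda>(i, j). if i = j then d i else 0) * X'"
    unfolding X'_def DA[symmetric] by (rule unitary_conj_mult[OF U' A U U' X V UU, symmetric])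
  also have "?U' * (X * B) * V = X' * mat n n (\<lambda>(i, j). if i = j then d' i else 0)"
    unfolding X'_def DB[symmetric] by (rule unitary_conj_mult[OF U' X V V' B V VV, symmetric])
  finally have F'eq: "F' = mat m m (\<lambda>(i, j). if i = j then d i else 0) * X' - X' * mat n n (\<lambda>(i, j). if i = j then d' i else 0)" .
  have eq: "F' $$ (p, q) = - complex_of_real (\<alpha> p + \<beta> q) * X' $$ (p, q)" if "p < m" "q < n" for p q
  proof -
    have "F' $$ (p, q) = d p * X' $$ (p, q) - X' $$ (p, q) * d' q"
      unfolding F'eq using X' that index_diag_mult[OF X' that] by (subst index_minus_mat) auto
    also have "\<dots> = - complex_of_real (\<alpha> p + \<beta> q) * X' $$ (p, q)"
      unfolding \<alpha>(2)[OF that(1)] \<beta>(2)[OF that(2)] by (simp add: algebra_simps)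
    finally show ?thesis .
  qed
  have sF: "sigma j F' = sigma j F" and sX: "sigma j X' = sigma j X" for j
    unfolding sigma_def F'_def X'_def sing_vals_unitary[OF F U V UU VV] sing_vals_unitary[OF X U V UU VV] by auto
  obtain v where v: "singular_system m n (\<lambda>p q. F' $$ (p, q)) (\<lambda>i. sigma (i + 1) F') v"
    using singular_system_exists[OF F'] by blast
  obtain v' where v': "singular_system m n (\<lambda>p q. X' $$ (p, q)) (\<lambda>i. sigma (i + 1) X') v'"
    using singular_system_exists[OF X'] by blast
  let ?\<mu> = "exp (pi\<^sup>2 / ln (4 * b / a))"
  have main: "sigma (t + 1) X' \<le> K * b / a * (4 * real k + 1) * ?\<mu> powr (- real k) * sigma (0 + 1) X'"
  proof (rule diagonal_singular_value_bound[OF assms(9,10) \<alpha>(1) \<beta>(1) eq v _ _ v' _ _ _ _ t])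
    show "sigma (j + 1) F' \<le> K * ?\<mu> powr (- real j) * sigma (0 + 1) F'" if "j < n" for j
      using assms(14)[OF that] by (simp add: sF spec_norm_def)
  qed (use assms(13) sigma_nonneg[OF F'] sigma_nonneg[OF X'] in \<open>auto intro: sigma_antimono[OF F'] sigma_antimono[OF X']\<close>)
  have kt: "real t = real k * (real k + 1) / 2"
  proof -
    have "even (k * (k + 1))" by simp
    then have "2 * t = k * (k + 1)" unfolding t by simp
    then have "2 * real t = real k * (real k + 1)" by (metis of_nat_mult of_nat_numeral of_nat_Suc Suc_eq_plus1 add.commute)
    then show ?thesis by simp
  qed
  \<comment> \<open>For triangular \<open>t\<close>, the number \<open>8 * t + 1\<close> is the
    square of \<open>2 * k + 1\<close>, so the exponent in the claim is exactly
    \<open>- k\<close>.\<close>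
  have "sqrt (8 * real t + 1) = 2 * real k + 1"
    unfolding kt by (rule real_sqrt_unique) (auto simp: power2_eq_square algebra_simps)
  then have exponent: "- (sqrt (8 * real t + 1) - 1) / 2 = - real k" by simp
  \<comment> \<open>After squaring, this compares \<open>16 * k\<^sup>2\<close> with
    \<open>36 * t = 18 * k * (k + 1)\<close>.\<close>
  have "4 * real k \<le> 6 * sqrt (real t)"
  proof (rule power2_le_imp_le)
    have "(4 * real k)\<^sup>2 \<le> 36 * real t" unfolding kt by (simp add: power2_eq_square field_simps)
    then show "(4 * real k)\<^sup>2 \<le> (6 * sqrt (real t))\<^sup>2" by (simp add: power_mult_distrib)
  qed simp
  then have "K * b / a * (4 * real k + 1) \<le> K * b / a * (6 * sqrt (real t) + 1)"
    using assms(9,10,13) by (intro mult_left_mono) auto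
  then have "K * b / a * (4 * real k + 1) * ?\<mu> powr (- real k) * sigma 1 X
      \<le> K * b / a * (6 * sqrt (real t) + 1) * ?\<mu> powr (- real k) * sigma 1 X"
    by (intro mult_right_mono sigma_nonneg[OF X]) auto
  then show "sigma (t + 1) X \<le> K * b / a * (6 * sqrt (real t) + 1)
      * ?\<mu> powr (- (sqrt (8 * real t + 1) - 1) / 2) * spec_norm X"
    using main unfolding exponent spec_norm_def sX by simp
qed

end
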